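(* Let $(\mathcal{M},c)$ be a cocomplete and complete coabelian braided monoidal category satisfying AB5, and assume that the tensor product commutes with direct sums. Let $H$ be a braided bialgebra in $(\mathcal{M},c)$, let $(M,\mu_M^r,\mu_M^l,\rho_M^r,\rho_M^l)$ be an object of ${}_H^H\mathcal{M}_H^H$, and let $T^c=T_H^c(M)$ be the cotensor coalgebra, with canonical projections $p_n:T^c\to M^{\square_Hn}$. Then there are unique coalgebra homomorphisms $$m_{T^c}:T^c\otimes T^c\to T^c\qquad\text{and}\qquad u_{T^c}:\mathbf{1}\to T^c$$ such that $$p_0\,m_{T^c}=m_H(p_0\otimes p_0),\qquad p_1\,m_{T^c}=\mu_M^l(p_0\otimes p_1)+\mu_M^r(p_1\otimes p_0),$$ $$p_0\,u_{T^c}=u_H,\qquad p_1\,u_{T^c}=0.$$ Moreover $(T^c,m_{T^c},u_{T^c},\Delta_{T^c},\varepsilon_{T^c})$ is a graded braided bialgebra in $\mathcal{M}$.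
   Context: Monoidal categories: associativity constraints are suppressed. A monoidal category $\mathcal{M}$ is coabelian monoidal if $\mathcal{M}$ is abelian and all functors $X\otimes(-)$ and $(-)\otimes X$ are additive and left exact. $c$ denotes the braiding. Graded objects: a graded object is $X=\bigoplus_{n\in\mathbb{N}}X_n$ with canonical injections $i_n$ and projections $p_n$; $(X\otimes Y)_n=\bigoplus_{a+b=n}X_a\otimes Y_b$. A graded (co)algebra is a (co)algebra whose underlying object is graded and whose (co)multiplication is a graded morphism. Braided bialgebra: $(H,m,u,\Delta,\varepsilon)$ with $(H,m,u)$ an algebra, $(H,\Delta,\varepsilon)$ a coalgebra in $\mathcal{M}$, such that $\Delta m=(m\otimes m)(H\otimes c_{H,H}\otimes H)(\Delta\otimes\Delta)$, $\varepsilon m=m_{\mathbf 1}(\varepsilon\otimes\varepsilon)$ (where $m_{\mathbf 1}:\mathbf1\otimes\mathbf1\to\mathbf1$ is the unit constraint), $\Delta u=(u\otimes u)m_{\mathbf 1}^{-1}$ and $\varepsilon u=\mathrm{Id}_{\mathbf 1}$. A graded braided bialgebra is a braided bialgebra with a grading making it both a graded algebra and a graded coalgebra. Hopf bimodules: an object of ${}_H^H\mathcal{M}_H^H$ is $(M,\mu_M^r,\mu_M^l,\rho_M^r,\rho_M^l)$ with $(M,\mu_M^r,\mu_M^l)$ an $H$-bimodule, $(M,\rho_M^r,\rho_M^l)$ an $H$-bicomodule and $\rho^l_M\mu^l_M=(m_H\otimes\mu_M^l)(H\otimes c_{H,H}\otimes M)(\Delta_H\otimes\rho_M^l)$, $\rho^l_M\mu^r_M=(m_H\otimes\mu_M^r)(H\otimes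 c_{M,H}\otimes H)(\rho_M^l\otimes\Delta_H)$, $\rho^r_M\mu^l_M=(\mu_M^l\otimes m_H)(H\otimes c_{H,M}\otimes H)(\Delta_H\otimes\rho_M^r)$, $\rho^r_M\mu^r_M=(\mu_M^r\otimes m_H)(M\otimes c_{H,H}\otimes H)(\rho_M^r\otimes\Delta_H)$. Cotensor coalgebra: $V\square_HW$ is the equalizer of $\rho_V\otimes W,\ V\otimes\rho_W:V\otimes W\to V\otimes H\otimes W$. $T^c_H(M)=\bigoplus_{n}M^{\square_Hn}$ with $M^{\square_H0}=H$, graded coalgebra with components $\Delta_{m,n}:M^{\square_H(m+n)}\cong M^{\square_Hm}\square_HM^{\square_Hn}\hookrightarrow M^{\square_Hm}\otimes M^{\square_Hn}$ of the comultiplication $\Delta_{T^c}$, and counit $\varepsilon_{T^c}=\varepsilon_Hp_0$. Coalgebra structures: for a coalgebra $C$, $C\otimes C$ is a coalgebra via $(C\otimes c_{C,C}\otimes C)(\Delta_C\otimes\Delta_C)$ and $m_{\mathbf 1}(\varepsilon_C\otimes\varepsilon_C)$; $\mathbf1$ is a coalgebra via $m_{\mathbf 1}^{-1}$ and $\mathrm{Id}_{\mathbf 1}$. *)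

theory Defs
  imports "HOL-Algebra.FiniteProduct"
begin

section \<open>Categories, functors, limits and colimits\<close>

record ('o, 'a) category =
  Ob :: "'o set"
  Ar :: "'a set"
  Dom :: "'a \<Rightarrow> 'o"
  Cod :: "'a \<Rightarrow> 'o"
  ident :: "'o \<Rightarrow> 'a" ("\<^bold>1\<index>")
  compose :: "'a \<Rightarrow> 'a \<Rightarrow> 'a" (infixr "\<cdot>\<index>" 70)

definition Hom :: "('o, 'a, 'z) category_scheme \<Rightarrow> 'o \<Rightarrow> 'o \<Rightarrow> 'a set" where
  "Hom C A B = {f \<in> Ar C. Dom C f = A \<and> Cod C f = B}"

locale category =
  fixes C :: "('o, 'a, 'z) category_scheme" (structure)
  assumes Dom_Ob: "f \<in> Ar C \<Longrightarrow> Dom C f \<in> Ob C"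
    and Cod_Ob: "f \<in> Ar C \<Longrightarrow> Cod C f \<in> Ob C"
    and ident_Hom: "A \<in> Ob C \<Longrightarrow> \<^bold>1 A \<in> Hom C A A"
    and compose_Hom: "\<lbrakk>f \<in> Hom C A B; g \<in> Hom C B D\<rbrakk> \<Longrightarrow> g \<cdot> f \<in> Hom C A D"
    and ident_left: "f \<in> Hom C A B \<Longrightarrow> \<^bold>1 B \<cdot> f = f"
    and ident_right: "f \<in> Hom C A B \<Longrightarrow> f \<cdot> \<^bold>1 A = f"
    and compose_assoc: "\<lbrakk>f \<in> Hom C A B; g \<in> Hom C B D; h \<in> Hom C D E\<rbrakk>
        \<Longrightarrow> (h \<cdot> g) \<cdot> f = h \<cdot> (g \<cdot> f)"

context
  fixes C :: "('o, 'a, 'z) category_scheme" (structure)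
begin

definition are_inverse :: "'a \<Rightarrow> 'a \<Rightarrow> bool" where
  "are_inverse f g \<longleftrightarrow> f \<in> Ar C \<and> g \<in> Hom C (Cod C f) (Dom C f)
     \<and> g \<cdot> f = \<^bold>1 (Dom C f) \<and> f \<cdot> g = \<^bold>1 (Cod C f)"

definition is_iso :: "'a \<Rightarrow> bool" where
  "is_iso f \<longleftrightarrow> (\<exists>g. are_inverse f g)"

definition inverse_ar :: "'a \<Rightarrow> 'a" where
  "inverse_ar f = (THE g. are_inverse f g)"

definition monic :: "'a \<Rightarrow> bool" where
  "monic f \<longleftrightarrow> f \<in> Ar C \<and>
     (\<forall>X. \<forall>g \<in> Hom C X (Dom C f). \<forall>h \<in> Hom C X (Dom C f). f \<cdot> g = f \<cdot> h \<longrightarrow> g = h)"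

definition epic :: "'a \<Rightarrow> bool" where
  "epic f \<longleftrightarrow> f \<in> Ar C \<and>
     (\<forall>X. \<forall>g \<in> Hom C (Cod C f) X. \<forall>h \<in> Hom C (Cod C f) X. g \<cdot> f = h \<cdot> f \<longrightarrow> g = h)"

definition is_equalizer :: "'a \<Rightarrow> 'a \<Rightarrow> 'a \<Rightarrow> bool" where
  "is_equalizer f g e \<longleftrightarrow> f \<in> Ar C \<and> g \<in> Hom C (Dom C f) (Cod C f)
     \<and> e \<in> Ar C \<and> Cod C e = Dom C f \<and> f \<cdot> e = g \<cdot> e
     \<and> (\<forall>X. \<forall>x \<in> Hom C X (Dom C f). f \<cdot> x = g \<cdot> x \<longrightarrow>
          (\<exists>!h. h \<in> Hom C X (Dom C e) \<and> e \<cdot> h = x))"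

definition is_coproduct :: "'j set \<Rightarrow> ('j \<Rightarrow> 'o) \<Rightarrow> 'o \<Rightarrow> ('j \<Rightarrow> 'a) \<Rightarrow> bool" where
  "is_coproduct I X S \<iota> \<longleftrightarrow> S \<in> Ob C \<and> (\<forall>j\<in>I. X j \<in> Ob C \<and> \<iota> j \<in> Hom C (X j) S)
     \<and> (\<forall>Y \<in> Ob C. \<forall>f. (\<forall>j\<in>I. f j \<in> Hom C (X j) Y) \<longrightarrow>
          (\<exists>!h. h \<in> Hom C S Y \<and> (\<forall>j\<in>I. h \<cdot> \<iota> j = f j)))"

text \<open>Chosen equalizers and direct sums; an equalizer is represented by its inclusion arrow.\<close>

definition equalizer :: "'a \<Rightarrow> 'a \<Rightarrow> 'a" where
  "equalizer f g = (SOME e. is_equalizer f g e)"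

definition coproduct :: "'j set \<Rightarrow> ('j \<Rightarrow> 'o) \<Rightarrow> 'o \<times> ('j \<Rightarrow> 'a)" where
  "coproduct I X = (SOME p. is_coproduct I X (fst p) (snd p))"

end

definition is_functor ::
  "('o, 'a, 'z) category_scheme \<Rightarrow> ('p, 'b, 'y) category_scheme \<Rightarrow> ('o \<Rightarrow> 'p) \<Rightarrow> ('a \<Rightarrow> 'b) \<Rightarrow> bool"
where
  "is_functor J C Fo Fa \<longleftrightarrow> (\<forall>j \<in> Ob J. Fo j \<in> Ob C)
     \<and> (\<forall>i j. \<forall>u \<in> Hom J i j. Fa u \<in> Hom C (Fo i) (Fo j))
     \<and> (\<forall>j \<in> Ob J. Fa (ident J j) = ident C (Fo j))
     \<and> (\<forall>i j k. \<forall>u \<in> Hom J i j. \<forall>v \<in> Hom J j k.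
          Fa (compose J v u) = compose C (Fa v) (Fa u))"

definition is_natural ::
  "('p, 'b, 'y) category_scheme \<Rightarrow> ('o, 'a, 'z) category_scheme \<Rightarrow>
   ('p \<Rightarrow> 'o) \<Rightarrow> ('b \<Rightarrow> 'a) \<Rightarrow> ('p \<Rightarrow> 'o) \<Rightarrow> ('b \<Rightarrow> 'a) \<Rightarrow> ('p \<Rightarrow> 'a) \<Rightarrow> bool"
where
  "is_natural J C Fo Fa Go Ga \<phi> \<longleftrightarrow> (\<forall>j \<in> Ob J. \<phi> j \<in> Hom C (Fo j) (Go j))
     \<and> (\<forall>i j. \<forall>u \<in> Hom J i j. compose C (\<phi> j) (Fa u) = compose C (Ga u) (\<phi> i))"

definition is_cone ::
  "('p, 'b, 'y) category_scheme \<Rightarrow> ('o, 'a, 'z) category_scheme \<Rightarrow>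
   ('p \<Rightarrow> 'o) \<Rightarrow> ('b \<Rightarrow> 'a) \<Rightarrow> 'o \<Rightarrow> ('p \<Rightarrow> 'a) \<Rightarrow> bool"
where
  "is_cone J C Fo Fa L \<pi> \<longleftrightarrow> L \<in> Ob C \<and> (\<forall>j \<in> Ob J. \<pi> j \<in> Hom C L (Fo j))
     \<and> (\<forall>i j. \<forall>u \<in> Hom J i j. compose C (Fa u) (\<pi> i) = \<pi> j)"

definition is_limit ::
  "('p, 'b, 'y) category_scheme \<Rightarrow> ('o, 'a, 'z) category_scheme \<Rightarrow>
   ('p \<Rightarrow> 'o) \<Rightarrow> ('b \<Rightarrow> 'a) \<Rightarrow> 'o \<Rightarrow> ('p \<Rightarrow> 'a) \<Rightarrow> bool"
where
  "is_limit J C Fo Fa L \<pi> \<longleftrightarrow> is_cone J C Fo Fa L \<pi>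
     \<and> (\<forall>X \<xi>. is_cone J C Fo Fa X \<xi> \<longrightarrow>
          (\<exists>!h. h \<in> Hom C X L \<and> (\<forall>j \<in> Ob J. compose C (\<pi> j) h = \<xi> j)))"

definition is_cocone ::
  "('p, 'b, 'y) category_scheme \<Rightarrow> ('o, 'a, 'z) category_scheme \<Rightarrow>
   ('p \<Rightarrow> 'o) \<Rightarrow> ('b \<Rightarrow> 'a) \<Rightarrow> 'o \<Rightarrow> ('p \<Rightarrow> 'a) \<Rightarrow> bool"
where
  "is_cocone J C Fo Fa L \<iota> \<longleftrightarrow> L \<in> Ob C \<and> (\<forall>j \<in> Ob J. \<iota> j \<in> Hom C (Fo j) L)
     \<and> (\<forall>i j. \<forall>u \<in> Hom J i j. compose C (\<iota> j) (Fa u) = \<iota> i)"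

definition is_colimit ::
  "('p, 'b, 'y) category_scheme \<Rightarrow> ('o, 'a, 'z) category_scheme \<Rightarrow>
   ('p \<Rightarrow> 'o) \<Rightarrow> ('b \<Rightarrow> 'a) \<Rightarrow> 'o \<Rightarrow> ('p \<Rightarrow> 'a) \<Rightarrow> bool"
where
  "is_colimit J C Fo Fa L \<iota> \<longleftrightarrow> is_cocone J C Fo Fa L \<iota>
     \<and> (\<forall>X \<xi>. is_cocone J C Fo Fa X \<xi> \<longrightarrow>
          (\<exists>!h. h \<in> Hom C L X \<and> (\<forall>j \<in> Ob J. compose C h (\<iota> j) = \<xi> j)))"

text \<open>
  Smallness is relative to a type \<open>'i\<close>: the small categories are those whose objects and arrows
  lie in \<open>'i\<close>, the small sets are the subsets of \<open>'i\<close>.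
\<close>

definition complete :: "'i itself \<Rightarrow> ('o, 'a, 'z) category_scheme \<Rightarrow> bool" where
  "complete (_ :: 'i itself) C \<longleftrightarrow>
     (\<forall>(J :: ('i, 'i) category) Fo Fa. category J \<and> is_functor J C Fo Fa \<longrightarrow>
        (\<exists>L \<pi>. is_limit J C Fo Fa L \<pi>))"

definition cocomplete :: "'i itself \<Rightarrow> ('o, 'a, 'z) category_scheme \<Rightarrow> bool" where
  "cocomplete (_ :: 'i itself) C \<longleftrightarrow>
     (\<forall>(J :: ('i, 'i) category) Fo Fa. category J \<and> is_functor J C Fo Fa \<longrightarrow>
        (\<exists>L \<iota>. is_colimit J C Fo Fa L \<iota>))"

definition filtered :: "('o, 'a, 'z) category_scheme \<Rightarrow> bool" where
  "filtered J \<longleftrightarrow> category J \<and> Ob J \<noteq> {}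
     \<and> (\<forall>i \<in> Ob J. \<forall>j \<in> Ob J. \<exists>k \<in> Ob J. Hom J i k \<noteq> {} \<and> Hom J j k \<noteq> {})
     \<and> (\<forall>i j. \<forall>u \<in> Hom J i j. \<forall>v \<in> Hom J i j.
          \<exists>k. \<exists>w \<in> Hom J j k. compose J w u = compose J w v)"


section \<open>Abelian categories\<close>

record ('o, 'a) preadditive_category = "('o, 'a) category" +
  add_ar :: "'a \<Rightarrow> 'a \<Rightarrow> 'a" (infixl "\<boxplus>\<index>" 65)
  zero_ar :: "'o \<Rightarrow> 'o \<Rightarrow> 'a"

text \<open>The additive group of arrows between two objects, in the multiplicative record format of
  HOL-Algebra; \<^const>\<open>finprod\<close> in this group is a finite sum of arrows.\<close>

definition hom_group :: "('o, 'a, 'z) preadditive_category_scheme \<Rightarrow> 'o \<Rightarrow> 'o \<Rightarrow> 'a monoid" where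
  "hom_group C A B = \<lparr>carrier = Hom C A B, mult = add_ar C, one = zero_ar C A B\<rparr>"

locale preadditive_category = category C
  for C :: "('o, 'a, 'z) preadditive_category_scheme" (structure) +
  assumes hom_comm_group: "\<lbrakk>A \<in> Ob C; B \<in> Ob C\<rbrakk> \<Longrightarrow> comm_group (hom_group C A B)"
    and compose_add_right: "\<lbrakk>f \<in> Hom C A B; f' \<in> Hom C A B; g \<in> Hom C B D\<rbrakk>
        \<Longrightarrow> g \<cdot> (f \<boxplus> f') = (g \<cdot> f) \<boxplus> (g \<cdot> f')"
    and compose_add_left: "\<lbrakk>f \<in> Hom C A B; g \<in> Hom C B D; g' \<in> Hom C B D\<rbrakk>
        \<Longrightarrow> (g \<boxplus> g') \<cdot> f = (g \<cdot> f) \<boxplus> (g' \<cdot> f)"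

context
  fixes C :: "('o, 'a, 'z) preadditive_category_scheme" (structure)
begin

definition is_zero_object :: "'o \<Rightarrow> bool" where
  "is_zero_object Z \<longleftrightarrow> Z \<in> Ob C
     \<and> (\<forall>A \<in> Ob C. (\<exists>!f. f \<in> Hom C A Z) \<and> (\<exists>!f. f \<in> Hom C Z A))"

definition is_biproduct :: "'o \<Rightarrow> 'o \<Rightarrow> 'o \<Rightarrow> 'a \<Rightarrow> 'a \<Rightarrow> 'a \<Rightarrow> 'a \<Rightarrow> bool" where
  "is_biproduct A B S i j p q \<longleftrightarrow> S \<in> Ob C
     \<and> i \<in> Hom C A S \<and> j \<in> Hom C B S \<and> p \<in> Hom C S A \<and> q \<in> Hom C S B
     \<and> p \<cdot> i = \<^bold>1 A \<and> q \<cdot> j = \<^bold>1 B \<and> p \<cdot> j = zero_ar C B A \<and> q \<cdot> i = zero_ar C A B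
     \<and> (i \<cdot> p) \<boxplus> (j \<cdot> q) = \<^bold>1 S"

definition is_kernel :: "'a \<Rightarrow> 'a \<Rightarrow> bool" where
  "is_kernel f k \<longleftrightarrow> f \<in> Ar C \<and> k \<in> Ar C \<and> Cod C k = Dom C f
     \<and> f \<cdot> k = zero_ar C (Dom C k) (Cod C f)
     \<and> (\<forall>X. \<forall>x \<in> Hom C X (Dom C f). f \<cdot> x = zero_ar C X (Cod C f) \<longrightarrow>
          (\<exists>!h. h \<in> Hom C X (Dom C k) \<and> k \<cdot> h = x))"

definition is_cokernel :: "'a \<Rightarrow> 'a \<Rightarrow> bool" where
  "is_cokernel f q \<longleftrightarrow> f \<in> Ar C \<and> q \<in> Ar C \<and> Dom C q = Cod C f
     \<and> q \<cdot> f = zero_ar C (Dom C f) (Cod C q)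
     \<and> (\<forall>X. \<forall>x \<in> Hom C (Cod C f) X. x \<cdot> f = zero_ar C (Dom C f) X \<longrightarrow>
          (\<exists>!h. h \<in> Hom C (Cod C q) X \<and> h \<cdot> q = x))"

text \<open>Exactness at the middle object: the image of \<open>f\<close>, i.e. the kernel of its cokernel, is the
  kernel of \<open>g\<close>.\<close>

definition exact_at :: "'a \<Rightarrow> 'a \<Rightarrow> bool" where
  "exact_at f g \<longleftrightarrow> f \<in> Ar C \<and> g \<in> Ar C \<and> Cod C f = Dom C g
     \<and> (\<exists>q k. is_cokernel f q \<and> is_kernel q k \<and> is_kernel g k)"

definition short_exact :: "'a \<Rightarrow> 'a \<Rightarrow> bool" where
  "short_exact f g \<longleftrightarrow> monic C f \<and> exact_at f g \<and> epic C g"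

end

locale abelian_category = preadditive_category C
  for C :: "('o, 'a, 'z) preadditive_category_scheme" (structure) +
  assumes zero_object: "\<exists>Z. is_zero_object C Z"
    and biproducts: "\<lbrakk>A \<in> Ob C; B \<in> Ob C\<rbrakk> \<Longrightarrow> \<exists>S i j p q. is_biproduct C A B S i j p q"
    and kernels: "f \<in> Ar C \<Longrightarrow> \<exists>k. is_kernel C f k"
    and cokernels: "f \<in> Ar C \<Longrightarrow> \<exists>q. is_cokernel C f q"
    and monic_normal: "monic C f \<Longrightarrow> \<exists>g. is_kernel C g f"
    and epic_normal: "epic C f \<Longrightarrow> \<exists>g. is_cokernel C g f"

definition additive_functor ::
  "('o, 'a, 'z) preadditive_category_scheme \<Rightarrow> ('p, 'b, 'y) preadditive_category_scheme \<Rightarrow>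
   ('o \<Rightarrow> 'p) \<Rightarrow> ('a \<Rightarrow> 'b) \<Rightarrow> bool"
where
  "additive_functor C D Fo Fa \<longleftrightarrow> is_functor C D Fo Fa
     \<and> (\<forall>A B. \<forall>f \<in> Hom C A B. \<forall>g \<in> Hom C A B. Fa (add_ar C f g) = add_ar D (Fa f) (Fa g))"

text \<open>Exact sequences \<open>0 \<rightarrow> X \<rightarrow> Y \<rightarrow> Z\<close> are mapped to exact sequences.\<close>

definition left_exact_functor ::
  "('o, 'a, 'z) preadditive_category_scheme \<Rightarrow> ('p, 'b, 'y) preadditive_category_scheme \<Rightarrow>
   ('o \<Rightarrow> 'p) \<Rightarrow> ('a \<Rightarrow> 'b) \<Rightarrow> bool"
where
  "left_exact_functor C D Fo Fa \<longleftrightarrow> is_functor C D Fo Fa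
     \<and> (\<forall>f g. monic C f \<and> exact_at C f g \<longrightarrow> monic D (Fa f) \<and> exact_at D (Fa f) (Fa g))"

text \<open>Grothendieck's AB5: small colimits exist and small filtered colimits of short exact sequences
  are short exact.\<close>

definition AB5 :: "'i itself \<Rightarrow> ('o, 'a, 'z) preadditive_category_scheme \<Rightarrow> bool" where
  "AB5 (_ :: 'i itself) C \<longleftrightarrow> abelian_category C \<and> cocomplete TYPE('i) C
     \<and> (\<forall>(J :: ('i, 'i) category) Xo Xa Yo Ya Zo Za \<phi> \<psi> LX \<iota>X LY \<iota>Y LZ \<iota>Z f g.
          filtered J
          \<and> is_functor J C Xo Xa \<and> is_functor J C Yo Ya \<and> is_functor J C Zo Za
          \<and> is_natural J C Xo Xa Yo Ya \<phi> \<and> is_natural J C Yo Ya Zo Za \<psi>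
          \<and> (\<forall>j \<in> Ob J. short_exact C (\<phi> j) (\<psi> j))
          \<and> is_colimit J C Xo Xa LX \<iota>X \<and> is_colimit J C Yo Ya LY \<iota>Y \<and> is_colimit J C Zo Za LZ \<iota>Z
          \<and> f \<in> Hom C LX LY \<and> (\<forall>j \<in> Ob J. compose C f (\<iota>X j) = compose C (\<iota>Y j) (\<phi> j))
          \<and> g \<in> Hom C LY LZ \<and> (\<forall>j \<in> Ob J. compose C g (\<iota>Y j) = compose C (\<iota>Z j) (\<psi> j))
          \<longrightarrow> short_exact C f g)"


section \<open>Braided monoidal categories\<close>

text \<open>The record extends preadditive categories, but the monoidal and braiding axioms below do not
  refer to the additive structure. Nothing is strict: the constraints are
  \<open>\<alpha> A B D : (A \<otimes> B) \<otimes> D \<rightarrow> A \<otimes> (B \<otimes> D)\<close>, \<open>\<l> A : \<I> \<otimes> A \<rightarrow> A\<close> and \<open>\<r> A : A \<otimes> \<I> \<rightarrow> A\<close>.\<close>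

record ('o, 'a) monoidal_category = "('o, 'a) preadditive_category" +
  tensor_ob :: "'o \<Rightarrow> 'o \<Rightarrow> 'o" (infixr "\<otimes>\<^sub>o\<index>" 75)
  tensor_ar :: "'a \<Rightarrow> 'a \<Rightarrow> 'a" (infixr "\<otimes>\<^sub>a\<index>" 75)
  unit_ob :: "'o" ("\<I>\<index>")
  associator :: "'o \<Rightarrow> 'o \<Rightarrow> 'o \<Rightarrow> 'a" ("\<alpha>\<index>")
  left_unitor :: "'o \<Rightarrow> 'a" ("\<l>\<index>")
  right_unitor :: "'o \<Rightarrow> 'a" ("\<r>\<index>")

locale monoidal_category = category C
  for C :: "('o, 'a, 'z) monoidal_category_scheme" (structure) +
  assumes tensor_Ob: "\<lbrakk>A \<in> Ob C; B \<in> Ob C\<rbrakk> \<Longrightarrow> A \<otimes>\<^sub>o B \<in> Ob C"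
    and tensor_Hom: "\<lbrakk>f \<in> Hom C A A'; g \<in> Hom C B B'\<rbrakk>
        \<Longrightarrow> f \<otimes>\<^sub>a g \<in> Hom C (A \<otimes>\<^sub>o B) (A' \<otimes>\<^sub>o B')"
    and tensor_ident: "\<lbrakk>A \<in> Ob C; B \<in> Ob C\<rbrakk> \<Longrightarrow> \<^bold>1 A \<otimes>\<^sub>a \<^bold>1 B = \<^bold>1 (A \<otimes>\<^sub>o B)"
    and tensor_compose:
      "\<lbrakk>f \<in> Hom C A A'; f' \<in> Hom C A' A''; g \<in> Hom C B B'; g' \<in> Hom C B' B''\<rbrakk>
        \<Longrightarrow> (f' \<cdot> f) \<otimes>\<^sub>a (g' \<cdot> g) = (f' \<otimes>\<^sub>a g') \<cdot> (f \<otimes>\<^sub>a g)"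
    and unit_Ob: "\<I> \<in> Ob C"
    and assoc_Hom: "\<lbrakk>A \<in> Ob C; B \<in> Ob C; D \<in> Ob C\<rbrakk>
        \<Longrightarrow> \<alpha> A B D \<in> Hom C ((A \<otimes>\<^sub>o B) \<otimes>\<^sub>o D) (A \<otimes>\<^sub>o (B \<otimes>\<^sub>o D)) \<and> is_iso C (\<alpha> A B D)"
    and assoc_natural: "\<lbrakk>f \<in> Hom C A A'; g \<in> Hom C B B'; h \<in> Hom C D D'\<rbrakk>
        \<Longrightarrow> \<alpha> A' B' D' \<cdot> ((f \<otimes>\<^sub>a g) \<otimes>\<^sub>a h) = (f \<otimes>\<^sub>a (g \<otimes>\<^sub>a h)) \<cdot> \<alpha> A B D"
    and lunit_Hom: "A \<in> Ob C \<Longrightarrow> \<l> A \<in> Hom C (\<I> \<otimes>\<^sub>o A) A \<and> is_iso C (\<l> A)"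
    and lunit_natural: "f \<in> Hom C A B \<Longrightarrow> \<l> B \<cdot> (\<^bold>1 \<I> \<otimes>\<^sub>a f) = f \<cdot> \<l> A"
    and runit_Hom: "A \<in> Ob C \<Longrightarrow> \<r> A \<in> Hom C (A \<otimes>\<^sub>o \<I>) A \<and> is_iso C (\<r> A)"
    and runit_natural: "f \<in> Hom C A B \<Longrightarrow> \<r> B \<cdot> (f \<otimes>\<^sub>a \<^bold>1 \<I>) = f \<cdot> \<r> A"
    and pentagon: "\<lbrakk>A \<in> Ob C; B \<in> Ob C; D \<in> Ob C; E \<in> Ob C\<rbrakk>
        \<Longrightarrow> \<alpha> A B (D \<otimes>\<^sub>o E) \<cdot> \<alpha> (A \<otimes>\<^sub>o B) D E
            = (\<^bold>1 A \<otimes>\<^sub>a \<alpha> B D E) \<cdot> \<alpha> A (B \<otimes>\<^sub>o D) E \<cdot> (\<alpha> A B D \<otimes>\<^sub>a \<^bold>1 E)"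
    and triangle: "\<lbrakk>A \<in> Ob C; B \<in> Ob C\<rbrakk>
        \<Longrightarrow> (\<^bold>1 A \<otimes>\<^sub>a \<l> B) \<cdot> \<alpha> A \<I> B = \<r> A \<otimes>\<^sub>a \<^bold>1 B"

record ('o, 'a) braided_category = "('o, 'a) monoidal_category" +
  braiding :: "'o \<Rightarrow> 'o \<Rightarrow> 'a" ("\<c>\<index>")

locale braided_monoidal_category = monoidal_category C
  for C :: "('o, 'a, 'z) braided_category_scheme" (structure) +
  assumes braiding_Hom: "\<lbrakk>A \<in> Ob C; B \<in> Ob C\<rbrakk>
        \<Longrightarrow> \<c> A B \<in> Hom C (A \<otimes>\<^sub>o B) (B \<otimes>\<^sub>o A) \<and> is_iso C (\<c> A B)"
    and braiding_natural: "\<lbrakk>f \<in> Hom C A A'; g \<in> Hom C B B'\<rbrakk>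
        \<Longrightarrow> \<c> A' B' \<cdot> (f \<otimes>\<^sub>a g) = (g \<otimes>\<^sub>a f) \<cdot> \<c> A B"
    and hexagon1: "\<lbrakk>A \<in> Ob C; B \<in> Ob C; D \<in> Ob C\<rbrakk>
        \<Longrightarrow> \<alpha> B D A \<cdot> \<c> A (B \<otimes>\<^sub>o D) \<cdot> \<alpha> A B D
            = (\<^bold>1 B \<otimes>\<^sub>a \<c> A D) \<cdot> \<alpha> B A D \<cdot> (\<c> A B \<otimes>\<^sub>a \<^bold>1 D)"
    and hexagon2: "\<lbrakk>A \<in> Ob C; B \<in> Ob C; D \<in> Ob C\<rbrakk>
        \<Longrightarrow> inverse_ar C (\<alpha> D A B) \<cdot> \<c> (A \<otimes>\<^sub>o B) D \<cdot> inverse_ar C (\<alpha> A B D)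
            = (\<c> A D \<otimes>\<^sub>a \<^bold>1 B) \<cdot> inverse_ar C (\<alpha> A D B) \<cdot> (\<^bold>1 A \<otimes>\<^sub>a \<c> B D)"

locale coabelian_monoidal_category = abelian_category C + monoidal_category C
  for C :: "('o, 'a, 'z) monoidal_category_scheme" (structure) +
  assumes tensor_left_additive:
      "X \<in> Ob C \<Longrightarrow> additive_functor C C (\<lambda>Y. X \<otimes>\<^sub>o Y) (\<lambda>f. \<^bold>1 X \<otimes>\<^sub>a f)"
    and tensor_right_additive:
      "X \<in> Ob C \<Longrightarrow> additive_functor C C (\<lambda>Y. Y \<otimes>\<^sub>o X) (\<lambda>f. f \<otimes>\<^sub>a \<^bold>1 X)"
    and tensor_left_left_exact:
      "X \<in> Ob C \<Longrightarrow> left_exact_functor C C (\<lambda>Y. X \<otimes>\<^sub>o Y) (\<lambda>f. \<^bold>1 X \<otimes>\<^sub>a f)"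
    and tensor_right_left_exact:
      "X \<in> Ob C \<Longrightarrow> left_exact_functor C C (\<lambda>Y. Y \<otimes>\<^sub>o X) (\<lambda>f. f \<otimes>\<^sub>a \<^bold>1 X)"

definition tensor_preserves_direct_sums ::
  "'i itself \<Rightarrow> ('o, 'a, 'z) monoidal_category_scheme \<Rightarrow> bool"
where
  "tensor_preserves_direct_sums (_ :: 'i itself) C \<longleftrightarrow>
     (\<forall>(I :: 'i set) X S \<iota>. \<forall>Y \<in> Ob C. is_coproduct C I X S \<iota> \<longrightarrow>
        is_coproduct C I (\<lambda>j. tensor_ob C Y (X j)) (tensor_ob C Y S)
          (\<lambda>j. tensor_ar C (ident C Y) (\<iota> j))
        \<and> is_coproduct C I (\<lambda>j. tensor_ob C (X j) Y) (tensor_ob C S Y)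
          (\<lambda>j. tensor_ar C (\<iota> j) (ident C Y)))"


section \<open>Algebras, coalgebras, bialgebras and Hopf bimodules\<close>

record ('o, 'a) coalgebra =
  carr :: "'o"
  comul :: "'a"
  counit :: "'a"

record ('o, 'a) bialgebra = "('o, 'a) coalgebra" +
  mul :: "'a"
  unt :: "'a"

record ('o, 'a) bicomodule =
  bic_ob :: "'o"
  rcoact :: "'a"
  lcoact :: "'a"

record ('o, 'a) hopf_bimodule = "('o, 'a) bicomodule" +
  ract :: "'a"
  lact :: "'a"

context
  fixes C :: "('o, 'a, 'z) monoidal_category_scheme" (structure)
begin

definition is_algebra :: "'o \<Rightarrow> 'a \<Rightarrow> 'a \<Rightarrow> bool" where
  "is_algebra A m u \<longleftrightarrow> A \<in> Ob C \<and> m \<in> Hom C (A \<otimes>\<^sub>o A) A \<and> u \<in> Hom C \<I> A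
     \<and> m \<cdot> (m \<otimes>\<^sub>a \<^bold>1 A) = m \<cdot> (\<^bold>1 A \<otimes>\<^sub>a m) \<cdot> \<alpha> A A A
     \<and> m \<cdot> (u \<otimes>\<^sub>a \<^bold>1 A) = \<l> A
     \<and> m \<cdot> (\<^bold>1 A \<otimes>\<^sub>a u) = \<r> A"

definition is_coalgebra :: "('o, 'a, 'y) coalgebra_scheme \<Rightarrow> bool" where
  "is_coalgebra D \<longleftrightarrow> (let A = carr D; \<Delta> = comul D; \<epsilon> = counit D in
     A \<in> Ob C \<and> \<Delta> \<in> Hom C A (A \<otimes>\<^sub>o A) \<and> \<epsilon> \<in> Hom C A \<I>
     \<and> \<alpha> A A A \<cdot> (\<Delta> \<otimes>\<^sub>a \<^bold>1 A) \<cdot> \<Delta> = (\<^bold>1 A \<otimes>\<^sub>a \<Delta>) \<cdot> \<Delta>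
     \<and> \<l> A \<cdot> (\<epsilon> \<otimes>\<^sub>a \<^bold>1 A) \<cdot> \<Delta> = \<^bold>1 A
     \<and> \<r> A \<cdot> (\<^bold>1 A \<otimes>\<^sub>a \<epsilon>) \<cdot> \<Delta> = \<^bold>1 A)"

definition is_coalgebra_hom ::
  "('o, 'a, 'y) coalgebra_scheme \<Rightarrow> ('o, 'a, 'x) coalgebra_scheme \<Rightarrow> 'a \<Rightarrow> bool"
where
  "is_coalgebra_hom D E f \<longleftrightarrow> is_coalgebra D \<and> is_coalgebra E
     \<and> f \<in> Hom C (carr D) (carr E)
     \<and> comul E \<cdot> f = (f \<otimes>\<^sub>a f) \<cdot> comul D \<and> counit E \<cdot> f = counit D"

definition unit_coalgebra :: "('o, 'a) coalgebra" where
  "unit_coalgebra = \<lparr>carr = \<I>, comul = inverse_ar C (\<l> \<I>), counit = \<^bold>1 \<I>\<rparr>"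

definition is_bimodule :: "('o, 'a, 'y) bialgebra_scheme \<Rightarrow> ('o, 'a, 'x) hopf_bimodule_scheme \<Rightarrow> bool"
where
  "is_bimodule H N \<longleftrightarrow>
     (let A = carr H; m = mul H; u = unt H; M = bic_ob N; r = ract N; l = lact N in
     is_algebra A m u \<and> M \<in> Ob C \<and> r \<in> Hom C (M \<otimes>\<^sub>o A) M \<and> l \<in> Hom C (A \<otimes>\<^sub>o M) M
     \<and> l \<cdot> (m \<otimes>\<^sub>a \<^bold>1 M) = l \<cdot> (\<^bold>1 A \<otimes>\<^sub>a l) \<cdot> \<alpha> A A M \<and> l \<cdot> (u \<otimes>\<^sub>a \<^bold>1 M) = \<l> M
     \<and> r \<cdot> (r \<otimes>\<^sub>a \<^bold>1 A) = r \<cdot> (\<^bold>1 M \<otimes>\<^sub>a m) \<cdot> \<alpha> M A A \<and> r \<cdot> (\<^bold>1 M \<otimes>\<^sub>a u) = \<r> M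
     \<and> r \<cdot> (l \<otimes>\<^sub>a \<^bold>1 A) = l \<cdot> (\<^bold>1 A \<otimes>\<^sub>a r) \<cdot> \<alpha> A M A)"

definition is_bicomodule :: "('o, 'a, 'y) coalgebra_scheme \<Rightarrow> ('o, 'a, 'x) bicomodule_scheme \<Rightarrow> bool"
where
  "is_bicomodule H N \<longleftrightarrow>
     (let A = carr H; \<Delta> = comul H; \<epsilon> = counit H; M = bic_ob N; r = rcoact N; l = lcoact N in
     is_coalgebra H \<and> M \<in> Ob C \<and> r \<in> Hom C M (M \<otimes>\<^sub>o A) \<and> l \<in> Hom C M (A \<otimes>\<^sub>o M)
     \<and> \<alpha> A A M \<cdot> (\<Delta> \<otimes>\<^sub>a \<^bold>1 M) \<cdot> l = (\<^bold>1 A \<otimes>\<^sub>a l) \<cdot> l \<and> \<l> M \<cdot> (\<epsilon> \<otimes>\<^sub>a \<^bold>1 M) \<cdot> l = \<^bold>1 M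
     \<and> \<alpha> M A A \<cdot> (r \<otimes>\<^sub>a \<^bold>1 A) \<cdot> r = (\<^bold>1 M \<otimes>\<^sub>a \<Delta>) \<cdot> r \<and> \<r> M \<cdot> (\<^bold>1 M \<otimes>\<^sub>a \<epsilon>) \<cdot> r = \<^bold>1 M
     \<and> \<alpha> A M A \<cdot> (l \<otimes>\<^sub>a \<^bold>1 A) \<cdot> r = (\<^bold>1 A \<otimes>\<^sub>a r) \<cdot> l)"

end

context
  fixes C :: "('o, 'a, 'z) braided_category_scheme" (structure)
begin

text \<open>\<open>A \<otimes> c\<^sub>B\<^sub>,\<^sub>D \<otimes> E : (A \<otimes> B) \<otimes> (D \<otimes> E) \<rightarrow> (A \<otimes> D) \<otimes> (B \<otimes> E)\<close> with the associativity
  constraints inserted.\<close>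

definition mid_braiding :: "'o \<Rightarrow> 'o \<Rightarrow> 'o \<Rightarrow> 'o \<Rightarrow> 'a" where
  "mid_braiding A B D E = inverse_ar C (\<alpha> A D (B \<otimes>\<^sub>o E))
     \<cdot> (\<^bold>1 A \<otimes>\<^sub>a (\<alpha> D B E \<cdot> (\<c> B D \<otimes>\<^sub>a \<^bold>1 E) \<cdot> inverse_ar C (\<alpha> B D E)))
     \<cdot> \<alpha> A B (D \<otimes>\<^sub>o E)"

definition tensor_coalgebra ::
  "('o, 'a, 'y) coalgebra_scheme \<Rightarrow> ('o, 'a, 'x) coalgebra_scheme \<Rightarrow> ('o, 'a) coalgebra"
where
  "tensor_coalgebra D E = \<lparr>carr = carr D \<otimes>\<^sub>o carr E,
     comul = mid_braiding (carr D) (carr D) (carr E) (carr E) \<cdot> (comul D \<otimes>\<^sub>a comul E),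
     counit = \<l> \<I> \<cdot> (counit D \<otimes>\<^sub>a counit E)\<rparr>"

definition is_braided_bialgebra :: "('o, 'a, 'y) bialgebra_scheme \<Rightarrow> bool" where
  "is_braided_bialgebra B \<longleftrightarrow>
     (let H = carr B; m = mul B; u = unt B; \<Delta> = comul B; \<epsilon> = counit B in
     is_algebra C H m u \<and> is_coalgebra C B
     \<and> \<Delta> \<cdot> m = (m \<otimes>\<^sub>a m) \<cdot> mid_braiding H H H H \<cdot> (\<Delta> \<otimes>\<^sub>a \<Delta>)
     \<and> \<epsilon> \<cdot> m = \<l> \<I> \<cdot> (\<epsilon> \<otimes>\<^sub>a \<epsilon>)
     \<and> \<Delta> \<cdot> u = (u \<otimes>\<^sub>a u) \<cdot> inverse_ar C (\<l> \<I>)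
     \<and> \<epsilon> \<cdot> u = \<^bold>1 \<I>)"

definition is_hopf_bimodule ::
  "('o, 'a, 'y) bialgebra_scheme \<Rightarrow> ('o, 'a, 'x) hopf_bimodule_scheme \<Rightarrow> bool"
where
  "is_hopf_bimodule B N \<longleftrightarrow>
     (let H = carr B; m = mul B; \<Delta> = comul B; M = bic_ob N;
          \<mu>r = ract N; \<mu>l = lact N; \<rho>r = rcoact N; \<rho>l = lcoact N in
     is_bimodule C B N \<and> is_bicomodule C B N
     \<and> \<rho>l \<cdot> \<mu>l = (m \<otimes>\<^sub>a \<mu>l) \<cdot> mid_braiding H H H M \<cdot> (\<Delta> \<otimes>\<^sub>a \<rho>l)
     \<and> \<rho>l \<cdot> \<mu>r = (m \<otimes>\<^sub>a \<mu>r) \<cdot> mid_braiding H M H H \<cdot> (\<rho>l \<otimes>\<^sub>a \<Delta>)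
     \<and> \<rho>r \<cdot> \<mu>l = (\<mu>l \<otimes>\<^sub>a m) \<cdot> mid_braiding H H M H \<cdot> (\<Delta> \<otimes>\<^sub>a \<rho>r)
     \<and> \<rho>r \<cdot> \<mu>r = (\<mu>r \<otimes>\<^sub>a m) \<cdot> mid_braiding M H H H \<cdot> (\<rho>r \<otimes>\<^sub>a \<Delta>))"

end


section \<open>Gradings\<close>

text \<open>A grading of \<open>X\<close> is a family \<open>Xs\<close> with injections \<open>i n : Xs n \<rightarrow> X\<close> exhibiting \<open>X\<close> as the
  direct sum of the \<open>Xs n\<close>.\<close>

context
  fixes C :: "('o, 'a, 'z) monoidal_category_scheme" (structure)
begin

definition is_grading :: "(nat \<Rightarrow> 'o) \<Rightarrow> 'o \<Rightarrow> (nat \<Rightarrow> 'a) \<Rightarrow> bool" where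
  "is_grading Xs X i \<longleftrightarrow> is_coproduct C UNIV Xs X i"

definition is_graded_morphism ::
  "(nat \<Rightarrow> 'o) \<Rightarrow> 'o \<Rightarrow> (nat \<Rightarrow> 'a) \<Rightarrow> (nat \<Rightarrow> 'o) \<Rightarrow> 'o \<Rightarrow> (nat \<Rightarrow> 'a) \<Rightarrow> 'a \<Rightarrow> bool"
where
  "is_graded_morphism Xs X i Ys Y j f \<longleftrightarrow>
     is_grading Xs X i \<and> is_grading Ys Y j \<and> f \<in> Hom C X Y
     \<and> (\<forall>n. \<exists>fn \<in> Hom C (Xs n) (Ys n). f \<cdot> i n = j n \<cdot> fn)"

definition tensor_degree_sum :: "(nat \<Rightarrow> 'o) \<Rightarrow> (nat \<Rightarrow> 'o) \<Rightarrow> nat \<Rightarrow> 'o \<times> (nat \<times> nat \<Rightarrow> 'a)" where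
  "tensor_degree_sum Xs Ys n = coproduct C {(a, b). a + b = n} (\<lambda>(a, b). Xs a \<otimes>\<^sub>o Ys b)"

definition tensor_degree :: "(nat \<Rightarrow> 'o) \<Rightarrow> (nat \<Rightarrow> 'o) \<Rightarrow> nat \<Rightarrow> 'o" where
  "tensor_degree Xs Ys n = fst (tensor_degree_sum Xs Ys n)"

definition tensor_inj ::
  "(nat \<Rightarrow> 'o) \<Rightarrow> 'o \<Rightarrow> (nat \<Rightarrow> 'a) \<Rightarrow> (nat \<Rightarrow> 'o) \<Rightarrow> 'o \<Rightarrow> (nat \<Rightarrow> 'a) \<Rightarrow> nat \<Rightarrow> 'a"
where
  "tensor_inj Xs X i Ys Y j n = (THE h. h \<in> Hom C (tensor_degree Xs Ys n) (X \<otimes>\<^sub>o Y)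
     \<and> (\<forall>a b. a + b = n \<longrightarrow> h \<cdot> snd (tensor_degree_sum Xs Ys n) (a, b) = i a \<otimes>\<^sub>a j b))"

definition is_graded_algebra :: "(nat \<Rightarrow> 'o) \<Rightarrow> (nat \<Rightarrow> 'a) \<Rightarrow> 'o \<Rightarrow> 'a \<Rightarrow> 'a \<Rightarrow> bool" where
  "is_graded_algebra As i A m u \<longleftrightarrow> is_algebra C A m u \<and> is_grading As A i
     \<and> is_graded_morphism (tensor_degree As As) (A \<otimes>\<^sub>o A) (tensor_inj As A i As A i) As A i m"

definition is_graded_coalgebra ::
  "(nat \<Rightarrow> 'o) \<Rightarrow> (nat \<Rightarrow> 'a) \<Rightarrow> ('o, 'a, 'y) coalgebra_scheme \<Rightarrow> bool"
where
  "is_graded_coalgebra As i D \<longleftrightarrow> (let A = carr D in is_coalgebra C D \<and> is_grading As A i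
     \<and> is_graded_morphism As A i (tensor_degree As As) (A \<otimes>\<^sub>o A) (tensor_inj As A i As A i)
         (comul D))"

end

definition is_graded_braided_bialgebra ::
  "('o, 'a, 'z) braided_category_scheme \<Rightarrow> (nat \<Rightarrow> 'o) \<Rightarrow> (nat \<Rightarrow> 'a) \<Rightarrow>
   ('o, 'a, 'y) bialgebra_scheme \<Rightarrow> bool"
where
  "is_graded_braided_bialgebra C Bs i B \<longleftrightarrow> is_braided_bialgebra C B
     \<and> is_graded_algebra C Bs i (carr B) (mul B) (unt B) \<and> is_graded_coalgebra C Bs i B"


section \<open>The cotensor coalgebra\<close>

context
  fixes C :: "('o, 'a, 'z) monoidal_category_scheme" (structure)
    and H :: "('o, 'a, 'y) coalgebra_scheme"
begin

text \<open>The inclusion of the cotensor product of \<open>V\<close> and \<open>W\<close> into \<open>V \<otimes> W\<close>.\<close>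

definition cotensor_incl ::
  "('o, 'a, 'x) bicomodule_scheme \<Rightarrow> ('o, 'a, 'w) bicomodule_scheme \<Rightarrow> 'a"
where
  "cotensor_incl V W = equalizer C
     (\<alpha> (bic_ob V) (carr H) (bic_ob W) \<cdot> (rcoact V \<otimes>\<^sub>a \<^bold>1 (bic_ob W)))
     (\<^bold>1 (bic_ob V) \<otimes>\<^sub>a lcoact W)"

text \<open>The coactions on the cotensor product are induced by the right one of \<open>W\<close> and the left one
  of \<open>V\<close>.\<close>

definition cotensor ::
  "('o, 'a, 'x) bicomodule_scheme \<Rightarrow> ('o, 'a, 'w) bicomodule_scheme \<Rightarrow> ('o, 'a) bicomodule"
where
  "cotensor V W = (let A = carr H; e = cotensor_incl V W; E = Dom C e in
     \<lparr>bic_ob = E,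
      rcoact = (THE r. r \<in> Hom C E (E \<otimes>\<^sub>o A) \<and>
        (e \<otimes>\<^sub>a \<^bold>1 A) \<cdot> r
          = inverse_ar C (\<alpha> (bic_ob V) (bic_ob W) A) \<cdot> (\<^bold>1 (bic_ob V) \<otimes>\<^sub>a rcoact W) \<cdot> e),
      lcoact = (THE l. l \<in> Hom C E (A \<otimes>\<^sub>o E) \<and>
        (\<^bold>1 A \<otimes>\<^sub>a e) \<cdot> l
          = \<alpha> A (bic_ob V) (bic_ob W) \<cdot> (lcoact V \<otimes>\<^sub>a \<^bold>1 (bic_ob W)) \<cdot> e)\<rparr>)"

context
  fixes M :: "('o, 'a, 'x) bicomodule_scheme"
begin

text \<open>Cotensor powers, bracketed to the left: \<open>H\<close>, \<open>M\<close>, and the cotensor product of the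
  \<open>n\<close>-th power with \<open>M\<close> for \<open>n \<ge> 1\<close>.\<close>

primrec cotensor_power :: "nat \<Rightarrow> ('o, 'a) bicomodule" where
  "cotensor_power 0 = \<lparr>bic_ob = carr H, rcoact = comul H, lcoact = comul H\<rparr>"
| "cotensor_power (Suc n) =
     (if n = 0 then bicomodule.truncate M else cotensor (cotensor_power n) M)"

definition cotensor_power_ob :: "nat \<Rightarrow> 'o" where
  "cotensor_power_ob n = bic_ob (cotensor_power n)"

text \<open>The inclusion of the \<open>m+n\<close>-th power into the tensor product of the \<open>m\<close>-th and the \<open>n\<close>-th,
  through the canonical isomorphism with their cotensor product. If \<open>m = 0\<close> or \<open>n = 0\<close> this
  isomorphism is given by a coaction; otherwise it is the associativity of the cotensor product,
  i.e. the arrow compatible with \<open>\<alpha>\<close> and the inclusions into tensor products.\<close>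

primrec Tc_component :: "nat \<Rightarrow> nat \<Rightarrow> 'a" where
  "Tc_component m 0 = rcoact (cotensor_power m)"
| "Tc_component m (Suc n) =
     (if m = 0 then lcoact (cotensor_power (Suc n))
      else if n = 0 then cotensor_incl (cotensor_power m) M
      else (THE d. d \<in> Hom C (cotensor_power_ob (m + Suc n))
                          (cotensor_power_ob m \<otimes>\<^sub>o cotensor_power_ob (Suc n))
        \<and> (\<^bold>1 (cotensor_power_ob m) \<otimes>\<^sub>a cotensor_incl (cotensor_power n) M) \<cdot> d
          = \<alpha> (cotensor_power_ob m) (cotensor_power_ob n) (bic_ob M)
            \<cdot> (Tc_component m n \<otimes>\<^sub>a \<^bold>1 (bic_ob M))
            \<cdot> cotensor_incl (cotensor_power (m + n)) M))"

definition Tc_ob :: "'o" where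
  "Tc_ob = fst (coproduct C UNIV cotensor_power_ob)"

definition Tc_inj :: "nat \<Rightarrow> 'a" where
  "Tc_inj = snd (coproduct C UNIV cotensor_power_ob)"

definition Tc_proj :: "nat \<Rightarrow> 'a" where
  "Tc_proj n = (THE p. p \<in> Hom C Tc_ob (cotensor_power_ob n) \<and>
     (\<forall>k. p \<cdot> Tc_inj k = (if k = n then \<^bold>1 (cotensor_power_ob n)
                       else zero_ar C (cotensor_power_ob k) (cotensor_power_ob n))))"

definition Tc_comul :: "'a" where
  "Tc_comul = (THE d. d \<in> Hom C Tc_ob (Tc_ob \<otimes>\<^sub>o Tc_ob) \<and>
     (\<forall>n. d \<cdot> Tc_inj n =
        finprod (hom_group C (cotensor_power_ob n) (Tc_ob \<otimes>\<^sub>o Tc_ob))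
          (\<lambda>a. (Tc_inj a \<otimes>\<^sub>a Tc_inj (n - a)) \<cdot> Tc_component a (n - a)) {..n}))"

definition cotensor_coalgebra :: "('o, 'a) coalgebra" where
  "cotensor_coalgebra = \<lparr>carr = Tc_ob, comul = Tc_comul, counit = counit H \<cdot> Tc_proj 0\<rparr>"

end

end

end

theory Submission
  imports Defs "HOL-Library.Nat_Bijection"
begin

text \<open>
  The cotensor powers \<open>T n\<close> are iterated equalizers \<open>E n : T (n + 1) \<rightarrow> T n \<otimes> M\<close>, and
  \<open>(p\<^sub>n \<otimes> p\<^sub>1) \<Delta> = E n \<cdot> p\<^sub>n\<^sub>+\<^sub>1\<close>. By AB5 the projections \<open>p\<^sub>n\<close> of the direct sum \<open>T\<close> are jointly
  monic, and \<open>E n\<close> is monic, so an arrow \<open>f\<close> into \<open>T\<close> that respects the comultiplications is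
  determined by \<open>p\<^sub>0 f\<close> and \<open>p\<^sub>1 f\<close>.

  Conversely, let \<open>f\<^sub>0 : B \<rightarrow> H\<close> be a coalgebra homomorphism and \<open>f\<^sub>1 : B \<rightarrow> M\<close> a homomorphism of
  bicomodules along \<open>f\<^sub>0\<close>. Then \<open>E n \<cdot> F\<^sub>n\<^sub>+\<^sub>1 = (F\<^sub>n \<otimes> f\<^sub>1) \<Delta>\<close> defines the components of a
  homomorphism into the product of the \<open>T n\<close>; if \<open>B\<close> is graded and \<open>f\<^sub>0\<close>, \<open>f\<^sub>1\<close> are concentrated in
  degrees 0 and 1, then \<open>F\<^sub>n\<close> is concentrated in degree \<open>n\<close> and they assemble to a graded coalgebra
  homomorphism \<open>B \<rightarrow> T\<close>. For \<open>B = T \<otimes> T\<close> the axioms of a Hopf bimodule are exactly what is needed.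

  The tensor product of a braided category is a monoidal functor and the associator and the unitors
  are monoidal transformations, so both sides of the associativity and unit laws respect the
  comultiplications, and uniqueness reduces these laws to the degrees 0 and 1.
\<close>

section \<open>Coherence in braided monoidal categories\<close>

text \<open>Two obstacles shape the proof. In an abelian category the canonical arrow from a direct
  sum to the product need not be monic, so identities of arrows into T cannot in general be tested
  on the projections; AB5 is what allows this test, for T and for its tensor square and cube, which
  are again countable direct sums because the tensor product commutes with them. Conversely, the
  recursively built components form a family into the product, and nothing like local nilpotency is
  available on T \<otimes> T to sum them; the grading replaces it, since on each homogeneous summand
  a single component survives. Exactness of the tensor product enters at every step of the tower: it
  keeps the whiskered \<open>E n\<close> equalizers, so that arrows into a cotensor power can be
  constructed and \<open>E n\<close> can be cancelled under further tensor factors. As nothing is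
  strict, coherence is decided by rewriting to a normal form in which, besides the constraints, the
  only generator is the braiding of two adjacent factors.\<close>

context category
begin

text \<open>As a rewrite rule this turns typing conditions into equations between domains and
  codomains, which the simplifier settles. Proofs that must keep a \<open>Hom\<close> membership
  intact remove it locally.\<close>

lemma in_Hom [simp]: "f \<in> Hom C A B \<longleftrightarrow> f \<in> Ar C \<and> Dom C f = A \<and> Cod C f = B"
  by (simp add: Hom_def)

lemma Dom_in_Ob [simp]: "f \<in> Ar C \<Longrightarrow> Dom C f \<in> Ob C"
  by (rule Dom_Ob)

lemma Cod_in_Ob [simp]: "f \<in> Ar C \<Longrightarrow> Cod C f \<in> Ob C"
  by (rule Cod_Ob)

lemma ident_simps [simp]:
  assumes "A \<in> Ob C"
  shows "\<^bold>1 A \<in> Ar C" "Dom C (\<^bold>1 A) = A" "Cod C (\<^bold>1 A) = A"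
  using ident_Hom[OF assms] by simp_all

lemma compose_simps [simp]:
  assumes "f \<in> Ar C" "g \<in> Ar C" "Cod C f = Dom C g"
  shows "g \<cdot> f \<in> Ar C" "Dom C (g \<cdot> f) = Dom C f" "Cod C (g \<cdot> f) = Cod C g"
  using compose_Hom[of f "Dom C f" "Cod C f" g "Cod C g"] assms by simp_all

lemma ident_compose [simp]: "f \<in> Ar C \<Longrightarrow> Cod C f = B \<Longrightarrow> \<^bold>1 B \<cdot> f = f"
  using ident_left[of f "Dom C f" B] by simp

lemma compose_ident [simp]: "f \<in> Ar C \<Longrightarrow> Dom C f = A \<Longrightarrow> f \<cdot> \<^bold>1 A = f"
  using ident_right[of f A "Cod C f"] by simp

lemma assoc_compose [simp]:
  assumes "f \<in> Ar C" "g \<in> Ar C" "h \<in> Ar C" "Cod C f = Dom C g" "Cod C g = Dom C h"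
  shows "(h \<cdot> g) \<cdot> f = h \<cdot> (g \<cdot> f)"
  using compose_assoc[of f "Dom C f" "Cod C f" g "Cod C g" h "Cod C h"] assms by simp

text \<open>Composites are kept nested to the right, so an equation for \<open>g \<cdot> f\<close>
  does not occur literally inside a longer composite. The version with a tail \<open>x\<close> does,
  and is the form in which most later equations are applied.\<close>

lemma compose_reduce:
  assumes "g \<cdot> f = h" "f \<in> Ar C" "g \<in> Ar C" "Cod C f = Dom C g"
    "x \<in> Ar C" "Cod C x = Dom C f"
  shows "g \<cdot> (f \<cdot> x) = h \<cdot> x"
  using assoc_compose[of x f g] assms by simp

lemma are_inverse_unique:
  assumes "are_inverse C f g" "are_inverse C f h"
  shows "g = h"
proof -
  have "g = g \<cdot> (f \<cdot> h)" using assms by (simp add: are_inverse_def)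
  also have "\<dots> = (g \<cdot> f) \<cdot> h" using assms by (subst assoc_compose) (simp_all add: are_inverse_def)
  also have "\<dots> = h" using assms by (simp add: are_inverse_def)
  finally show ?thesis .
qed

lemma inverse_ar_eqI: "are_inverse C f g \<Longrightarrow> inverse_ar C f = g"
  unfolding inverse_ar_def by (blast intro: are_inverse_unique)

lemma are_inverse_inverse_ar: "is_iso C f \<Longrightarrow> are_inverse C f (inverse_ar C f)"
  using inverse_ar_eqI by (fastforce simp: is_iso_def)

lemma inverse_simps:
  assumes "is_iso C f"
  shows "inverse_ar C f \<in> Ar C" "Dom C (inverse_ar C f) = Cod C f"
    "Cod C (inverse_ar C f) = Dom C f"
    "f \<cdot> inverse_ar C f = \<^bold>1 (Cod C f)" "inverse_ar C f \<cdot> f = \<^bold>1 (Dom C f)"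
  using are_inverse_inverse_ar[OF assms] by (simp_all add: are_inverse_def)

text \<open>One-sided inverses as a predicate: the simplifier discharges it recursively under
    whiskering, so
  that an isomorphism cancels against its inverse at any depth.\<close>

definition inv_pair :: "'a \<Rightarrow> 'a \<Rightarrow> bool" where
  "inv_pair g f \<longleftrightarrow> f \<in> Ar C \<and> g \<in> Ar C \<and> Cod C f = Dom C g \<and> Cod C g = Dom C f \<and> g \<cdot> f = \<^bold>1 (Dom C f)"

lemma inv_pair_cancel:
  assumes "inv_pair g f"
  shows "g \<cdot> f = \<^bold>1 (Dom C f)" "x \<in> Ar C \<Longrightarrow> Cod C x = Dom C f \<Longrightarrow> g \<cdot> (f \<cdot> x) = x"
  using assms compose_reduce[of g f "\<^bold>1 (Dom C f)" x] by (auto simp: inv_pair_def)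

end

section \<open>Monoidal coherence: whiskering and the associator\<close>

context monoidal_category
begin

abbreviation associator_inv :: "'o \<Rightarrow> 'o \<Rightarrow> 'o \<Rightarrow> 'a" ("\<beta>") where
  "\<beta> A B D \<equiv> inverse_ar C (\<alpha> A B D)"

text \<open>A whiskering has one active factor: functoriality splits it along composites and
  naturality moves it inwards. A tensor of two arrows is reduced to two whiskerings by
  \<open>tensor_split\<close>.\<close>

definition lw :: "'o \<Rightarrow> 'a \<Rightarrow> 'a" (infixr "\<lhd>" 76) where
  "X \<lhd> f = \<^bold>1 X \<otimes>\<^sub>a f"

definition rw :: "'a \<Rightarrow> 'o \<Rightarrow> 'a" (infixl "\<rhd>" 76) where
  "f \<rhd> X = f \<otimes>\<^sub>a \<^bold>1 X"

lemma tensor_ob_simps [simp]: "\<lbrakk>A \<in> Ob C; B \<in> Ob C\<rbrakk> \<Longrightarrow> A \<otimes>\<^sub>o B \<in> Ob C"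
  by (rule tensor_Ob)

lemma unit_ob_simps [simp]: "\<I> \<in> Ob C"
  by (rule unit_Ob)

lemma tensor_ar_simps [simp]:
  assumes "f \<in> Ar C" "g \<in> Ar C"
  shows "f \<otimes>\<^sub>a g \<in> Ar C" "Dom C (f \<otimes>\<^sub>a g) = Dom C f \<otimes>\<^sub>o Dom C g"
    "Cod C (f \<otimes>\<^sub>a g) = Cod C f \<otimes>\<^sub>o Cod C g"
  using tensor_Hom[of f "Dom C f" "Cod C f" g "Dom C g" "Cod C g"] assms by simp_all

lemma compose_tensor:
  assumes "f \<in> Ar C" "f' \<in> Ar C" "g \<in> Ar C" "g' \<in> Ar C" "Cod C f = Dom C f'" "Cod C g = Dom C g'"
  shows "(f' \<otimes>\<^sub>a g') \<cdot> (f \<otimes>\<^sub>a g) = (f' \<cdot> f) \<otimes>\<^sub>a (g' \<cdot> g)"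
  using tensor_compose[of f "Dom C f" "Cod C f" f' "Cod C f'" g "Dom C g" "Cod C g" g' "Cod C g'"]
    assms by simp

lemma tensor_ident_simps [simp]: "\<lbrakk>A \<in> Ob C; B \<in> Ob C\<rbrakk> \<Longrightarrow> \<^bold>1 A \<otimes>\<^sub>a \<^bold>1 B = \<^bold>1 (A \<otimes>\<^sub>o B)"
  by (rule tensor_ident)

lemma assoc_simps [simp]:
  assumes "A \<in> Ob C" "B \<in> Ob C" "D \<in> Ob C"
  shows "\<alpha> A B D \<in> Ar C" "Dom C (\<alpha> A B D) = (A \<otimes>\<^sub>o B) \<otimes>\<^sub>o D"
    "Cod C (\<alpha> A B D) = A \<otimes>\<^sub>o (B \<otimes>\<^sub>o D)"
    "\<beta> A B D \<in> Ar C" "Cod C (\<beta> A B D) = (A \<otimes>\<^sub>o B) \<otimes>\<^sub>o D"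
    "Dom C (\<beta> A B D) = A \<otimes>\<^sub>o (B \<otimes>\<^sub>o D)"
  using assoc_Hom[OF assms] inverse_simps[of "\<alpha> A B D"] by simp_all

lemma inv_pair_assoc [simp]:
  assumes "A \<in> Ob C" "B \<in> Ob C" "D \<in> Ob C"
  shows "inv_pair (\<alpha> A B D) (\<beta> A B D)" "inv_pair (\<beta> A B D) (\<alpha> A B D)"
  using assoc_Hom[OF assms] inverse_simps[of "\<alpha> A B D"] by (simp_all add: inv_pair_def assms)

lemma lw_simps [simp]:
  assumes "X \<in> Ob C" "f \<in> Ar C"
  shows "X \<lhd> f \<in> Ar C" "Dom C (X \<lhd> f) = X \<otimes>\<^sub>o Dom C f" "Cod C (X \<lhd> f) = X \<otimes>\<^sub>o Cod C f"
  using assms by (simp_all add: lw_def)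

lemma rw_simps [simp]:
  assumes "X \<in> Ob C" "f \<in> Ar C"
  shows "f \<rhd> X \<in> Ar C" "Dom C (f \<rhd> X) = Dom C f \<otimes>\<^sub>o X" "Cod C (f \<rhd> X) = Cod C f \<otimes>\<^sub>o X"
  using assms by (simp_all add: rw_def)

lemma whisker_ident [simp]:
  assumes "X \<in> Ob C" "Y \<in> Ob C"
  shows "X \<lhd> \<^bold>1 Y = \<^bold>1 (X \<otimes>\<^sub>o Y)" "\<^bold>1 X \<rhd> Y = \<^bold>1 (X \<otimes>\<^sub>o Y)"
  using assms by (simp_all add: lw_def rw_def)

lemma whisker_compose:
  assumes "X \<in> Ob C" "f \<in> Ar C" "g \<in> Ar C" "Cod C f = Dom C g"
  shows "X \<lhd> (g \<cdot> f) = X \<lhd> g \<cdot> X \<lhd> f" "(g \<cdot> f) \<rhd> X = g \<rhd> X \<cdot> f \<rhd> X"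
  using assms by (simp_all add: lw_def rw_def compose_tensor)

lemma tensor_split:
  assumes "f \<in> Ar C" "g \<in> Ar C"
  shows "f \<otimes>\<^sub>a g = f \<rhd> Cod C g \<cdot> Dom C f \<lhd> g"
  using assms by (simp add: lw_def rw_def compose_tensor)

text \<open>Bifunctoriality of the tensor product. It stays outside \<open>whisker_normal\<close>,
  since neither order of the two arrows is preferred, and is invoked by hand where two arrows act on
  different factors.\<close>

lemma interchange:
  assumes "f \<in> Ar C" "g \<in> Ar C" "Dom C f = A" "Cod C f = A'" "Dom C g = B" "Cod C g = B'"
  shows "f \<rhd> B' \<cdot> A \<lhd> g = A' \<lhd> g \<cdot> f \<rhd> B"
  using assms Dom_Ob[of f] Cod_Ob[of f] Dom_Ob[of g] Cod_Ob[of g]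
  by (simp add: lw_def rw_def compose_tensor)

lemma inv_pair_lw [simp]:
  assumes "X \<in> Ob C" "inv_pair g f"
  shows "inv_pair (X \<lhd> g) (X \<lhd> f)"
  using assms whisker_compose(1)[of X f g] by (auto simp add: inv_pair_def)

lemma assoc_nat_ar:
  assumes "f \<in> Ar C" "g \<in> Ar C" "h \<in> Ar C"
  shows "\<alpha> (Cod C f) (Cod C g) (Cod C h) \<cdot> ((f \<otimes>\<^sub>a g) \<otimes>\<^sub>a h)
    = (f \<otimes>\<^sub>a (g \<otimes>\<^sub>a h)) \<cdot> \<alpha> (Dom C f) (Dom C g) (Dom C h)"
  using assms by (intro assoc_natural) simp_all

lemma inv_pair_move:
  assumes "inv_pair b a" "a \<cdot> f = g" "f \<in> Ar C" "Cod C f = Dom C a"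
  shows "f = b \<cdot> g"
  using inv_pair_cancel(2)[OF assms(1), of f] assms by simp

text \<open>Naturality of the associator with two identity arguments, solved for the form that is to
  disappear. What remains are left whiskerings by single objects around at most one right
  whiskering.\<close>

lemma whisker_whisker:
  assumes "X \<in> Ob C" "Y \<in> Ob C" "f \<in> Ar C"
  shows "(X \<otimes>\<^sub>o Y) \<lhd> f = \<beta> X Y (Cod C f) \<cdot> X \<lhd> (Y \<lhd> f) \<cdot> \<alpha> X Y (Dom C f)"
    "(f \<rhd> X) \<rhd> Y = \<beta> (Cod C f) X Y \<cdot> f \<rhd> (X \<otimes>\<^sub>o Y) \<cdot> \<alpha> (Dom C f) X Y"
    "(X \<lhd> f) \<rhd> Y = \<beta> X (Cod C f) Y \<cdot> X \<lhd> (f \<rhd> Y) \<cdot> \<alpha> X (Dom C f) Y"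
proof -
  note [simp] = assms
  show "(X \<otimes>\<^sub>o Y) \<lhd> f = \<beta> X Y (Cod C f) \<cdot> X \<lhd> (Y \<lhd> f) \<cdot> \<alpha> X Y (Dom C f)"
    by (rule inv_pair_move[where a = "\<alpha> X Y (Cod C f)"]) (use assoc_nat_ar[of "\<^bold>1 X"
        "\<^bold>1 Y" f] in \<open>simp_all add: lw_def rw_def\<close>)
  show "(f \<rhd> X) \<rhd> Y = \<beta> (Cod C f) X Y \<cdot> f \<rhd> (X \<otimes>\<^sub>o Y) \<cdot> \<alpha> (Dom C f) X Y"
    by (rule inv_pair_move[where a = "\<alpha> (Cod C f) X Y"]) (use assoc_nat_ar[of f "\<^bold>1 X"
        "\<^bold>1 Y"] in \<open>simp_all add: lw_def rw_def\<close>)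
  show "(X \<lhd> f) \<rhd> Y = \<beta> X (Cod C f) Y \<cdot> X \<lhd> (f \<rhd> Y) \<cdot> \<alpha> X (Dom C f) Y"
    by (rule inv_pair_move[where a = "\<alpha> X (Cod C f) Y"]) (use assoc_nat_ar[of "\<^bold>1 X" f
        "\<^bold>1 Y"] in \<open>simp_all add: lw_def rw_def\<close>)
qed

text \<open>The pentagon solved for its right-whiskered edge, a form that
  \<open>whisker_whisker\<close> does not reach.\<close>

lemma pentagon_rw:
  assumes [simp]: "A \<in> Ob C" "B \<in> Ob C" "D \<in> Ob C" "E \<in> Ob C"
  shows "\<alpha> A B D \<rhd> E
      = \<beta> A (B \<otimes>\<^sub>o D) E \<cdot> A \<lhd> \<beta> B D E \<cdot> \<alpha> A B (D \<otimes>\<^sub>o E) \<cdot> \<alpha> (A \<otimes>\<^sub>o B) D E" (is "?a = ?b")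
    and "\<beta> A B D \<rhd> E
      = \<beta> (A \<otimes>\<^sub>o B) D E \<cdot> \<beta> A B (D \<otimes>\<^sub>o E) \<cdot> A \<lhd> \<alpha> B D E \<cdot> \<alpha> A (B \<otimes>\<^sub>o D) E" (is "?c = ?d")
proof -
  have "A \<lhd> \<alpha> B D E \<cdot> \<alpha> A (B \<otimes>\<^sub>o D) E \<cdot> \<alpha> A B D \<rhd> E = \<alpha> A B (D \<otimes>\<^sub>o E) \<cdot> \<alpha> (A \<otimes>\<^sub>o B) D E"
    by (simp add: lw_def rw_def pentagon)
  hence "?b = \<beta> A (B \<otimes>\<^sub>o D) E \<cdot> A \<lhd> \<beta> B D E \<cdot> A \<lhd> \<alpha> B D E \<cdot> \<alpha> A (B \<otimes>\<^sub>o D) E \<cdot> \<alpha> A B D \<rhd> E"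
    by simp
  thus 1: "?a = ?b" by (simp add: inv_pair_cancel)
  \<comment> \<open>\<open>?b \<cdot> ?d\<close> is an identity by cancellation of associators, and
    \<open>?c \<cdot> ?a\<close> is a whiskered identity; so the second formula is the inverse of
    the first.\<close>
  have "?c = ?c \<cdot> ?b \<cdot> ?d" by (simp add: inv_pair_cancel)
  also have "\<dots> = ?c \<cdot> ?a \<cdot> ?d" using 1 by simp
  also have "?c \<cdot> ?a \<cdot> ?d = (?c \<cdot> ?a) \<cdot> ?d" by simp
  also have "?c \<cdot> ?a = \<^bold>1 (((A \<otimes>\<^sub>o B) \<otimes>\<^sub>o D) \<otimes>\<^sub>o E)"
    using whisker_compose(2)[of E "\<alpha> A B D" "\<beta> A B D"] by (simp add: inv_pair_cancel)
  finally show "?c = ?d" by simp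
qed

text \<open>These rules push every whiskering down to the generating arrows and bracket the objects to the
  right; the associators then meet their inverses and cancel.\<close>

lemmas whisker_normal = whisker_compose whisker_whisker pentagon_rw inv_pair_cancel

end

section \<open>The braiding and the hexagons\<close>

context braided_monoidal_category
begin

lemma braiding_simps [simp]:
  assumes "A \<in> Ob C" "B \<in> Ob C"
  shows "\<c> A B \<in> Ar C" "Dom C (\<c> A B) = A \<otimes>\<^sub>o B" "Cod C (\<c> A B) = B \<otimes>\<^sub>o A"
  using braiding_Hom[OF assms] by simp_all

text \<open>The braiding of \<open>B\<close> past \<open>D\<close> in front of a tail \<open>E\<close>. The hexagons become
  rewrite rules for it that fit the right-bracketed normal form.\<close>

definition slide :: "'o \<Rightarrow> 'o \<Rightarrow> 'o \<Rightarrow> 'a" where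
  "slide B D E = \<alpha> D B E \<cdot> \<c> B D \<rhd> E \<cdot> \<beta> B D E"

lemma slide_simps [simp]:
  assumes "B \<in> Ob C" "D \<in> Ob C" "E \<in> Ob C"
  shows "slide B D E \<in> Ar C" "Dom C (slide B D E) = B \<otimes>\<^sub>o (D \<otimes>\<^sub>o E)"
    "Cod C (slide B D E) = D \<otimes>\<^sub>o (B \<otimes>\<^sub>o E)"
  using assms by (simp_all add: slide_def)

lemma mid_braiding_slide:
  assumes "A \<in> Ob C" "B \<in> Ob C" "D \<in> Ob C" "E \<in> Ob C"
  shows "mid_braiding C A B D E = \<beta> A D (B \<otimes>\<^sub>o E) \<cdot> A \<lhd> slide B D E \<cdot> \<alpha> A B (D \<otimes>\<^sub>o E)"
  by (simp add: mid_braiding_def slide_def lw_def rw_def)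

lemma slide_rw:
  assumes [simp]: "B \<in> Ob C" "D \<in> Ob C" "E \<in> Ob C" "E' \<in> Ob C"
  shows "slide B D E \<rhd> E' = \<beta> D (B \<otimes>\<^sub>o E) E' \<cdot> D \<lhd> \<beta> B E E' \<cdot> slide B D (E \<otimes>\<^sub>o E')
      \<cdot> B \<lhd> \<alpha> D E E' \<cdot> \<alpha> B (D \<otimes>\<^sub>o E) E'"
  by (simp add: slide_def whisker_normal)

lemma slide_tensor_left:
  assumes [simp]: "A \<in> Ob C" "B \<in> Ob C" "D \<in> Ob C" "E \<in> Ob C"
  shows "slide (A \<otimes>\<^sub>o B) D E = D \<lhd> \<beta> A B E \<cdot> slide A D (B \<otimes>\<^sub>o E) \<cdot> A \<lhd> slide B D E
      \<cdot> \<alpha> A B (D \<otimes>\<^sub>o E)"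
proof -
  have "\<c> (A \<otimes>\<^sub>o B) D = \<alpha> D A B \<cdot> (\<beta> D A B \<cdot> \<c> (A \<otimes>\<^sub>o B) D \<cdot> \<beta> A B D) \<cdot> \<alpha> A B D"
    by (simp add: inv_pair_cancel)
  also have "\<dots> = \<alpha> D A B \<cdot> \<c> A D \<rhd> B \<cdot> \<beta> A D B \<cdot> A \<lhd> \<c> B D \<cdot> \<alpha> A B D"
    by (subst hexagon2) (simp_all add: lw_def rw_def)
  finally show ?thesis by (simp add: slide_def whisker_normal)
qed

lemma slide_tensor_right:
  assumes [simp]: "A \<in> Ob C" "B \<in> Ob C" "D \<in> Ob C" "E \<in> Ob C"
  shows "slide A (B \<otimes>\<^sub>o D) E = \<beta> B D (A \<otimes>\<^sub>o E) \<cdot> B \<lhd> slide A D E \<cdot> slide A B (D \<otimes>\<^sub>o E)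
      \<cdot> A \<lhd> \<alpha> B D E"
proof -
  have "\<c> A (B \<otimes>\<^sub>o D) = \<beta> B D A \<cdot> (\<alpha> B D A \<cdot> \<c> A (B \<otimes>\<^sub>o D) \<cdot> \<alpha> A B D) \<cdot> \<beta> A B D"
    by (simp add: inv_pair_cancel)
  also have "\<dots> = \<beta> B D A \<cdot> B \<lhd> \<c> A D \<cdot> \<alpha> B A D \<cdot> \<c> A B \<rhd> D \<cdot> \<beta> A B D"
    by (subst hexagon1) (simp_all add: lw_def rw_def)
  finally show ?thesis by (simp add: slide_def whisker_normal)
qed

lemma slide_natural_tail:
  assumes "B \<in> Ob C" "D \<in> Ob C" "h \<in> Ar C" "Dom C h = E" "Cod C h = E'"
  shows "slide B D E' \<cdot> B \<lhd> (D \<lhd> h) = D \<lhd> (B \<lhd> h) \<cdot> slide B D E"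
proof -
  have [simp]: "E \<in> Ob C" "E' \<in> Ob C" using assms Dom_Ob[of h] Cod_Ob[of h] by simp_all
  have "\<c> B D \<rhd> E' \<cdot> (B \<otimes>\<^sub>o D) \<lhd> h = (D \<otimes>\<^sub>o B) \<lhd> h \<cdot> \<c> B D \<rhd> E"
    using assms by (intro interchange) auto
  hence *: "\<alpha> D B E' \<cdot> (\<c> B D \<rhd> E' \<cdot> (B \<otimes>\<^sub>o D) \<lhd> h) \<cdot> \<beta> B D E = \<alpha> D B E' \<cdot> ((D \<otimes>\<^sub>o B) \<lhd> h
      \<cdot> \<c> B D \<rhd> E) \<cdot> \<beta> B D E"
    by simp
  show ?thesis using * assms by (simp add: slide_def whisker_normal)
qed

lemma mid_braiding_simps [simp]:
  assumes "A \<in> Ob C" "B \<in> Ob C" "D \<in> Ob C" "E \<in> Ob C"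
  shows "mid_braiding C A B D E \<in> Ar C"
    "Dom C (mid_braiding C A B D E) = (A \<otimes>\<^sub>o B) \<otimes>\<^sub>o (D \<otimes>\<^sub>o E)"
    "Cod C (mid_braiding C A B D E) = (A \<otimes>\<^sub>o D) \<otimes>\<^sub>o (B \<otimes>\<^sub>o E)"
  using assms by (simp_all add: mid_braiding_slide)

end

section \<open>Unit constraints\<close>

context monoidal_category
begin

lemma lw_compose_reduce:
  assumes "X \<in> Ob C" "f \<in> Ar C" "g \<in> Ar C" "Cod C f = Dom C g" "g \<cdot> f = h"
  shows "X \<lhd> g \<cdot> X \<lhd> f = X \<lhd> h"
    "x \<in> Ar C \<Longrightarrow> Cod C x = X \<otimes>\<^sub>o Dom C f \<Longrightarrow> X \<lhd> g \<cdot> (X \<lhd> f \<cdot> x) = X \<lhd> h \<cdot> x"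
proof -
  show *: "X \<lhd> g \<cdot> X \<lhd> f = X \<lhd> h"
    using whisker_compose(1)[of X f g] assms by simp
  show "x \<in> Ar C \<Longrightarrow> Cod C x = X \<otimes>\<^sub>o Dom C f \<Longrightarrow> X \<lhd> g \<cdot> (X \<lhd> f \<cdot> x) = X \<lhd> h \<cdot> x"
    using compose_reduce[OF *, of x] assms by simp
qed

abbreviation left_unitor_inv :: "'o \<Rightarrow> 'a" where
  "left_unitor_inv A \<equiv> inverse_ar C (\<l> A)"

abbreviation right_unitor_inv :: "'o \<Rightarrow> 'a" where
  "right_unitor_inv A \<equiv> inverse_ar C (\<r> A)"

lemma unitor_simps [simp]:
  assumes "A \<in> Ob C"
  shows "\<l> A \<in> Ar C" "Dom C (\<l> A) = \<I> \<otimes>\<^sub>o A" "Cod C (\<l> A) = A"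
    "\<r> A \<in> Ar C" "Dom C (\<r> A) = A \<otimes>\<^sub>o \<I>" "Cod C (\<r> A) = A"
    "left_unitor_inv A \<in> Ar C" "Cod C (left_unitor_inv A) = \<I> \<otimes>\<^sub>o A" "Dom C (left_unitor_inv A) = A"
    "right_unitor_inv A \<in> Ar C" "Cod C (right_unitor_inv A) = A \<otimes>\<^sub>o \<I>" "Dom C (right_unitor_inv A)
        = A"
  using lunit_Hom[OF assms] runit_Hom[OF assms] inverse_simps[of "\<l> A"] inverse_simps[of "\<r> A"]
  by simp_all

lemma inv_pair_unitor [simp]:
  assumes "A \<in> Ob C"
  shows "inv_pair (\<l> A) (left_unitor_inv A)" "inv_pair (left_unitor_inv A) (\<l> A)"
    "inv_pair (\<r> A) (right_unitor_inv A)" "inv_pair (right_unitor_inv A) (\<r> A)"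
  using lunit_Hom[OF assms] runit_Hom[OF assms] inverse_simps[of "\<l> A"] inverse_simps[of
      "\<r> A"] assms
  by (simp_all add: inv_pair_def)

lemma unitor_natural:
  assumes "f \<in> Ar C"
  shows "\<l> (Cod C f) \<cdot> \<I> \<lhd> f = f \<cdot> \<l> (Dom C f)" "\<r> (Cod C f) \<cdot> f \<rhd> \<I> = f \<cdot> \<r> (Dom C f)"
  using lunit_natural[of f] runit_natural[of f] assms by (simp_all add: lw_def rw_def)

lemma cancel_left:
  assumes "inv_pair b a" "a \<cdot> f = a \<cdot> g" "f \<in> Ar C" "g \<in> Ar C" "Cod C f = Dom C a" "Cod C g
      = Dom C a"
  shows "f = g"
proof -
  have "f = b \<cdot> (a \<cdot> f)" using inv_pair_cancel(2)[OF assms(1), of f] assms(3,5) by simp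
  also have "\<dots> = b \<cdot> (a \<cdot> g)" by (simp only: assms(2))
  also have "\<dots> = g" using inv_pair_cancel(2)[OF assms(1), of g] assms(4,6) by simp
  finally show ?thesis .
qed

lemma cancel_right:
  assumes "inv_pair a b" "f \<cdot> a = g \<cdot> a" "f \<in> Ar C" "g \<in> Ar C" "Cod C a = Dom C f" "Cod C a
      = Dom C g"
  shows "f = g"
proof -
  have "f = (f \<cdot> a) \<cdot> b" using assms(1,3-) by (simp add: inv_pair_def)
  also have "\<dots> = (g \<cdot> a) \<cdot> b" using assms by simp
  also have "\<dots> = g" using assms(1,3-) by (simp add: inv_pair_def)
  finally show ?thesis .
qed

text \<open>The unitors make tensoring with \<open>\<I>\<close> naturally isomorphic to the identity
  functor. Equations between unit constraints can therefore be tested after adding a factor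
  \<open>\<I>\<close>.\<close>

lemma unit_whisker_faithful:
  assumes "f \<in> Ar C" "g \<in> Ar C" "Dom C f = Dom C g" "Cod C f = Cod C g"
  shows "\<I> \<lhd> f = \<I> \<lhd> g \<Longrightarrow> f = g" "f \<rhd> \<I> = g \<rhd> \<I> \<Longrightarrow> f = g"
proof -
  assume "\<I> \<lhd> f = \<I> \<lhd> g"
  hence "f \<cdot> \<l> (Dom C f) = g \<cdot> \<l> (Dom C f)"
    using unitor_natural[of f] unitor_natural[of g] assms by simp
  thus "f = g"
    by (rule cancel_right[rotated, where b = "left_unitor_inv (Dom C f)"]) (use assms in simp_all)
next
  assume "f \<rhd> \<I> = g \<rhd> \<I>"
  hence "f \<cdot> \<r> (Dom C f) = g \<cdot> \<r> (Dom C f)"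
    using unitor_natural[of f] unitor_natural[of g] assms by simp
  thus "f = g"
    by (rule cancel_right[rotated, where b = "right_unitor_inv (Dom C f)"]) (use assms in simp_all)
qed

lemma triangle_rw:
  assumes "A \<in> Ob C" "B \<in> Ob C"
  shows "\<r> A \<rhd> B = A \<lhd> \<l> B \<cdot> \<alpha> A \<I> B"
  using triangle[OF assms] by (simp add: lw_def rw_def)

text \<open>Kelly's argument: only the triangle with the unit in the middle is an axiom. A doubly
  whiskered \<open>\<r> \<I>\<close> is evaluated twice, once merging the two whiskerings first and
  once applying the triangle first; then all isomorphisms are cancelled.\<close>

lemma left_unitor_rw:
  assumes [simp]: "A \<in> Ob C" "B \<in> Ob C"
  shows "\<l> A \<rhd> B = \<l> (A \<otimes>\<^sub>o B) \<cdot> \<alpha> \<I> A B"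
proof -
  have "(\<r> \<I> \<rhd> A) \<rhd> B = \<beta> \<I> A B \<cdot> \<I> \<lhd> \<l> (A \<otimes>\<^sub>o B) \<cdot> \<alpha> \<I> \<I> (A \<otimes>\<^sub>o B) \<cdot> \<alpha> (\<I> \<otimes>\<^sub>o \<I>) A B"
    by (subst whisker_whisker) (simp_all add: triangle_rw)
  moreover have "(\<r> \<I> \<rhd> A) \<rhd> B = \<beta> \<I> A B \<cdot> \<I> \<lhd> (\<l> A \<rhd> B \<cdot> \<beta> \<I> A B)
     \<cdot> \<alpha> \<I> \<I> (A \<otimes>\<^sub>o B) \<cdot> \<alpha> (\<I> \<otimes>\<^sub>o \<I>) A B"
    by (subst triangle_rw) (simp_all add: whisker_normal)
  ultimately have "\<beta> \<I> A B \<cdot> \<I> \<lhd> (\<l> A \<rhd> B \<cdot> \<beta> \<I> A B)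
     \<cdot> \<alpha> \<I> \<I> (A \<otimes>\<^sub>o B) \<cdot> \<alpha> (\<I> \<otimes>\<^sub>o \<I>) A B =
     \<beta> \<I> A B \<cdot> \<I> \<lhd> \<l> (A \<otimes>\<^sub>o B) \<cdot> \<alpha> \<I> \<I> (A \<otimes>\<^sub>o B) \<cdot> \<alpha> (\<I> \<otimes>\<^sub>o \<I>) A B" by simp
  hence "\<I> \<lhd> (\<l> A \<rhd> B \<cdot> \<beta> \<I> A B) \<cdot> \<alpha> \<I> \<I> (A \<otimes>\<^sub>o B) \<cdot> \<alpha> (\<I> \<otimes>\<^sub>o \<I>) A B
    = \<I> \<lhd> \<l> (A \<otimes>\<^sub>o B) \<cdot> \<alpha> \<I> \<I> (A \<otimes>\<^sub>o B) \<cdot> \<alpha> (\<I> \<otimes>\<^sub>o \<I>) A B"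
    by (rule cancel_left[rotated, where b = "\<alpha> \<I> A B"]) simp_all
  hence "(\<I> \<lhd> (\<l> A \<rhd> B \<cdot> \<beta> \<I> A B) \<cdot> \<alpha> \<I> \<I> (A \<otimes>\<^sub>o B)) \<cdot> \<alpha> (\<I> \<otimes>\<^sub>o \<I>) A B
    = (\<I> \<lhd> \<l> (A \<otimes>\<^sub>o B) \<cdot> \<alpha> \<I> \<I> (A \<otimes>\<^sub>o B)) \<cdot> \<alpha> (\<I> \<otimes>\<^sub>o \<I>) A B" by simp
  hence "\<I> \<lhd> (\<l> A \<rhd> B \<cdot> \<beta> \<I> A B) \<cdot> \<alpha> \<I> \<I> (A \<otimes>\<^sub>o B)
    = \<I> \<lhd> \<l> (A \<otimes>\<^sub>o B) \<cdot> \<alpha> \<I> \<I> (A \<otimes>\<^sub>o B)"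
    by (rule cancel_right[rotated, where b = "\<beta> (\<I> \<otimes>\<^sub>o \<I>) A B"]) simp_all
  hence "\<I> \<lhd> (\<l> A \<rhd> B \<cdot> \<beta> \<I> A B) = \<I> \<lhd> \<l> (A \<otimes>\<^sub>o B)"
    by (rule cancel_right[rotated, where b = "\<beta> \<I> \<I> (A \<otimes>\<^sub>o B)"]) simp_all
  hence "\<l> A \<rhd> B \<cdot> \<beta> \<I> A B = \<l> (A \<otimes>\<^sub>o B)"
    by (rule unit_whisker_faithful(1)[rotated 4]) simp_all
  hence "(\<l> A \<rhd> B \<cdot> \<beta> \<I> A B) \<cdot> \<alpha> \<I> A B = \<l> (A \<otimes>\<^sub>o B) \<cdot> \<alpha> \<I> A B"
    by simp
  thus ?thesis by (simp add: inv_pair_cancel)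
qed

lemma right_unitor_lw:
  assumes [simp]: "A \<in> Ob C" "B \<in> Ob C"
  shows "A \<lhd> \<r> B = \<r> (A \<otimes>\<^sub>o B) \<cdot> \<beta> A B \<I>"
  by (rule unit_whisker_faithful(2)[rotated 4]) (simp_all add: triangle_rw whisker_normal)

text \<open>Naturality of \<open>\<l>\<close> at the arrow \<open>\<l> A\<close> itself, after which
  the invertible \<open>\<l> A\<close> is cancelled.\<close>

lemma left_unitor_unit: "\<l> (\<I> \<otimes>\<^sub>o A) = \<I> \<lhd> \<l> A" if [simp]: "A \<in> Ob C"
proof -
  have "\<l> A \<cdot> \<l> (\<I> \<otimes>\<^sub>o A) = \<l> A \<cdot> \<I> \<lhd> \<l> A"
    using unitor_natural(1)[of "\<l> A"] by simp
  thus ?thesis by (rule cancel_left[rotated, where b = "left_unitor_inv A"]) simp_all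
qed

lemma right_unitor_unit: "\<r> \<I> = \<l> \<I>"
proof (rule unit_whisker_faithful(2))
  show "\<r> \<I> \<rhd> \<I> = \<l> \<I> \<rhd> \<I>"
    by (simp add: triangle_rw left_unitor_rw left_unitor_unit)
qed simp_all

end

section \<open>The interchange \<open>mid_braiding\<close> as an opmonoidal structure\<close>

context braided_monoidal_category
begin

text \<open>Naturality of a slide in its tail, under one more whiskering and with a continuation
  \<open>x\<close>. In the two coherence lemmas below \<open>h\<close> is itself a slide: slides on
  disjoint factors commute.\<close>

lemma slide_lw_reduce:
  assumes "A \<in> Ob C" "B \<in> Ob C" "D \<in> Ob C" "h \<in> Ar C" "Dom C h = E" "Cod C h = E'"
    "x \<in> Ar C" "Cod C x = A \<otimes>\<^sub>o (B \<otimes>\<^sub>o (D \<otimes>\<^sub>o E))"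
  shows "A \<lhd> slide B D E' \<cdot> A \<lhd> (B \<lhd> (D \<lhd> h)) \<cdot> x = A \<lhd> (D \<lhd> (B \<lhd> h)) \<cdot> A \<lhd> slide B D E \<cdot> x"
proof -
  have [simp]: "E \<in> Ob C" "E' \<in> Ob C" using assms Dom_Ob[of h] Cod_Ob[of h] by simp_all
  have "A \<lhd> slide B D E' \<cdot> A \<lhd> (B \<lhd> (D \<lhd> h)) \<cdot> x = A \<lhd> (D \<lhd> (B \<lhd> h) \<cdot> slide B D E) \<cdot> x"
    using assms by (intro lw_compose_reduce slide_natural_tail) simp_all
  thus ?thesis using assms by (simp add: whisker_compose)
qed

text \<open>The tensor product, as a functor of two variables, is opmonoidal with structure arrow
  \<open>mid_braiding\<close>; this is its associativity axiom. In normal form the two sides differ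
  by the order of two slides on disjoint factors.\<close>

lemma mid_braiding_assoc:
  assumes [simp]: "A \<in> Ob C" "B \<in> Ob C" "D \<in> Ob C" "A' \<in> Ob C" "B' \<in> Ob C" "D' \<in> Ob C"
  shows "\<alpha> (A \<otimes>\<^sub>o A') (B \<otimes>\<^sub>o B') (D \<otimes>\<^sub>o D')
      \<cdot> mid_braiding C A B A' B' \<rhd> (D \<otimes>\<^sub>o D') \<cdot> mid_braiding C (A \<otimes>\<^sub>o B) D (A' \<otimes>\<^sub>o B') D'
    = (A \<otimes>\<^sub>o A') \<lhd> mid_braiding C B D B' D' \<cdot> mid_braiding C A (B \<otimes>\<^sub>o D) A' (B' \<otimes>\<^sub>o D')
      \<cdot> (\<alpha> A B D \<otimes>\<^sub>a \<alpha> A' B' D')"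
  by (simp add: mid_braiding_slide slide_rw slide_tensor_left slide_tensor_right tensor_split
      whisker_normal slide_lw_reduce[where h = "slide D B' D'" and D = A'])

text \<open>The associator is a monoidal transformation for the structure
  \<open>mid_braiding\<close>. This is why rebracketing will respect comultiplications of tensor
  products.\<close>

lemma mid_braiding_associator:
  assumes [simp]: "A \<in> Ob C" "B \<in> Ob C" "D \<in> Ob C" "A' \<in> Ob C" "B' \<in> Ob C" "D' \<in> Ob C"
  shows "(\<alpha> A B D \<otimes>\<^sub>a \<alpha> A' B' D') \<cdot> mid_braiding C (A \<otimes>\<^sub>o B) (A' \<otimes>\<^sub>o B') D D'
       \<cdot> mid_braiding C A A' B B' \<rhd> (D \<otimes>\<^sub>o D')
    = mid_braiding C A A' (B \<otimes>\<^sub>o D) (B' \<otimes>\<^sub>o D') \<cdot> (A \<otimes>\<^sub>o A') \<lhd> mid_braiding C B B' D D'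
      \<cdot> \<alpha> (A \<otimes>\<^sub>o A') (B \<otimes>\<^sub>o B') (D \<otimes>\<^sub>o D')"
  by (simp add: mid_braiding_slide slide_rw slide_tensor_left slide_tensor_right tensor_split
      whisker_normal slide_lw_reduce[where h = "slide B' D D'" and B = A'])

definition slide_inv :: "'o \<Rightarrow> 'o \<Rightarrow> 'o \<Rightarrow> 'a" where
  "slide_inv B D E = \<alpha> B D E \<cdot> inverse_ar C (\<c> B D) \<rhd> E \<cdot> \<beta> D B E"

lemma inv_pair_slide [simp]:
  assumes [simp]: "B \<in> Ob C" "D \<in> Ob C" "E \<in> Ob C"
  shows "inv_pair (slide_inv B D E) (slide B D E)" "inv_pair (slide B D E) (slide_inv B D E)"
proof -
  note [simp] = inverse_simps[of "\<c> B D", OF conjunct2[OF braiding_Hom[of B D]]]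
  have 1: "inverse_ar C (\<c> B D) \<rhd> E \<cdot> \<c> B D \<rhd> E = \<^bold>1 ((B \<otimes>\<^sub>o D) \<otimes>\<^sub>o E)"
    "\<c> B D \<rhd> E \<cdot> inverse_ar C (\<c> B D) \<rhd> E = \<^bold>1 ((D \<otimes>\<^sub>o B) \<otimes>\<^sub>o E)"
    using whisker_compose(2)[of E "\<c> B D" "inverse_ar C (\<c> B D)"]
      whisker_compose(2)[of E "inverse_ar C (\<c> B D)" "\<c> B D"] by simp_all
  note 2 = compose_reduce[OF 1(1)] compose_reduce[OF 1(2)]
  show "inv_pair (slide_inv B D E) (slide B D E)" "inv_pair (slide B D E) (slide_inv B D E)"
    unfolding inv_pair_def by (simp_all add: slide_def slide_inv_def inv_pair_cancel 1 2)
qed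

lemma braiding_nat_ar:
  assumes "f \<in> Ar C" "g \<in> Ar C"
  shows "\<c> (Cod C f) (Cod C g) \<cdot> (f \<otimes>\<^sub>a g) = (g \<otimes>\<^sub>a f) \<cdot> \<c> (Dom C f) (Dom C g)"
  using assms by (intro braiding_natural) simp_all

lemma assoc_inv_nat_ar:
  assumes "f \<in> Ar C" "g \<in> Ar C" "h \<in> Ar C"
  shows "\<beta> (Cod C f) (Cod C g) (Cod C h) \<cdot> (f \<otimes>\<^sub>a (g \<otimes>\<^sub>a h))
    = ((f \<otimes>\<^sub>a g) \<otimes>\<^sub>a h) \<cdot> \<beta> (Dom C f) (Dom C g) (Dom C h)"
proof -
  have "\<beta> (Cod C f) (Cod C g) (Cod C h) \<cdot> (f \<otimes>\<^sub>a (g \<otimes>\<^sub>a h)) =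
    \<beta> (Cod C f) (Cod C g) (Cod C h) \<cdot> ((f \<otimes>\<^sub>a (g \<otimes>\<^sub>a h)) \<cdot> \<alpha> (Dom C f) (Dom C g) (Dom C h)) \<cdot> \<beta>
        (Dom C f) (Dom C g) (Dom C h)"
    using assms by (simp add: inv_pair_cancel)
  also have "\<dots> = ((f \<otimes>\<^sub>a g) \<otimes>\<^sub>a h) \<cdot> \<beta> (Dom C f) (Dom C g) (Dom C h)"
    using assms by (subst assoc_nat_ar[symmetric]) (simp_all add: inv_pair_cancel)
  finally show ?thesis .
qed

lemma slide_natural:
  assumes "f \<in> Ar C" "g \<in> Ar C" "h \<in> Ar C"
  shows "slide (Cod C f) (Cod C g) (Cod C h) \<cdot> (f \<otimes>\<^sub>a (g \<otimes>\<^sub>a h))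
    = (g \<otimes>\<^sub>a (f \<otimes>\<^sub>a h)) \<cdot> slide (Dom C f) (Dom C g) (Dom C h)"
proof -
  have "\<c> (Cod C f) (Cod C g) \<rhd> Cod C h \<cdot> ((f \<otimes>\<^sub>a g) \<otimes>\<^sub>a h) = ((g \<otimes>\<^sub>a f) \<otimes>\<^sub>a h) \<cdot> \<c> (Dom C f)
      (Dom C g) \<rhd> Dom C h"
    using assms braiding_nat_ar[of f g] by (simp add: rw_def compose_tensor)
  note 1 = compose_reduce[OF this]
  note 2 = compose_reduce[OF assoc_nat_ar]
  note 3 = compose_reduce[OF assoc_inv_nat_ar]
  show ?thesis using assms by (simp add: slide_def 1 2 assoc_inv_nat_ar)
qed

lemma mid_braiding_natural:
  assumes "f \<in> Ar C" "g \<in> Ar C" "h \<in> Ar C" "k \<in> Ar C"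
  shows "mid_braiding C (Cod C f) (Cod C g) (Cod C h) (Cod C k) \<cdot> ((f \<otimes>\<^sub>a g) \<otimes>\<^sub>a (h \<otimes>\<^sub>a k))
    = ((f \<otimes>\<^sub>a h) \<otimes>\<^sub>a (g \<otimes>\<^sub>a k)) \<cdot> mid_braiding C (Dom C f) (Dom C g) (Dom C h) (Dom C k)"
proof -
  have "Cod C f \<lhd> slide (Cod C g) (Cod C h) (Cod C k) \<cdot> (f \<otimes>\<^sub>a (g \<otimes>\<^sub>a (h \<otimes>\<^sub>a k)))
      = (f \<otimes>\<^sub>a (h \<otimes>\<^sub>a (g \<otimes>\<^sub>a k))) \<cdot> Dom C f \<lhd> slide (Dom C g) (Dom C h) (Dom C k)"
    using assms slide_natural[of g h k] by (simp add: lw_def compose_tensor)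
  note 1 = compose_reduce[OF this]
  have 2: "\<beta> (Cod C f) (Cod C h) (Cod C g \<otimes>\<^sub>o Cod C k) \<cdot> (f \<otimes>\<^sub>a (h \<otimes>\<^sub>a (g \<otimes>\<^sub>a k)))
    = ((f \<otimes>\<^sub>a h) \<otimes>\<^sub>a (g \<otimes>\<^sub>a k)) \<cdot> \<beta> (Dom C f) (Dom C h) (Dom C g \<otimes>\<^sub>o Dom C k)"
    using assoc_inv_nat_ar[of f h "g \<otimes>\<^sub>a k"] assms by simp
  have 3: "\<alpha> (Cod C f) (Cod C g) (Cod C h \<otimes>\<^sub>o Cod C k) \<cdot> ((f \<otimes>\<^sub>a g) \<otimes>\<^sub>a (h \<otimes>\<^sub>a k))
    = (f \<otimes>\<^sub>a (g \<otimes>\<^sub>a (h \<otimes>\<^sub>a k))) \<cdot> \<alpha> (Dom C f) (Dom C g) (Dom C h \<otimes>\<^sub>o Dom C k)"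
    using assoc_nat_ar[of f g "h \<otimes>\<^sub>a k"] assms by simp
  show ?thesis using assms
    by (simp add: mid_braiding_slide 3 1 compose_reduce[OF 2])
qed

text \<open>Sliding past \<open>\<I> \<otimes> \<I>\<close> is sliding twice past \<open>\<I>\<close>; by naturality along \<open>\<l> \<I>\<close> it is also sliding
  once, and one factor cancels.\<close>

lemma slide_unit_right:
  assumes [simp]: "A \<in> Ob C" "E \<in> Ob C"
  shows "\<l> (A \<otimes>\<^sub>o E) \<cdot> slide A \<I> E = A \<lhd> \<l> E"
proof -
  have "slide A \<I> E \<cdot> A \<lhd> (\<l> \<I> \<rhd> E) = \<l> \<I> \<rhd> (A \<otimes>\<^sub>o E) \<cdot> slide A (\<I> \<otimes>\<^sub>o \<I>) E"
    using slide_natural[of "\<^bold>1 A" "\<l> \<I>" "\<^bold>1 E"] by (simp add: lw_def rw_def)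
  hence "slide A \<I> E \<cdot> A \<lhd> (\<I> \<lhd> \<l> E) \<cdot> A \<lhd> \<alpha> \<I> \<I> E =
      (\<I> \<lhd> (\<l> (A \<otimes>\<^sub>o E) \<cdot> slide A \<I> E) \<cdot> slide A \<I> (\<I> \<otimes>\<^sub>o E)) \<cdot> A \<lhd> \<alpha> \<I> \<I> E"
    by (simp add: left_unitor_rw left_unitor_unit slide_tensor_right whisker_normal)
  also have "slide A \<I> E \<cdot> A \<lhd> (\<I> \<lhd> \<l> E) \<cdot> A \<lhd> \<alpha> \<I> \<I> E = (\<I> \<lhd> (A \<lhd> \<l> E) \<cdot> slide A \<I> (\<I> \<otimes>\<^sub>o E))
      \<cdot> A \<lhd> \<alpha> \<I> \<I> E"
    using compose_reduce[OF slide_natural_tail[of A \<I> "\<l> E" "\<I> \<otimes>\<^sub>o E" E], of "A \<lhd> \<alpha> \<I> \<I> E"] by simp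
  finally have "\<I> \<lhd> (A \<lhd> \<l> E) \<cdot> slide A \<I> (\<I> \<otimes>\<^sub>o E) = \<I> \<lhd> (\<l> (A \<otimes>\<^sub>o E) \<cdot> slide A \<I> E) \<cdot> slide A \<I>
      (\<I> \<otimes>\<^sub>o E)"
    by (rule cancel_right[rotated, where b = "A \<lhd> \<beta> \<I> \<I> E"]) simp_all
  hence "\<I> \<lhd> (A \<lhd> \<l> E) = \<I> \<lhd> (\<l> (A \<otimes>\<^sub>o E) \<cdot> slide A \<I> E)"
    by (rule cancel_right[rotated, where b = "slide_inv A \<I> (\<I> \<otimes>\<^sub>o E)"]) simp_all
  hence "A \<lhd> \<l> E = \<l> (A \<otimes>\<^sub>o E) \<cdot> slide A \<I> E"
    by (rule unit_whisker_faithful(1)[rotated 4]) simp_all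
  thus ?thesis ..
qed

text \<open>The mirror image of \<open>slide_unit_right\<close>: the double slide now comes from the
  other hexagon.\<close>

lemma slide_unit_left:
  assumes [simp]: "B \<in> Ob C" "E \<in> Ob C"
  shows "B \<lhd> \<l> E \<cdot> slide \<I> B E = \<l> (B \<otimes>\<^sub>o E)"
proof -
  have "slide \<I> B E \<cdot> \<l> \<I> \<rhd> (B \<otimes>\<^sub>o E) = B \<lhd> (\<l> \<I> \<rhd> E) \<cdot> slide (\<I> \<otimes>\<^sub>o \<I>) B E"
    using slide_natural[of "\<l> \<I>" "\<^bold>1 B" "\<^bold>1 E"] by (simp add: lw_def rw_def)
  hence "(slide \<I> B E \<cdot> \<I> \<lhd> \<l> (B \<otimes>\<^sub>o E)) \<cdot> \<alpha> \<I> \<I> (B \<otimes>\<^sub>o E) =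
     (B \<lhd> (\<I> \<lhd> \<l> E) \<cdot> slide \<I> B (\<I> \<otimes>\<^sub>o E) \<cdot> \<I> \<lhd> slide \<I> B E) \<cdot> \<alpha> \<I> \<I> (B \<otimes>\<^sub>o E)"
    by (simp add: left_unitor_rw left_unitor_unit slide_tensor_left whisker_normal)
  hence "slide \<I> B E \<cdot> \<I> \<lhd> \<l> (B \<otimes>\<^sub>o E) = B \<lhd> (\<I> \<lhd> \<l> E) \<cdot> slide \<I> B (\<I> \<otimes>\<^sub>o E) \<cdot> \<I> \<lhd> slide \<I> B E"
    by (rule cancel_right[rotated, where b = "\<beta> \<I> \<I> (B \<otimes>\<^sub>o E)"]) simp_all
  also have "\<dots> = slide \<I> B E \<cdot> \<I> \<lhd> (B \<lhd> \<l> E \<cdot> slide \<I> B E)"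
    using compose_reduce[OF slide_natural_tail[of \<I> B "\<l> E" "\<I> \<otimes>\<^sub>o E" E], of "\<I> \<lhd> slide \<I> B E"]
    by (simp add: whisker_compose)
  finally have "\<I> \<lhd> \<l> (B \<otimes>\<^sub>o E) = \<I> \<lhd> (B \<lhd> \<l> E \<cdot> slide \<I> B E)"
    by (rule cancel_left[rotated, where b = "slide_inv \<I> B E"]) simp_all
  hence "\<l> (B \<otimes>\<^sub>o E) = B \<lhd> \<l> E \<cdot> slide \<I> B E"
    by (rule unit_whisker_faithful(1)[rotated 4]) simp_all
  thus ?thesis ..
qed

text \<open>The first two equations are the unit axioms of the opmonoidal tensor functor, the last
  two say that the unitors are monoidal transformations. They become the counit laws of tensor
  coalgebras and the compatibility of the unitors with comultiplications.\<close>

lemma mid_braiding_units: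
  assumes [simp]: "A \<in> Ob C" "B \<in> Ob C"
  shows "\<l> (A \<otimes>\<^sub>o B) \<cdot> \<l> \<I> \<rhd> (A \<otimes>\<^sub>o B) \<cdot> mid_braiding C \<I> A \<I> B = \<l> A \<otimes>\<^sub>a \<l> B"
    "\<r> (A \<otimes>\<^sub>o B) \<cdot> (A \<otimes>\<^sub>o B) \<lhd> \<l> \<I> \<cdot> mid_braiding C A \<I> B \<I> = \<r> A \<otimes>\<^sub>a \<r> B"
    "(\<l> A \<otimes>\<^sub>a \<l> B) \<cdot> mid_braiding C \<I> \<I> A B = \<l> (A \<otimes>\<^sub>o B) \<cdot> \<l> \<I> \<rhd> (A \<otimes>\<^sub>o B)"
    "(\<r> A \<otimes>\<^sub>a \<r> B) \<cdot> mid_braiding C A B \<I> \<I> = \<r> (A \<otimes>\<^sub>o B) \<cdot> (A \<otimes>\<^sub>o B) \<lhd> \<l> \<I>"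
proof -
  \<comment> \<open>Naturality of \<open>\<l>\<close> at \<open>\<r> B\<close> exchanges the order
    in which a left and a right unit are removed; this brings the equations with \<open>\<r>\<close>
    into the range of the two slide lemmas.\<close>
  have n: "\<l> B \<cdot> \<I> \<lhd> \<r> B = \<r> B \<cdot> \<l> (B \<otimes>\<^sub>o \<I>)" if "B \<in> Ob C" for B
    using unitor_natural(1)[of "\<r> B"] that by simp
  note lr = lw_compose_reduce
  show "\<l> (A \<otimes>\<^sub>o B) \<cdot> \<l> \<I> \<rhd> (A \<otimes>\<^sub>o B) \<cdot> mid_braiding C \<I> A \<I> B = \<l> A \<otimes>\<^sub>a \<l> B"
    by (simp add: mid_braiding_slide tensor_split left_unitor_rw left_unitor_unit whisker_normal
        lr(2)[OF _ _ _ _ slide_unit_right])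
  show "(\<l> A \<otimes>\<^sub>a \<l> B) \<cdot> mid_braiding C \<I> \<I> A B = \<l> (A \<otimes>\<^sub>o B) \<cdot> \<l> \<I> \<rhd> (A \<otimes>\<^sub>o B)"
    by (simp add: mid_braiding_slide tensor_split left_unitor_rw left_unitor_unit whisker_normal
        lr(2)[OF _ _ _ _ slide_unit_left])
  show "\<r> (A \<otimes>\<^sub>o B) \<cdot> (A \<otimes>\<^sub>o B) \<lhd> \<l> \<I> \<cdot> mid_braiding C A \<I> B \<I> = \<r> A \<otimes>\<^sub>a \<r> B"
  proof -
    have "\<r> A \<otimes>\<^sub>a \<r> B = A \<lhd> (\<l> B \<cdot> \<I> \<lhd> \<r> B) \<cdot> \<alpha> A \<I> (B \<otimes>\<^sub>o \<I>)"
      by (simp add: tensor_split triangle_rw whisker_normal)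
    also have "\<dots> = \<r> (A \<otimes>\<^sub>o B) \<cdot> (A \<otimes>\<^sub>o B) \<lhd> \<l> \<I> \<cdot> mid_braiding C A \<I> B \<I>"
      by (subst n) (simp_all add: mid_braiding_slide right_unitor_lw whisker_normal lr(2)[OF _ _ _
          _ slide_unit_left])
    finally show ?thesis ..
  qed
  show "(\<r> A \<otimes>\<^sub>a \<r> B) \<cdot> mid_braiding C A B \<I> \<I> = \<r> (A \<otimes>\<^sub>o B) \<cdot> (A \<otimes>\<^sub>o B) \<lhd> \<l> \<I>"
  proof -
    have "\<r> A \<otimes>\<^sub>a \<r> B = A \<lhd> (\<l> B \<cdot> \<I> \<lhd> \<r> B) \<cdot> \<alpha> A \<I> (B \<otimes>\<^sub>o \<I>)"
      by (simp add: tensor_split triangle_rw whisker_normal)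
    also have "\<dots> = A \<lhd> \<r> B \<cdot> A \<lhd> \<l> (B \<otimes>\<^sub>o \<I>) \<cdot> \<alpha> A \<I> (B \<otimes>\<^sub>o \<I>)"
      by (subst n) (simp_all add: whisker_compose)
    finally show ?thesis
      by (simp add: mid_braiding_slide right_unitor_lw whisker_normal lr(2)[OF _ _ _ _
          slide_unit_right])
  qed
qed

end

section \<open>Kernels, equalizers and direct sums\<close>

lemma ex1_eqD: "\<exists>!x. x \<in> A \<and> P x \<Longrightarrow> a \<in> A \<Longrightarrow> b \<in> A \<Longrightarrow> P a \<Longrightarrow> P b \<Longrightarrow> a = b"
  by blast

section \<open>Differences and finite sums of arrows\<close>

context preadditive_category
begin

lemma hom_group_simps [simp]:
  "carrier (hom_group C A B) = Hom C A B" "mult (hom_group C A B) = add_ar C"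
  "one (hom_group C A B) = zero_ar C A B"
  by (simp_all add: hom_group_def)

lemma zero_ar_simps [simp]:
  assumes "A \<in> Ob C" "B \<in> Ob C"
  shows "zero_ar C A B \<in> Ar C" "Dom C (zero_ar C A B) = A" "Cod C (zero_ar C A B) = B"
proof -
  interpret G: comm_group "hom_group C A B" by (rule hom_comm_group[OF assms])
  show "zero_ar C A B \<in> Ar C" "Dom C (zero_ar C A B) = A" "Cod C (zero_ar C A B) = B"
    using G.one_closed by (simp_all add: hom_group_def)
qed

lemma add_ar_simps [simp]:
  assumes "f \<in> Ar C" "g \<in> Ar C" "Dom C f = Dom C g" "Cod C f = Cod C g"
  shows "f \<boxplus> g \<in> Ar C" "Dom C (f \<boxplus> g) = Dom C f" "Cod C (f \<boxplus> g) = Cod C f"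
proof -
  interpret G: comm_group "hom_group C (Dom C f) (Cod C f)" using assms by
      (intro hom_comm_group) simp_all
  show "f \<boxplus> g \<in> Ar C" "Dom C (f \<boxplus> g) = Dom C f" "Cod C (f \<boxplus> g) = Cod C f"
    using G.m_closed[of f g] assms by (simp_all add: hom_group_def)
qed

lemma add_zero [simp]:
  assumes "f \<in> Ar C" "Dom C f = A" "Cod C f = B"
  shows "f \<boxplus> zero_ar C A B = f" "zero_ar C A B \<boxplus> f = f"
proof -
  interpret G: comm_group "hom_group C A B" using assms Dom_Ob[of f] Cod_Ob[of f] by
      (intro hom_comm_group) simp_all
  show "f \<boxplus> zero_ar C A B = f" "zero_ar C A B \<boxplus> f = f"
    using G.r_one[of f] G.l_one[of f] assms by (simp_all add: hom_group_def)
qed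

lemma add_right_cancel:
  assumes "f \<boxplus> h = g \<boxplus> h" "f \<in> Ar C" "g \<in> Ar C" "h \<in> Ar C"
    "Dom C f = Dom C h" "Cod C f = Cod C h" "Dom C g = Dom C h" "Cod C g = Cod C h"
  shows "f = g"
proof -
  interpret G: comm_group "hom_group C (Dom C h) (Cod C h)" using assms by
      (intro hom_comm_group) simp_all
  show ?thesis using G.right_cancel[of h f g] assms by (simp add: hom_group_def)
qed

lemma add_assoc:
  assumes "f \<in> Hom C A B" "g \<in> Hom C A B" "h \<in> Hom C A B"
  shows "(f \<boxplus> g) \<boxplus> h = f \<boxplus> (g \<boxplus> h)"
proof -
  interpret G: comm_group "hom_group C A B"
    using assms(1) Dom_Ob[of f] Cod_Ob[of f] by (intro hom_comm_group) simp_all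
  show ?thesis using G.m_assoc[of f g h] assms by simp
qed

definition neg :: "'a \<Rightarrow> 'a" where
  "neg f = m_inv (hom_group C (Dom C f) (Cod C f)) f"

lemma neg_simps [simp]:
  assumes "f \<in> Ar C"
  shows "neg f \<in> Ar C" "Dom C (neg f) = Dom C f" "Cod C (neg f) = Cod C f"
    "f \<boxplus> neg f = zero_ar C (Dom C f) (Cod C f)"
proof -
  interpret G: comm_group "hom_group C (Dom C f) (Cod C f)" using assms by
      (intro hom_comm_group) simp_all
  show "neg f \<in> Ar C" "Dom C (neg f) = Dom C f" "Cod C (neg f) = Cod C f"
    "f \<boxplus> neg f = zero_ar C (Dom C f) (Cod C f)"
    using G.inv_closed[of f] G.r_inv[of f] assms by (simp_all add: hom_group_def neg_def)
qed

lemma compose_add: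
  assumes "f \<in> Ar C" "f' \<in> Ar C" "g \<in> Ar C" "Dom C f = Dom C f'" "Cod C f = Cod C f'"
  shows "Cod C f' = Dom C g \<Longrightarrow> g \<cdot> (f \<boxplus> f') = (g \<cdot> f) \<boxplus> (g \<cdot> f')"
    "Cod C g = Dom C f' \<Longrightarrow> (f \<boxplus> f') \<cdot> g = (f \<cdot> g) \<boxplus> (f' \<cdot> g)"
  using compose_add_right[of f "Dom C f" "Cod C f" f' g "Cod C g"]
    compose_add_left[of g "Dom C g" "Cod C g" f "Cod C f" f'] assms by simp_all

lemma compose_zero [simp]:
  assumes "g \<in> Ar C" "X \<in> Ob C"
  shows "Dom C g = B \<Longrightarrow> g \<cdot> zero_ar C X B = zero_ar C X (Cod C g)"
    "Cod C g = B \<Longrightarrow> zero_ar C B X \<cdot> g = zero_ar C (Dom C g) X"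
proof -
  let ?z = "zero_ar C X (Dom C g)"
  have "(g \<cdot> ?z) \<boxplus> (g \<cdot> ?z) = g \<cdot> (?z \<boxplus> ?z)" using assms by (subst compose_add) simp_all
  also have "\<dots> = zero_ar C X (Cod C g) \<boxplus> (g \<cdot> ?z)" using assms by simp
  finally have "g \<cdot> ?z = zero_ar C X (Cod C g)"
    by (rule add_right_cancel) (use assms in simp_all)
  thus "Dom C g = B \<Longrightarrow> g \<cdot> zero_ar C X B = zero_ar C X (Cod C g)" by simp
next
  let ?z = "zero_ar C (Cod C g) X"
  have "(?z \<cdot> g) \<boxplus> (?z \<cdot> g) = (?z \<boxplus> ?z) \<cdot> g" using assms by (subst compose_add) simp_all
  also have "\<dots> = zero_ar C (Dom C g) X \<boxplus> (?z \<cdot> g)" using assms by simp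
  finally have "?z \<cdot> g = zero_ar C (Dom C g) X"
    by (rule add_right_cancel) (use assms in simp_all)
  thus "Cod C g = B \<Longrightarrow> zero_ar C B X \<cdot> g = zero_ar C (Dom C g) X" by simp
qed

lemma eq_iff_diff_zero:
  assumes "f \<in> Ar C" "g \<in> Ar C" "Dom C f = Dom C g" "Cod C f = Cod C g"
  shows "f = g \<longleftrightarrow> f \<boxplus> neg g = zero_ar C (Dom C g) (Cod C g)"
proof
  assume "f \<boxplus> neg g = zero_ar C (Dom C g) (Cod C g)"
  hence "f \<boxplus> neg g = g \<boxplus> neg g" using assms by simp
  thus "f = g" by (rule add_right_cancel) (use assms in simp_all)
qed (use assms in simp)

lemma diff_compose_eq_zero:
  assumes "f \<in> Ar C" "g \<in> Ar C" "Dom C f = Dom C g" "Cod C f = Cod C g" "x \<in> Ar C" "Cod C x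
      = Dom C g"
  shows "(f \<boxplus> neg g) \<cdot> x = zero_ar C (Dom C x) (Cod C g) \<longleftrightarrow> f \<cdot> x = g \<cdot> x"
proof -
  have "(f \<boxplus> neg g) \<cdot> x = (f \<cdot> x) \<boxplus> (neg g \<cdot> x)"
    using assms by (simp add: compose_add)
  moreover have "neg g \<cdot> x = neg (g \<cdot> x)"
  proof (rule add_right_cancel)
    interpret G: comm_group "hom_group C (Dom C x) (Cod C g)" using assms by
        (intro hom_comm_group) simp_all
    have c: "h \<boxplus> k = k \<boxplus> h" if "h \<in> Hom C (Dom C x) (Cod C g)" "k \<in> Hom C (Dom C x) (Cod C g)"
        for h k
      using G.m_comm[of h k] that by (simp add: hom_group_def)
    have "neg g \<cdot> x \<boxplus> g \<cdot> x = g \<cdot> x \<boxplus> neg g \<cdot> x" using assms by (intro c) simp_all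
    also have "\<dots> = (g \<boxplus> neg g) \<cdot> x" using assms by (subst compose_add) simp_all
    also have "\<dots> = g \<cdot> x \<boxplus> neg (g \<cdot> x)" using assms by simp
    also have "\<dots> = neg (g \<cdot> x) \<boxplus> g \<cdot> x" using assms by (intro c) simp_all
    finally show "neg g \<cdot> x \<boxplus> g \<cdot> x = neg (g \<cdot> x) \<boxplus> g \<cdot> x" .
  qed (use assms in simp_all)
  ultimately show ?thesis using eq_iff_diff_zero[of "f \<cdot> x" "g \<cdot> x"] assms by simp
qed

text \<open>Exactness speaks of kernels, cotensor products are equalizers; the difference of the two
  arrows passes between them.\<close>

lemma equalizer_iff_kernel:
  assumes "f \<in> Ar C" "g \<in> Ar C" "Dom C f = Dom C g" "Cod C f = Cod C g"
  shows "is_equalizer C f g e \<longleftrightarrow> is_kernel C (f \<boxplus> neg g) e"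
proof -
  have 1: "(f \<boxplus> neg g) \<cdot> x = zero_ar C X (Cod C g) \<longleftrightarrow> f \<cdot> x = g \<cdot> x" if "x \<in> Hom C X (Dom C g)"
      for x X
    using diff_compose_eq_zero[OF assms, of x] that by simp
  have 2: "(f \<boxplus> neg g) \<cdot> e = zero_ar C (Dom C e) (Cod C g) \<longleftrightarrow> f \<cdot> e = g \<cdot> e" if "e \<in> Ar C" "Cod C e
      = Dom C g"
    using 1[of e] that by simp
  have 3: "g \<in> Hom C (Dom C g) (Cod C g)" using assms by simp
  show ?thesis
    unfolding is_equalizer_def is_kernel_def
    using assms 3 by (simp add: 1 2 cong: ball_cong conj_cong del: in_Hom)
qed

text \<open>Membership in the hom-set is carried along with \<open>P\<close>, because
  \<open>P\<close> is only assumed stable under sums of arrows of that type. With a trivial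
  \<open>P\<close> the lemma types a finite sum.\<close>

lemma finprod_Hom_induct:
  assumes "A \<in> Ob C" "B \<in> Ob C" "finite S"
    and "\<And>x. x \<in> S \<Longrightarrow> f x \<in> Hom C A B \<and> P (f x)"
    and "P (zero_ar C A B)"
    and "\<And>g h. g \<in> Hom C A B \<Longrightarrow> h \<in> Hom C A B \<Longrightarrow> P g \<Longrightarrow> P h \<Longrightarrow> P (g \<boxplus> h)"
  shows "finprod (hom_group C A B) f S \<in> Hom C A B \<and> P (finprod (hom_group C A B) f S)"
proof -
  interpret G: comm_group "hom_group C A B" by (rule hom_comm_group) fact+
  have "finprod (hom_group C A B) f T \<in> Hom C A B \<and> P (finprod (hom_group C A B) f T)" if "T \<subseteq> S"
      for T
    using finite_subset[OF that assms(3)] that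
  proof (induction T rule: finite_induct)
    case empty
    show ?case using assms by simp
  next
    case (insert x T)
    have "f \<in> T \<rightarrow> carrier (hom_group C A B)" "f x \<in> carrier (hom_group C A B)"
      using insert.prems assms(4) by (fastforce simp: Pi_iff)+
    hence "finprod (hom_group C A B) f (insert x T) = f x \<boxplus> finprod (hom_group C A B) f T"
      using insert.hyps by (subst G.finprod_insert) simp_all
    thus ?case using insert assms(4)[of x] assms(6)[of "f x" "finprod (hom_group C A B) f T"]
        by simp
  qed
  thus ?thesis by blast
qed

lemma compose_finprod:
  assumes "A \<in> Ob C" "finite S" "\<And>x. x \<in> S \<Longrightarrow> f x \<in> Hom C A B" "g \<in> Hom C B D"
  shows "g \<cdot> finprod (hom_group C A B) f S = finprod (hom_group C A D) (\<lambda>x. g \<cdot> f x) S"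
proof -
  have ob [simp]: "A \<in> Ob C" "B \<in> Ob C" "D \<in> Ob C" using assms Dom_Ob[of g] Cod_Ob[of g] by simp_all
  interpret G: comm_group "hom_group C A B" by (rule hom_comm_group) fact+
  interpret K: comm_group "hom_group C A D" by (rule hom_comm_group) fact+
  have "g \<cdot> finprod (hom_group C A B) f T = finprod (hom_group C A D) (\<lambda>x. g \<cdot> f x) T" if "T \<subseteq> S"
      for T
    using finite_subset[OF that assms(2)] that
  proof (induction T rule: finite_induct)
    case empty
    show ?case using assms(4) by simp
  next
    case (insert x T)
    have fT: "f \<in> T \<rightarrow> carrier (hom_group C A B)" "f x \<in> carrier (hom_group C A B)"
      using insert.prems assms(3) by (fastforce simp: Pi_iff)+
    have gT: "(\<lambda>x. g \<cdot> f x) \<in> T \<rightarrow> carrier (hom_group C A D)" "g \<cdot> f x \<in> carrier (hom_group C A D)"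
      using insert.prems assms(3,4) by (fastforce simp: Pi_iff)+
    have "finprod (hom_group C A B) f (insert x T) = f x \<boxplus> finprod (hom_group C A B) f T"
      using insert.hyps fT by (subst G.finprod_insert) simp_all
    moreover have "finprod (hom_group C A D) (\<lambda>x. g \<cdot> f x) (insert x T) = (g \<cdot> f x) \<boxplus> finprod
        (hom_group C A D) (\<lambda>x. g \<cdot> f x) T"
      using insert.hyps gT by (subst K.finprod_insert) simp_all
    moreover have "finprod (hom_group C A B) f T \<in> Hom C A B"
      using G.finprod_closed[OF fT(1)] by simp
    ultimately show ?case using insert assms(3)[of x] assms(4) by (simp add: compose_add)
  qed
  thus ?thesis by blast
qed

lemma finprod_single:
  assumes "A \<in> Ob C" "B \<in> Ob C" "finite S" "a \<in> S" "f a \<in> Hom C A B"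
    and "\<And>x. x \<in> S \<Longrightarrow> x \<noteq> a \<Longrightarrow> f x = zero_ar C A B"
  shows "finprod (hom_group C A B) f S = f a"
proof -
  interpret G: comm_group "hom_group C A B" by (rule hom_comm_group) fact+
  have fS: "f x \<in> Hom C A B" if "x \<in> S" for x using assms that by (cases "x = a") simp_all
  have "finprod (hom_group C A B) f S = finprod (hom_group C A B) (\<lambda>x. if a = x then f x else one
      (hom_group C A B)) S"
    using assms(1,2,6) fS by (intro G.finprod_cong') auto
  also have "\<dots> = f a"
    using assms(3,4) fS by (subst G.finprod_singleton) (auto simp del: in_Hom)
  finally show ?thesis .
qed

end

section \<open>Universal properties of equalizers and direct sums\<close>

context category
begin

lemma equalizer_univ:
  assumes "is_equalizer C f g e" "x \<in> Hom C X (Dom C f)" "f \<cdot> x = g \<cdot> x"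
  shows "\<exists>!h. h \<in> Hom C X (Dom C e) \<and> e \<cdot> h = x"
proof -
  have "\<forall>X. \<forall>x \<in> Hom C X (Dom C f). f \<cdot> x = g \<cdot> x \<longrightarrow> (\<exists>!h. h \<in> Hom C X (Dom C e) \<and> e \<cdot> h = x)"
    using assms(1) unfolding is_equalizer_def by (elim conjE)
  from this[rule_format, OF assms(2,3)] show ?thesis .
qed

lemma equalizer_monic:
  assumes "is_equalizer C f g e" "e \<cdot> h = e \<cdot> k" "h \<in> Ar C" "k \<in> Ar C" "Cod C h = Dom C e"
      "Cod C k = Dom C e"
    "Dom C h = Dom C k"
  shows "h = k"
proof -
  have e: "e \<in> Ar C" "Cod C e = Dom C f" "f \<in> Ar C" "f \<cdot> e = g \<cdot> e" "g \<in> Ar C" "Dom C g = Dom C f"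
    using assms(1) by (simp_all add: is_equalizer_def)
  have "f \<cdot> (e \<cdot> h) = g \<cdot> (e \<cdot> h)"
    using e(1-3,5,6) assms(3-) compose_reduce[OF e(4), of h] by simp
  moreover have "e \<cdot> h \<in> Hom C (Dom C h) (Dom C f)" using e(1-3,5,6) assms(3-) by simp
  ultimately have "\<exists>!k. k \<in> Hom C (Dom C h) (Dom C e) \<and> e \<cdot> k = e \<cdot> h"
    by (intro equalizer_univ[OF assms(1)])
  moreover have "h \<in> Hom C (Dom C h) (Dom C e)" "k \<in> Hom C (Dom C h) (Dom C e)" using assms(3-)
      by simp_all
  ultimately show ?thesis by (rule ex1_eqD[where P = "\<lambda>x. e \<cdot> x = e
      \<cdot> h", OF _ _ _ refl assms(2)[symmetric]])
qed

lemma coproduct_univ: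
  assumes "is_coproduct C I X S \<iota>" "Y \<in> Ob C" "\<And>j. j \<in> I \<Longrightarrow> f j \<in> Hom C (X j) Y"
  shows "\<exists>!h. h \<in> Hom C S Y \<and> (\<forall>j\<in>I. h \<cdot> \<iota> j = f j)"
  using assms unfolding is_coproduct_def by blast

lemma coproduct_ext:
  assumes "is_coproduct C I X S \<iota>" "f \<in> Ar C" "g \<in> Ar C" "Dom C f = S" "Dom C g = S" "Cod C f
      = Cod C g"
    "\<And>j. j \<in> I \<Longrightarrow> f \<cdot> \<iota> j = g \<cdot> \<iota> j"
  shows "f = g"
proof -
  have "\<exists>!h. h \<in> Hom C S (Cod C f) \<and> (\<forall>j\<in>I. h \<cdot> \<iota> j = f \<cdot> \<iota> j)"
    using assms by (intro coproduct_univ) (simp_all add: is_coproduct_def)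
  moreover have "f \<in> Hom C S (Cod C f)" "g \<in> Hom C S (Cod C f)" using assms(2-6) by simp_all
  moreover have "\<forall>j\<in>I. f \<cdot> \<iota> j = f \<cdot> \<iota> j" "\<forall>j\<in>I. g \<cdot> \<iota> j = f \<cdot> \<iota> j"
    using assms(7)[symmetric] by blast+
  ultimately show ?thesis by (rule ex1_eqD)
qed

lemma coproduct_desc:
  assumes "is_coproduct C I X S \<iota>" "Y \<in> Ob C" "\<And>j. j \<in> I \<Longrightarrow> f j \<in> Hom C (X j) Y"
  shows "\<exists>h \<in> Hom C S Y. \<forall>j\<in>I. h \<cdot> \<iota> j = f j"
  using ex1_implies_ex[OF coproduct_univ[OF assms]] by (simp only: Bex_def)

lemma coproduct_simps:
  assumes "is_coproduct C I X S \<iota>"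
  shows "S \<in> Ob C" "j \<in> I \<Longrightarrow> X j \<in> Ob C" "j \<in> I \<Longrightarrow> \<iota> j \<in> Ar C"
    "j \<in> I \<Longrightarrow> Dom C (\<iota> j) = X j" "j \<in> I \<Longrightarrow> Cod C (\<iota> j) = S"
  using assms by (simp_all add: is_coproduct_def)

lemma coproductI:
  assumes "S \<in> Ob C" "\<And>j. j \<in> I \<Longrightarrow> X j \<in> Ob C" "\<And>j. j \<in> I \<Longrightarrow> \<iota> j \<in> Hom C (X j) S"
    and "\<And>Y f. Y \<in> Ob C \<Longrightarrow> (\<And>j. j \<in> I \<Longrightarrow> f j \<in> Hom C (X j) Y) \<Longrightarrow> \<exists>h \<in> Hom C S Y. \<forall>j\<in>I. h \<cdot> \<iota> j = f j"
    and "\<And>f g. f \<in> Ar C \<Longrightarrow> g \<in> Ar C \<Longrightarrow> Dom C f = S \<Longrightarrow> Dom C g = S \<Longrightarrow> Cod C f = Cod C g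
      \<Longrightarrow> (\<And>j. j \<in> I \<Longrightarrow> f \<cdot> \<iota> j = g \<cdot> \<iota> j) \<Longrightarrow> f = g"
  shows "is_coproduct C I X S \<iota>"
  unfolding is_coproduct_def
proof (intro conjI ballI allI impI)
  fix Y f assume Y: "Y \<in> Ob C" "\<forall>j\<in>I. f j \<in> Hom C (X j) Y"
  then obtain h where h: "h \<in> Hom C S Y" "\<forall>j\<in>I. h \<cdot> \<iota> j = f j" using assms(4) by metis
  show "\<exists>!h. h \<in> Hom C S Y \<and> (\<forall>j\<in>I. h \<cdot> \<iota> j = f j)"
  proof (rule ex1I)
    fix k assume "k \<in> Hom C S Y \<and> (\<forall>j\<in>I. k \<cdot> \<iota> j = f j)"
    with h show "k = h" by - (rule assms(5), simp_all)
  qed (use h in blast)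
qed (use assms(1-3) in simp_all)

text \<open>Direct sums occur over pairs and triples of numbers, while smallness refers to subsets
  of one type; index sets are therefore exchanged along bijections.\<close>

lemma coproduct_reindex:
  assumes "bij_betw f I I'"
  shows "is_coproduct C I' X S \<iota> \<longleftrightarrow> is_coproduct C I (\<lambda>j. X (f j)) S (\<lambda>j. \<iota> (f j))"
proof
  assume *: "is_coproduct C I' X S \<iota>"
  have fI: "f j \<in> I'" if "j \<in> I" for j using assms that by (auto simp: bij_betw_def)
  show "is_coproduct C I (\<lambda>j. X (f j)) S (\<lambda>j. \<iota> (f j))"
  proof (rule coproductI)
    fix Y g assume Y: "Y \<in> Ob C" "\<And>j. j \<in> I \<Longrightarrow> g j \<in> Hom C (X (f j)) Y"
    have "\<exists>h\<in>Hom C S Y. \<forall>j\<in>I'. h \<cdot> \<iota> j = g (inv_into I f j)"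
    proof (rule coproduct_desc[OF *])
      fix j assume j: "j \<in> I'"
      have "inv_into I f j \<in> I" "f (inv_into I f j) = j"
        using assms j by (auto simp: bij_betw_def inv_into_into f_inv_into_f)
      thus "g (inv_into I f j) \<in> Hom C (X j) Y" using Y(2)[of "inv_into I f j"] by simp
    qed fact
    then obtain h where h: "h\<in>Hom C S Y" "\<forall>j\<in>I'. h \<cdot> \<iota> j = g (inv_into I f j)" by blast
    show "\<exists>h\<in>Hom C S Y. \<forall>j\<in>I. h \<cdot> \<iota> (f j) = g j"
      using h assms fI by (intro bexI[of _ h]) (auto simp: bij_betw_def)
  next
    fix g h
    assume "g \<in> Ar C" "h \<in> Ar C" "Dom C g = S" "Dom C h = S" "Cod C g = Cod C h"
      "\<And>j. j \<in> I \<Longrightarrow> g \<cdot> \<iota> (f j) = h \<cdot> \<iota> (f j)"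
    thus "g = h" using fI assms by - (rule coproduct_ext[OF *], auto simp: bij_betw_def)
  qed (use fI coproduct_simps[OF *] in simp_all)
next
  assume *: "is_coproduct C I (\<lambda>j. X (f j)) S (\<lambda>j. \<iota> (f j))"
  have fI: "\<exists>i\<in>I. j = f i" if "j \<in> I'" for j using assms that by (auto simp: bij_betw_def)
  show "is_coproduct C I' X S \<iota>"
  proof (rule coproductI)
    fix Y g assume Y: "Y \<in> Ob C" "\<And>j. j \<in> I' \<Longrightarrow> g j \<in> Hom C (X j) Y"
    have "\<exists>h\<in>Hom C S Y. \<forall>j\<in>I. h \<cdot> \<iota> (f j) = g (f j)"
      using assms Y by (intro coproduct_desc[OF *]) (auto simp: bij_betw_def simp del: in_Hom)
    thus "\<exists>h\<in>Hom C S Y. \<forall>j\<in>I'. h \<cdot> \<iota> j = g j" using fI by metis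
  next
    fix g h
    assume "g \<in> Ar C" "h \<in> Ar C" "Dom C g = S" "Dom C h = S" "Cod C g = Cod C h"
      "\<And>j. j \<in> I' \<Longrightarrow> g \<cdot> \<iota> j = h \<cdot> \<iota> j"
    thus "g = h" using assms by - (rule coproduct_ext[OF *], auto simp: bij_betw_def)
  next
    show "X j \<in> Ob C" "\<iota> j \<in> Hom C (X j) S" if "j \<in> I'" for j
      using fI[OF that] coproduct_simps[OF *] by auto
  qed (use coproduct_simps[OF *] in simp_all)
qed

text \<open>A direct sum is the colimit of a discrete diagram. The discrete category
  \<open>J\<close> lives on the image of \<open>enc\<close>, each element being an object and its
  own identity.\<close>

lemma coproduct_exists:
  fixes enc :: "'j \<Rightarrow> 'i"
  assumes "cocomplete TYPE('i) C" "inj_on enc I" "\<And>j. j \<in> I \<Longrightarrow> X j \<in> Ob C"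
  shows "\<exists>S \<iota>. is_coproduct C I X S \<iota>"
proof -
  define J :: "('i, 'i) category" where
    "J = \<lparr>Ob = enc ` I, Ar = enc ` I, Dom = id, Cod = id, ident = id, compose = (\<lambda>f g. f)\<rparr>"
  have HomJ: "u \<in> Hom J i j \<longleftrightarrow> u \<in> enc ` I \<and> i = u \<and> j = u" for u i j
    by (auto simp: J_def Hom_def)
  have Jsimp: "Ob J = enc ` I" "ident J j = j" "compose J u v = u" for j u v
    by (simp_all add: J_def)
  have "category J"
    by unfold_locales (auto simp: J_def Hom_def)
  let ?d = "inv_into I enc"
  have d: "?d (enc j) = j" if "j \<in> I" for j using assms(2) that by simp
  have "is_functor J C (\<lambda>i. X (?d i)) (\<lambda>i. \<^bold>1 (X (?d i)))"
    unfolding is_functor_def using assms(3) d by (auto simp: HomJ Jsimp)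
  with \<open>category J\<close> assms(1) obtain S \<iota> where
    S: "is_colimit J C (\<lambda>i. X (?d i)) (\<lambda>i. \<^bold>1 (X (?d i))) S \<iota>"
    unfolding cocomplete_def by metis
  have S': "S \<in> Ob C" "\<And>j. j \<in> I \<Longrightarrow> \<iota> (enc j) \<in> Hom C (X j) S"
    using S d unfolding is_colimit_def is_cocone_def by (fastforce simp: Jsimp)+
  have "is_coproduct C I X S (\<lambda>j. \<iota> (enc j))"
    unfolding is_coproduct_def
  proof (intro conjI ballI allI impI)
    fix Y f assume Y: "Y \<in> Ob C" "\<forall>j\<in>I. f j \<in> Hom C (X j) Y"
    have "is_cocone J C (\<lambda>i. X (?d i)) (\<lambda>i. \<^bold>1 (X (?d i))) Y (\<lambda>i. f (?d i))"
      unfolding is_cocone_def using Y d by (auto simp: HomJ Jsimp)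
    hence "\<exists>!h. h \<in> Hom C S Y \<and> (\<forall>j \<in> Ob J. h \<cdot> \<iota> j = f (?d j))"
      using S unfolding is_colimit_def by metis
    thus "\<exists>!h. h \<in> Hom C S Y \<and> (\<forall>j \<in> I. h \<cdot> \<iota> (enc j) = f j)"
      by (simp add: Jsimp d)
  qed (use S' assms(3) in auto)
  thus ?thesis by blast
qed

end

section \<open>Kernels and exactness\<close>

context abelian_category
begin

lemma kernel_univ:
  assumes "is_kernel C f k" "x \<in> Hom C X (Dom C f)" "f \<cdot> x = zero_ar C X (Cod C f)"
  shows "\<exists>!h. h \<in> Hom C X (Dom C k) \<and> k \<cdot> h = x"
proof -
  have "\<forall>X. \<forall>x \<in> Hom C X (Dom C f). f \<cdot> x = zero_ar C X (Cod C f) \<longrightarrow> (\<exists>!h. h \<in> Hom C X (Dom C k)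
      \<and> k \<cdot> h = x)"
    using assms(1) unfolding is_kernel_def by (elim conjE)
  from this[rule_format, OF assms(2,3)] show ?thesis .
qed

lemma cokernel_univ:
  assumes "is_cokernel C f q" "x \<in> Hom C (Cod C f) X" "x \<cdot> f = zero_ar C (Dom C f) X"
  shows "\<exists>!h. h \<in> Hom C (Cod C q) X \<and> h \<cdot> q = x"
proof -
  have "\<forall>X. \<forall>x \<in> Hom C (Cod C f) X. x \<cdot> f = zero_ar C (Dom C f) X \<longrightarrow> (\<exists>!h. h \<in> Hom C (Cod C q) X
      \<and> h \<cdot> q = x)"
    using assms(1) unfolding is_cokernel_def by (elim conjE)
  from this[rule_format, OF assms(2,3)] show ?thesis .
qed

lemma kernel_lift:
  assumes "is_kernel C f k" "x \<in> Ar C" "Cod C x = Dom C f" "f \<cdot> x = zero_ar C (Dom C x) (Cod C f)"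
  shows "\<exists>h \<in> Hom C (Dom C x) (Dom C k). k \<cdot> h = x"
proof -
  have "x \<in> Hom C (Dom C x) (Dom C f)" using assms(2,3) by simp
  from ex1_implies_ex[OF kernel_univ[OF assms(1) this assms(4)]] show ?thesis by
      (simp only: Bex_def)
qed

lemma kernel_simps:
  assumes "is_kernel C f k"
  shows "f \<in> Ar C" "k \<in> Ar C" "Cod C k = Dom C f" "f \<cdot> k = zero_ar C (Dom C k) (Cod C f)"
  using assms by (simp_all add: is_kernel_def)

lemma kernel_monic: "is_kernel C f k \<Longrightarrow> monic C k"
  unfolding monic_def
proof (intro conjI allI ballI impI)
  assume k: "is_kernel C f k"
  note k' = kernel_simps[OF k]
  show "k \<in> Ar C" by fact
  fix X g h assume *: "g \<in> Hom C X (Dom C k)" "h \<in> Hom C X (Dom C k)" "k \<cdot> g = k \<cdot> h"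
  have "f \<cdot> (k \<cdot> g) = zero_ar C X (Cod C f)"
    using k' * compose_reduce[of f k "zero_ar C (Dom C k) (Cod C f)" g] by simp
  moreover have "k \<cdot> g \<in> Hom C X (Dom C f)" using k' * by simp
  ultimately have "\<exists>!h. h \<in> Hom C X (Dom C k) \<and> k \<cdot> h = k \<cdot> g"
    by (intro kernel_univ[OF k])
  thus "g = h" using *(1,2) by (rule ex1_eqD[where P = "\<lambda>x. k \<cdot> x = k
      \<cdot> g", OF _ _ _ refl *(3)[symmetric]])
qed

lemma kernelI:
  assumes "f \<in> Ar C" "monic C k" "Cod C k = Dom C f" "f \<cdot> k = zero_ar C (Dom C k) (Cod C f)"
    and "\<And>x. x \<in> Ar C \<Longrightarrow> Cod C x = Dom C f \<Longrightarrow> f \<cdot> x = zero_ar C (Dom C x) (Cod C f)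
       \<Longrightarrow> \<exists>h \<in> Hom C (Dom C x) (Dom C k). k \<cdot> h = x"
  shows "is_kernel C f k"
  unfolding is_kernel_def
proof (intro conjI allI ballI impI)
  fix X x assume "x \<in> Hom C X (Dom C f)" "f \<cdot> x = zero_ar C X (Cod C f)"
  then obtain h where h: "h \<in> Hom C X (Dom C k)" "k \<cdot> h = x" using assms(5)[of x] by auto
  show "\<exists>!h. h \<in> Hom C X (Dom C k) \<and> k \<cdot> h = x"
    using h assms(2) unfolding monic_def by blast
qed (use assms in \<open>simp_all add: monic_def\<close>)

text \<open>Since \<open>g\<close> kills \<open>k\<close>, it factors as \<open>w \<cdot> q\<close>;
  whatever \<open>q\<close> kills is then killed by \<open>g\<close> and lifts along
  \<open>k\<close>.\<close>

lemma kernel_of_cokernel: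
  assumes "is_kernel C g k" "is_cokernel C k q"
  shows "is_kernel C q k"
proof (rule kernelI)
  note k = kernel_simps[OF assms(1)]
  have q: "q \<in> Ar C" "Dom C q = Cod C k" "q \<cdot> k = zero_ar C (Dom C k) (Cod C q)"
    using assms(2) by (simp_all add: is_cokernel_def)
  show "q \<in> Ar C" "Cod C k = Dom C q" "q \<cdot> k = zero_ar C (Dom C k) (Cod C q)" using q by simp_all
  show "monic C k" by (rule kernel_monic) fact
  have "g \<in> Hom C (Cod C k) (Cod C g)" "g \<cdot> k = zero_ar C (Dom C k) (Cod C g)" using k by simp_all
  then obtain w where w: "w \<in> Hom C (Cod C q) (Cod C g)" "w \<cdot> q = g"
    using ex1_implies_ex[OF cokernel_univ[OF assms(2)]] by blast
  fix x assume x: "x \<in> Ar C" "Cod C x = Dom C q" "q \<cdot> x = zero_ar C (Dom C x) (Cod C q)"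
  have "g \<cdot> x = (w \<cdot> q) \<cdot> x" using w by simp
  also have "\<dots> = w \<cdot> (q \<cdot> x)" using w(1) x q by (intro assoc_compose) simp_all
  also have "\<dots> = zero_ar C (Dom C x) (Cod C g)" using w(1) x q by simp
  finally show "\<exists>h \<in> Hom C (Dom C x) (Dom C k). k \<cdot> h = x"
    using x q k by (intro kernel_lift[OF assms(1)]) simp_all
qed

lemma monic_kernel_of_cokernel: "monic C k \<Longrightarrow> is_cokernel C k q \<Longrightarrow> is_kernel C q k"
  using monic_normal kernel_of_cokernel by blast

lemma cokernel_epic: "is_cokernel C f q \<Longrightarrow> epic C q"
  unfolding epic_def
proof (intro conjI allI ballI impI)
  assume q: "is_cokernel C f q"
  hence q': "f \<in> Ar C" "q \<in> Ar C" "Dom C q = Cod C f" "q \<cdot> f = zero_ar C (Dom C f) (Cod C q)"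
    by (simp_all add: is_cokernel_def)
  show "q \<in> Ar C" by fact
  fix X g h assume *: "g \<in> Hom C (Cod C q) X" "h \<in> Hom C (Cod C q) X" "g \<cdot> q = h \<cdot> q"
  have X: "X \<in> Ob C" using * Cod_Ob[of g] by simp
  have "(g \<cdot> q) \<cdot> f = zero_ar C (Dom C f) X"
    using q' *(1) X by simp
  moreover have "g \<cdot> q \<in> Hom C (Cod C f) X" using q' *(1) by simp
  ultimately have "\<exists>!h. h \<in> Hom C (Cod C q) X \<and> h \<cdot> q = g \<cdot> q"
    by (intro cokernel_univ[OF q])
  thus "g = h" using *(1,2) by (rule ex1_eqD[where P = "\<lambda>x. x \<cdot> q = g
      \<cdot> q", OF _ _ _ refl *(3)[symmetric]])
qed

lemma kernel_exact: "is_kernel C f k \<Longrightarrow> exact_at C k f"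
  unfolding exact_at_def using cokernels[of k] kernel_of_cokernel kernel_simps[of f k] by metis

text \<open>Exactness provides some kernel \<open>k'\<close> common to \<open>f\<close> and to the
  cokernel \<open>q\<close> of \<open>k\<close>. A monic \<open>k\<close> is a kernel of
  \<open>q\<close> as well, so \<open>k\<close> and \<open>k'\<close> factor through each other and
  \<open>k\<close> inherits the universal property.\<close>

lemma exact_monic_kernel:
  assumes "monic C k" "exact_at C k f"
  shows "is_kernel C f k"
proof -
  from assms(2) obtain q k' where
    q: "is_cokernel C k q" "is_kernel C q k'" "is_kernel C f k'"
    unfolding exact_at_def by blast
  have f: "f \<in> Ar C" "Cod C k = Dom C f" using assms(2) by (simp_all add: exact_at_def)
  have qk: "is_kernel C q k" using monic_kernel_of_cokernel assms(1) q(1) .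
  note [simp] = f kernel_simps(1,2,4)[OF q(2)] kernel_simps(2,4)[OF qk] kernel_simps(4)[OF q(3)]
  have [simp]: "Dom C q = Dom C f" "Cod C k' = Dom C f" using kernel_simps(3)[OF qk]
      kernel_simps(3)[OF q(3)] by simp_all
  have "\<exists>h\<in>Hom C (Dom C k) (Dom C k'). k' \<cdot> h = k" by (rule kernel_lift[OF q(2)]) simp_all
  then obtain a where a: "a \<in> Hom C (Dom C k) (Dom C k')" "k' \<cdot> a = k" by (rule bexE)
  have "\<exists>h\<in>Hom C (Dom C k') (Dom C k). k \<cdot> h = k'" by (rule kernel_lift[OF qk]) simp_all
  then obtain b where b: "b \<in> Hom C (Dom C k') (Dom C k)" "k \<cdot> b = k'" by (rule bexE)
  show ?thesis
  proof (rule kernelI)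
    have "f \<cdot> (k' \<cdot> a) = zero_ar C (Dom C k) (Cod C f)"
      using a(1) compose_reduce[OF kernel_simps(4)[OF q(3)], of a] by simp
    thus "f \<cdot> k = zero_ar C (Dom C k) (Cod C f)" using a by simp
    fix x assume "x \<in> Ar C" "Cod C x = Dom C f" "f \<cdot> x = zero_ar C (Dom C x) (Cod C f)"
    from kernel_lift[OF q(3) this] obtain h where h: "h \<in> Hom C (Dom C x) (Dom C k')" "k' \<cdot> h = x"
      by (rule bexE)
    have "k \<cdot> (b \<cdot> h) = x" using h b compose_reduce[OF b(2), of h] by simp
    thus "\<exists>h \<in> Hom C (Dom C x) (Dom C k). k \<cdot> h = x"
      using b(1) h(1) by (intro bexI[of _ "b \<cdot> h"]) simp_all
  qed (use f assms in simp_all)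
qed

lemma equalizer_exists:
  assumes "f \<in> Ar C" "g \<in> Ar C" "Dom C f = Dom C g" "Cod C f = Cod C g"
  shows "is_equalizer C f g (equalizer C f g)"
  unfolding equalizer_def
  using kernels[of "f \<boxplus> neg g"] equalizer_iff_kernel[OF assms] assms by (auto intro: someI_ex)

text \<open>The equalizer is the kernel of the difference: left exactness preserves the kernel,
  additivity the difference.\<close>

lemma left_exact_functor_equalizer:
  assumes "left_exact_functor C C Fo Fa" "additive_functor C C Fo Fa" "is_equalizer C f g e"
  shows "is_equalizer C (Fa f) (Fa g) (Fa e)"
proof -
  have Fhom: "Fa u \<in> Hom C (Fo i) (Fo j)" if "u \<in> Hom C i j" for i j u
    using assms(1) that unfolding left_exact_functor_def is_functor_def by blast
  have add: "Fa (u \<boxplus> v) = Fa u \<boxplus> Fa v" if "u \<in> Hom C i j" "v \<in> Hom C i j" for i j u v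
    using assms(2) that unfolding additive_functor_def by blast
  have [simp]: "f \<in> Ar C" "g \<in> Ar C" "Dom C f = Dom C g" "Cod C f = Cod C g"
    using assms(3) by (simp_all add: is_equalizer_def)
  have k: "is_kernel C (f \<boxplus> neg g) e" using assms(3) by (subst equalizer_iff_kernel[symmetric])
      simp_all
  have "is_kernel C (Fa (f \<boxplus> neg g)) (Fa e)"
    using assms(1) kernel_exact[OF k] kernel_monic[OF k] exact_monic_kernel
        unfolding left_exact_functor_def
    by blast
  moreover have "Fa (f \<boxplus> neg g) = Fa f \<boxplus> Fa (neg g)"
    by (rule add) simp_all
  moreover have Fz: "Fa (zero_ar C i j) = zero_ar C (Fo i) (Fo j)" if "i \<in> Ob C" "j \<in> Ob C" for i j
  proof -
    have z: "Fa (zero_ar C i j) \<in> Hom C (Fo i) (Fo j)" using that by (intro Fhom) simp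
    hence ob: "Fo i \<in> Ob C" "Fo j \<in> Ob C"
      using Dom_Ob[of "Fa (zero_ar C i j)"] Cod_Ob[of "Fa (zero_ar C i j)"] by simp_all
    have "Fa (zero_ar C i j \<boxplus> zero_ar C i j) = Fa (zero_ar C i j) \<boxplus> Fa (zero_ar C i j)"
      using that by (intro add) simp_all
    hence "Fa (zero_ar C i j) \<boxplus> Fa (zero_ar C i j) = zero_ar C (Fo i) (Fo j) \<boxplus> Fa (zero_ar C i j)"
      using that z ob by simp
    thus ?thesis by (rule add_right_cancel) (use z ob in simp_all)
  qed
  have Fg: "Fa f \<in> Hom C (Fo (Dom C g)) (Fo (Cod C g))" "Fa g \<in> Hom C (Fo (Dom C g)) (Fo (Cod C g))"
     "Fa (neg g) \<in> Hom C (Fo (Dom C g)) (Fo (Cod C g))" by (intro Fhom; simp)+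
  \<comment> \<open>Inverses are unique: both sides become the zero arrow after adding
    \<open>Fa g\<close>.\<close>
  have "Fa (neg g) = neg (Fa g)"
  proof (rule add_right_cancel)
    interpret G: comm_group "hom_group C (Fo (Dom C g)) (Fo (Cod C g))"
      using Fg Dom_Ob[of "Fa g"] Cod_Ob[of "Fa g"] by (intro hom_comm_group) simp_all
    have c: "h \<boxplus> k = k \<boxplus> h" if "h \<in> Hom C (Fo (Dom C g)) (Fo (Cod C g))" "k \<in> Hom C (Fo (Dom C g))
        (Fo (Cod C g))" for h k
      using G.m_comm[of h k] that by (simp add: hom_group_def)
    have "Fa (neg g) \<boxplus> Fa g = Fa g \<boxplus> Fa (neg g)" using Fg by (intro c)
    also have "\<dots> = Fa (g \<boxplus> neg g)" by (rule add[symmetric]) simp_all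
    also have "\<dots> = Fa g \<boxplus> neg (Fa g)" using Fg Fz by simp
    also have "\<dots> = neg (Fa g) \<boxplus> Fa g" using Fg by (intro c) simp_all
    finally show "Fa (neg g) \<boxplus> Fa g = neg (Fa g) \<boxplus> Fa g" .
  qed (use Fg in simp_all)
  ultimately show ?thesis using Fg by (subst equalizer_iff_kernel) simp_all
qed

end

section \<open>Additivity and exactness of the tensor product\<close>

context coabelian_monoidal_category
begin

text \<open>Every cancellation of a whiskered \<open>E n\<close>, and every factorization through it
  under a tensor factor, will rest on this consequence of left exactness in each variable.\<close>

lemma tensor_equalizer:
  assumes "is_equalizer C f g e" "X \<in> Ob C"
  shows "is_equalizer C (X \<lhd> f) (X \<lhd> g) (X \<lhd> e)"
    "is_equalizer C (f \<rhd> X) (g \<rhd> X) (e \<rhd> X)"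
  unfolding lw_def rw_def
  using left_exact_functor_equalizer[OF tensor_left_left_exact tensor_left_additive assms(1)]
    left_exact_functor_equalizer[OF tensor_right_left_exact tensor_right_additive assms(1)] assms(2)
  by blast+

lemma whisker_add:
  assumes "f \<in> Ar C" "g \<in> Ar C" "Dom C f = Dom C g" "Cod C f = Cod C g" "X \<in> Ob C"
  shows "X \<lhd> (f \<boxplus> g) = X \<lhd> f \<boxplus> X \<lhd> g" "(f \<boxplus> g) \<rhd> X = f \<rhd> X \<boxplus> g \<rhd> X"
proof -
  have "f \<in> Hom C (Dom C g) (Cod C g)" "g \<in> Hom C (Dom C g) (Cod C g)" using assms by simp_all
  thus "X \<lhd> (f \<boxplus> g) = X \<lhd> f \<boxplus> X \<lhd> g" "(f \<boxplus> g) \<rhd> X = f \<rhd> X \<boxplus> g \<rhd> X"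
    using tensor_left_additive[OF assms(5)] tensor_right_additive[OF assms(5)]
    unfolding additive_functor_def lw_def rw_def by blast+
qed

lemma whisker_zero [simp]:
  assumes "A \<in> Ob C" "B \<in> Ob C" "X \<in> Ob C"
  shows "X \<lhd> zero_ar C A B = zero_ar C (X \<otimes>\<^sub>o A) (X \<otimes>\<^sub>o B)"
    "zero_ar C A B \<rhd> X = zero_ar C (A \<otimes>\<^sub>o X) (B \<otimes>\<^sub>o X)"
proof -
  let ?z = "zero_ar C A B"
  have "X \<lhd> ?z \<boxplus> X \<lhd> ?z = zero_ar C (X \<otimes>\<^sub>o A) (X \<otimes>\<^sub>o B) \<boxplus> X \<lhd> ?z"
    using whisker_add(1)[of ?z ?z X] assms by simp
  thus "X \<lhd> zero_ar C A B = zero_ar C (X \<otimes>\<^sub>o A) (X \<otimes>\<^sub>o B)"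
    by (rule add_right_cancel) (use assms in simp_all)
  have "?z \<rhd> X \<boxplus> ?z \<rhd> X = zero_ar C (A \<otimes>\<^sub>o X) (B \<otimes>\<^sub>o X) \<boxplus> ?z \<rhd> X"
    using whisker_add(2)[of ?z ?z X] assms by simp
  thus "zero_ar C A B \<rhd> X = zero_ar C (A \<otimes>\<^sub>o X) (B \<otimes>\<^sub>o X)"
    by (rule add_right_cancel) (use assms in simp_all)
qed

lemma tensor_zero [simp]:
  assumes "A \<in> Ob C" "B \<in> Ob C" "f \<in> Ar C"
  shows "f \<otimes>\<^sub>a zero_ar C A B = zero_ar C (Dom C f \<otimes>\<^sub>o A) (Cod C f \<otimes>\<^sub>o B)"
    "zero_ar C A B \<otimes>\<^sub>a f = zero_ar C (A \<otimes>\<^sub>o Dom C f) (B \<otimes>\<^sub>o Cod C f)"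
  using assms by (simp_all add: tensor_split)

lemma tensor_add:
  assumes "f \<in> Ar C" "g \<in> Ar C" "Dom C f = Dom C g" "Cod C f = Cod C g" "h \<in> Ar C"
  shows "h \<otimes>\<^sub>a (f \<boxplus> g) = (h \<otimes>\<^sub>a f) \<boxplus> (h \<otimes>\<^sub>a g)" "(f \<boxplus> g) \<otimes>\<^sub>a h = (f \<otimes>\<^sub>a h) \<boxplus> (g \<otimes>\<^sub>a h)"
  using assms by (simp_all add: tensor_split whisker_add compose_add)

end

section \<open>AB5 and countable direct sums\<close>

context category
begin

lemma coproduct_cong:
  assumes "is_coproduct C I X S \<iota>" "\<And>j. j \<in> I \<Longrightarrow> X j = X' j" "\<And>j. j \<in> I \<Longrightarrow> \<iota> j = \<iota>' j"
  shows "is_coproduct C I X' S \<iota>'"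
proof (rule coproductI)
  note * = coproduct_simps[OF assms(1)]
  show "S \<in> Ob C" "\<And>j. j \<in> I \<Longrightarrow> X' j \<in> Ob C" "\<And>j. j \<in> I \<Longrightarrow> \<iota>' j \<in> Hom C (X' j) S"
    using * assms(2,3) by auto
  show "\<exists>h \<in> Hom C S Y. \<forall>j\<in>I. h \<cdot> \<iota>' j = f j"
    if "Y \<in> Ob C" "\<And>j. j \<in> I \<Longrightarrow> f j \<in> Hom C (X' j) Y" for Y f
    using coproduct_desc[OF assms(1) that(1), of f] that(2) assms(2,3) by simp
  show "f = g" if "f \<in> Ar C" "g \<in> Ar C" "Dom C f = S" "Dom C g = S" "Cod C f = Cod C g"
      "\<And>j. j \<in> I \<Longrightarrow> f \<cdot> \<iota>' j = g \<cdot> \<iota>' j" for f g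
    using that assms(3) by - (rule coproduct_ext[OF assms(1)], simp_all)
qed

end

text \<open>The ordered set of natural numbers, transported along \<open>enc\<close> to a category whose objects and
  arrows lie in the type that measures smallness.\<close>

definition omega_category :: "(nat \<Rightarrow> 'i) \<Rightarrow> ('i, 'i) category" where
  "omega_category enc = \<lparr>Ob = range enc,
     Ar = {enc (prod_encode (n, m)) | n m. n \<le> m},
     Dom = (\<lambda>u. enc (fst (prod_decode (the_inv enc u)))),
     Cod = (\<lambda>u. enc (snd (prod_decode (the_inv enc u)))),
     ident = (\<lambda>i. enc (prod_encode (the_inv enc i, the_inv enc i))),
     compose = (\<lambda>v u. enc (prod_encode (fst (prod_decode (the_inv enc u)), snd (prod_decode
         (the_inv enc v)))))\<rparr>"

text \<open>Only countable diagrams occur: the ordered set of natural numbers, and direct sums over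
  numbers, pairs and triples. One embedding \<open>enc\<close> makes all of them small.\<close>

locale ab5_braided_category = coabelian_monoidal_category C + braided_monoidal_category C
  for C :: "('o, 'a, 'z) braided_category_scheme" (structure) +
  fixes enc :: "nat \<Rightarrow> 'i"
  assumes inj_enc: "inj enc"
    and AB5: "AB5 TYPE('i) C"
    and tensor_direct_sums: "tensor_preserves_direct_sums TYPE('i) C"
begin

abbreviation \<Omega> :: "('i, 'i) category" where
  "\<Omega> \<equiv> omega_category enc"

lemma inv_enc [simp]: "the_inv enc (enc n) = n"
  using inj_enc by (rule the_inv_f_f)

lemma enc_eq [simp]: "enc n = enc m \<longleftrightarrow> n = m"
  using inj_enc by (simp add: inj_eq)

lemma Hom_omega: "u \<in> Hom \<Omega> i j \<longleftrightarrow> (\<exists>n m. n \<le> m \<and> i = enc n \<and> j = enc m \<and> u = enc (prod_encode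
    (n, m)))"
  by (auto simp: omega_category_def Hom_def)

lemma omega_simps [simp]:
  "Ob \<Omega> = range enc" "ident \<Omega> (enc n) = enc (prod_encode (n, n))"
  "compose \<Omega> (enc (prod_encode (m, l))) (enc (prod_encode (n, m'))) = enc (prod_encode (n, l))"
  by (simp_all add: omega_category_def)

lemma category_omega: "category \<Omega>"
proof
  fix f A B g D h E
  show "f \<in> Ar \<Omega> \<Longrightarrow> Dom \<Omega> f \<in> Ob \<Omega>" "f \<in> Ar \<Omega> \<Longrightarrow> Cod \<Omega> f \<in> Ob \<Omega>"
    by (auto simp: omega_category_def)
  show "A \<in> Ob \<Omega> \<Longrightarrow> ident \<Omega> A \<in> Hom \<Omega> A A"
    "f \<in> Hom \<Omega> A B \<Longrightarrow> g \<in> Hom \<Omega> B D \<Longrightarrow> compose \<Omega> g f \<in> Hom \<Omega> A D"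
    "f \<in> Hom \<Omega> A B \<Longrightarrow> compose \<Omega> (ident \<Omega> B) f = f"
    "f \<in> Hom \<Omega> A B \<Longrightarrow> compose \<Omega> f (ident \<Omega> A) = f"
    "f \<in> Hom \<Omega> A B \<Longrightarrow> g \<in> Hom \<Omega> B D \<Longrightarrow> h \<in> Hom \<Omega> D E \<Longrightarrow>
       compose \<Omega> (compose \<Omega> h g) f = compose \<Omega> h (compose \<Omega> g f)"
    by (auto simp: Hom_omega)
qed

lemma filtered_omega: "filtered \<Omega>"
  unfolding filtered_def
proof (intro conjI ballI allI category_omega)
  fix i j assume "i \<in> Ob \<Omega>" "j \<in> Ob \<Omega>"
  then obtain n m where nm: "i = enc n" "j = enc m" by auto
  have "enc (prod_encode (n, max n m)) \<in> Hom \<Omega> i (enc (max n m))"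
    "enc (prod_encode (m, max n m)) \<in> Hom \<Omega> j (enc (max n m))"
    unfolding Hom_omega nm by fastforce+
  thus "\<exists>k\<in>Ob \<Omega>. Hom \<Omega> i k \<noteq> {} \<and> Hom \<Omega> j k \<noteq> {}" by (intro bexI[of _ "enc (max n m)"]) auto
next
  fix i j u v assume u: "u \<in> Hom \<Omega> i j" "v \<in> Hom \<Omega> i j"
  hence "u = v" by (auto simp: Hom_omega)
  moreover from u obtain m where "j = enc m" by (auto simp: Hom_omega)
  ultimately show "\<exists>k. \<exists>w\<in>Hom \<Omega> j k. compose \<Omega> w u = compose \<Omega> w v"
    by (intro exI[of _ j] bexI[of _ "ident \<Omega> j"]) (auto simp: Hom_omega)
qed simp_all

definition omega_ar :: "(nat \<Rightarrow> nat \<Rightarrow> 'a) \<Rightarrow> 'i \<Rightarrow> 'a" where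
  "omega_ar G u = (case prod_decode (the_inv enc u) of (n, m) \<Rightarrow> G n m)"

lemma omega_ar [simp]: "omega_ar G (enc (prod_encode (n, m))) = G n m"
  by (simp add: omega_ar_def)

lemma omega_functor:
  assumes "A \<in> Ob C" "\<And>n m. n \<le> m \<Longrightarrow> G n m \<in> Hom C A A" "\<And>n. G n n = \<^bold>1 A"
    "\<And>n m l. n \<le> m \<Longrightarrow> m \<le> l \<Longrightarrow> G m l \<cdot> G n m = G n l"
  shows "is_functor \<Omega> C (\<lambda>_. A) (omega_ar G)"
  unfolding is_functor_def using assms by (auto simp: Hom_omega)

lemma omega_natural:
  assumes "\<phi> \<in> Hom C A B" "\<And>n m. n \<le> m \<Longrightarrow> \<phi> \<cdot> G n m = G' n m \<cdot> \<phi>"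
  shows "is_natural \<Omega> C (\<lambda>_. A) (omega_ar G) (\<lambda>_. B) (omega_ar G') (\<lambda>_. \<phi>)"
  unfolding is_natural_def using assms by (auto simp: Hom_omega)

lemma omega_cocone:
  "is_cocone \<Omega> C (\<lambda>_. A) (omega_ar G) L \<xi> \<longleftrightarrow>
     L \<in> Ob C \<and> (\<forall>n. \<xi> (enc n) \<in> Hom C A L) \<and> (\<forall>n m. n \<le> m \<longrightarrow> \<xi> (enc m) \<cdot> G n m = \<xi> (enc n))"
proof -
  have "\<xi> (enc m) \<cdot> G n m = \<xi> (enc n)" if "\<forall>i j. \<forall>u\<in>Hom \<Omega> i j. \<xi> j \<cdot> omega_ar G u = \<xi> i" "n \<le> m"
      for n m
  proof -
    have "enc (prod_encode (n, m)) \<in> Hom \<Omega> (enc n) (enc m)" using that(2) by (auto simp: Hom_omega)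
    with that(1) have "\<xi> (enc m) \<cdot> omega_ar G (enc (prod_encode (n, m))) = \<xi> (enc n)" by blast
    thus ?thesis by simp
  qed
  thus ?thesis unfolding is_cocone_def by (auto simp: Hom_omega simp del: in_Hom)
qed

lemma omega_colimitI:
  assumes "L \<in> Ob C" "\<And>n. c n \<in> Hom C A L" "\<And>n m. n \<le> m \<Longrightarrow> c m \<cdot> G n m = c n"
    and "\<And>X \<xi>. X \<in> Ob C \<Longrightarrow> (\<And>n. \<xi> n \<in> Hom C A X) \<Longrightarrow> (\<And>n m. n \<le> m \<Longrightarrow> \<xi> m \<cdot> G n m = \<xi> n)
      \<Longrightarrow> \<exists>h \<in> Hom C L X. \<forall>n. h \<cdot> c n = \<xi> n"
    and "\<And>f g. f \<in> Ar C \<Longrightarrow> g \<in> Ar C \<Longrightarrow> Dom C f = L \<Longrightarrow> Dom C g = L \<Longrightarrow> Cod C f = Cod C g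
      \<Longrightarrow> (\<And>n. f \<cdot> c n = g \<cdot> c n) \<Longrightarrow> f = g"
  shows "is_colimit \<Omega> C (\<lambda>_. A) (omega_ar G) L (\<lambda>i. c (the_inv enc i))"
  unfolding is_colimit_def
proof (intro conjI allI impI)
  show "is_cocone \<Omega> C (\<lambda>_. A) (omega_ar G) L (\<lambda>i. c (the_inv enc i))"
    using assms(1-3) by (simp add: omega_cocone)
  fix X \<xi> assume *: "is_cocone \<Omega> C (\<lambda>_. A) (omega_ar G) X \<xi>"
  have "\<exists>h \<in> Hom C L X. \<forall>n. h \<cdot> c n = \<xi> (enc n)"
    using * unfolding omega_cocone by (intro assms(4)) blast+
  then obtain h where h: "h \<in> Hom C L X" "\<forall>n. h \<cdot> c n = \<xi> (enc n)" by blast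
  show "\<exists>!h. h \<in> Hom C L X \<and> (\<forall>j\<in>Ob \<Omega>. h \<cdot> c (the_inv enc j) = \<xi> j)"
  proof (rule ex1I)
    fix k assume "k \<in> Hom C L X \<and> (\<forall>j\<in>Ob \<Omega>. k \<cdot> c (the_inv enc j) = \<xi> j)"
    with h show "k = h" by - (rule assms(5), simp_all)
  qed (use h in simp)
qed

text \<open>Let \<open>k\<close> be the kernel of the cokernel of \<open>x\<close>. The constant endomorphism systems on \<open>S\<close> with
  transition maps \<open>t n m\<close>, which annihilate the summands \<open>n, \<dots>, m - 1\<close>, have colimit \<open>S\<close> along the
  truncations \<open>s n\<close>. Since \<open>s n \<cdot> k = 0\<close>, the monomorphism \<open>k\<close> induces the zero map on colimits,
      which
  is monic by AB5.\<close>

lemma coproduct_proj_zero: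
  fixes X :: "nat \<Rightarrow> 'o"
  assumes S: "is_coproduct C UNIV X S \<iota>" and p: "\<And>n. p n \<in> Hom C S (X n)"
    and p\<iota>: "\<And>n k. p n \<cdot> \<iota> k = (if k = n then \<^bold>1 (X n) else zero_ar C (X k) (X n))"
    and x: "x \<in> Ar C" "Cod C x = S" and px: "\<And>n. p n \<cdot> x = zero_ar C (Dom C x) (X n)"
  shows "x = zero_ar C (Dom C x) S"
proof -
  note [simp] = coproduct_simps[OF S, simplified] x p[simplified] px
  note ext = coproduct_ext[OF S]
  have p': "p n \<in> Ar C" "Dom C (p n) = S" "Cod C (p n) = X n" for n using p by simp_all
  obtain q where q: "is_cokernel C x q" using cokernels[of x] by auto
  hence q' [simp]: "q \<in> Ar C" "Dom C q = S" "q \<cdot> x = zero_ar C (Dom C x) (Cod C q)"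
    by (simp_all add: is_cokernel_def)
  obtain k where k: "is_kernel C q k" using kernels[of q] by auto
  note [simp] = kernel_simps(2-4)[OF k]
  define K where "K = Dom C k"
  define Q where "Q = Cod C q"
  have [simp]: "K \<in> Ob C" "Q \<in> Ob C" "Dom C k = K" "Cod C q = Q" by (simp_all add: K_def Q_def)
  have "\<exists>h \<in> Hom C (Dom C x) (Dom C k). k \<cdot> h = x" by (rule kernel_lift[OF k]) simp_all
  then obtain x' where x': "x' \<in> Hom C (Dom C x) (Dom C k)" "k \<cdot> x' = x" by (rule bexE)
  \<comment> \<open>Each \<open>p n\<close> kills \<open>x\<close>, hence factors through the
    cokernel \<open>q\<close>, and \<open>q\<close> kills \<open>k\<close>. So \<open>k\<close> has
    the property assumed of \<open>x\<close>, and is monic in addition.\<close>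
  have pk: "p n \<cdot> k = zero_ar C K (X n)" for n
  proof -
    have "\<exists>!w. w \<in> Hom C (Cod C q) (X n) \<and> w \<cdot> q = p n"
      by (rule cokernel_univ[OF q]) simp_all
    then obtain w where w: "w \<in> Hom C (Cod C q) (X n)" "w \<cdot> q = p n" by blast
    have "(w \<cdot> q) \<cdot> k = zero_ar C K (X n)" using w(1) by simp
    thus ?thesis using w(2) by simp
  qed
  have "\<exists>h \<in> Hom C S S. \<forall>k\<in>UNIV. h \<cdot> \<iota> k = (if k < n then \<iota> k else zero_ar C (X k) S)" for n
    by (rule coproduct_desc[OF S]) simp_all
  hence "\<forall>n. \<exists>h. h \<in> Hom C S S \<and> (\<forall>k\<in>UNIV. h \<cdot> \<iota> k = (if k < n then \<iota> k else zero_ar C (X k) S))"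
    unfolding Bex_def by (rule allI)
  from choice[OF this] obtain s where s: "\<And>n. s n \<in> Hom C S S"
    "\<And>n k. s n \<cdot> \<iota> k = (if k < n then \<iota> k else zero_ar C (X k) S)"
    by blast
  have "\<exists>h \<in> Hom C S S. \<forall>k\<in>UNIV. h \<cdot> \<iota> k = (if n \<le> k \<and> k < m then zero_ar C (X k) S else \<iota> k)"
      for n m
    by (rule coproduct_desc[OF S]) simp_all
  hence "\<forall>n. \<exists>t. \<forall>m. t m \<in> Hom C S S \<and> (\<forall>k\<in>UNIV. t m \<cdot> \<iota> k = (if n \<le> k \<and> k < m then zero_ar C
      (X k) S else \<iota> k))"
    unfolding Bex_def by (intro allI choice) simp
  from choice[OF this] obtain t where t: "\<And>n m. t n m \<in> Hom C S S"
    "\<And>n m k. t n m \<cdot> \<iota> k = (if n \<le> k \<and> k < m then zero_ar C (X k) S else \<iota> k)"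
    by blast
  note [simp] = s[simplified] t[simplified]
  have tt: "t m l \<cdot> t n m = t n l" if "n \<le> m" "m \<le> l" for n m l
    by (rule ext) (use that in auto)
  have t1: "t n n = \<^bold>1 S" for n by (rule ext) auto
  have st: "s m \<cdot> t n m = s n" if "n \<le> m" for n m
    by (rule ext) (use that in auto)
  have s0: "s 0 = zero_ar C S S" by (rule ext) simp_all
  have sS: "s (Suc n) = s n \<boxplus> \<iota> n \<cdot> p n" for n
    by (rule ext) (auto simp: compose_add p\<iota> less_Suc_eq)
  have sk: "s n \<cdot> k = zero_ar C K S" for n
    by (induction n) (simp_all add: s0 sS compose_add pk)
  \<comment> \<open>A subtraction-free form of \<open>t n m = 1 - (s m - s n)\<close>. As the
    truncations kill \<open>k\<close>, it shows that \<open>t n m\<close> fixes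
    \<open>k\<close>.\<close>
  have ts: "t n m \<boxplus> s m = \<^bold>1 S \<boxplus> s n" if "n \<le> m" for n m
    by (rule ext) (use that in \<open>auto simp: compose_add\<close>)
  have tk: "t n m \<cdot> k = k" if "n \<le> m" for n m
  proof -
    have "(t n m \<boxplus> s m) \<cdot> k = (\<^bold>1 S \<boxplus> s n) \<cdot> k" using ts[OF that] by simp
    thus ?thesis by (simp add: compose_add sk)
  qed
  \<comment> \<open>Since \<open>t n m\<close> fixes \<open>x\<close>, it descends to the cokernel;
    this gives the third system of the short exact sequence of systems.\<close>
  have "\<exists>z. z \<in> Hom C Q Q \<and> z \<cdot> q = q \<cdot> t n m" if "n \<le> m" for n m
  proof -
    have "t n m \<cdot> x = x" using compose_reduce[OF tk[OF that], of x'] x' by simp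
    hence "\<exists>!z. z \<in> Hom C (Cod C q) Q \<and> z \<cdot> q = q \<cdot> t n m"
      by (intro cokernel_univ[OF q]) simp_all
    thus ?thesis by auto
  qed
  then obtain z where z: "\<And>n m. n \<le> m \<Longrightarrow> z n m \<in> Hom C Q Q" "\<And>n m. n \<le> m \<Longrightarrow> z n m \<cdot> q = q \<cdot> t n m"
    by metis
  have ep: "f = g" if "f \<cdot> q = g \<cdot> q" "f \<in> Hom C Q Y" "g \<in> Hom C Q Y" for f g Y
    using cokernel_epic[OF q] that unfolding epic_def by (metis \<open>Cod C q = Q\<close>)
  have FX: "is_functor \<Omega> C (\<lambda>_. K) (omega_ar (\<lambda>_ _. \<^bold>1 K))" by (rule omega_functor) simp_all
  have FY: "is_functor \<Omega> C (\<lambda>_. S) (omega_ar t)" by (rule omega_functor) (simp_all add: t1 tt)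
  have FZ: "is_functor \<Omega> C (\<lambda>_. Q) (omega_ar z)"
  proof (rule omega_functor)
    show "z n m \<in> Hom C Q Q" if "n \<le> m" for n m by (rule z) fact
    show "z n n = \<^bold>1 Q" for n
      by (rule ep) (use z[of n n] in \<open>simp_all add: t1\<close>)
    show "z m l \<cdot> z n m = z n l" if "n \<le> m" "m \<le> l" for n m l
    proof (rule ep)
      have "z m l \<cdot> (q \<cdot> t n m) = (q \<cdot> t m l) \<cdot> t n m"
        using compose_reduce[OF z(2)[OF that(2)], of "t n m"] z(1)[OF that(2)] by simp
      thus "(z m l \<cdot> z n m) \<cdot> q = z n l \<cdot> q"
        using that z[OF that(1)] z[OF that(2)] z[of n l] by (simp add: tt)
    qed (use that z[OF that(1)] z[OF that(2)] z[of n l] in simp_all)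
  qed simp
  have "\<exists>LZ \<iota>Z. is_colimit \<Omega> C (\<lambda>_. Q) (omega_ar z) LZ \<iota>Z"
    using AB5 category_omega FZ unfolding AB5_def cocomplete_def by blast
  then obtain LZ \<iota>Z where LZ: "is_colimit \<Omega> C (\<lambda>_. Q) (omega_ar z) LZ \<iota>Z" by blast
  hence LZ': "LZ \<in> Ob C" "\<iota>Z (enc n) \<in> Hom C Q LZ" "n \<le> m \<Longrightarrow> \<iota>Z (enc m) \<cdot> z n m = \<iota>Z (enc n)" for n m
    unfolding is_colimit_def omega_cocone by blast+
  have LX: "is_colimit \<Omega> C (\<lambda>_. K) (omega_ar (\<lambda>_ _. \<^bold>1 K)) K (\<lambda>i. (\<lambda>_. \<^bold>1 K) (the_inv enc i))"
  proof (rule omega_colimitI)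
    fix X and \<xi> :: "nat \<Rightarrow> 'a"
    assume *: "X \<in> Ob C" "\<And>n. \<xi> n \<in> Hom C K X" "\<And>n m. n \<le> m \<Longrightarrow> \<xi> m \<cdot> \<^bold>1 K = \<xi> n"
    have "\<xi> 0 = \<xi> n" for n using *(3)[of 0 n] *(2)[of n] by simp
    hence "\<xi> 0 \<cdot> \<^bold>1 K = \<xi> n" for n using *(2)[of 0] by simp
    thus "\<exists>h\<in>Hom C K X. \<forall>n. h \<cdot> \<^bold>1 K = \<xi> n" using *(2)[of 0] by blast
  qed simp_all
  have LY: "is_colimit \<Omega> C (\<lambda>_. S) (omega_ar t) S (\<lambda>i. s (the_inv enc i))"
  proof (rule omega_colimitI)
    fix Y and \<xi> :: "nat \<Rightarrow> 'a"
    assume *: "Y \<in> Ob C" "\<And>n. \<xi> n \<in> Hom C S Y" "\<And>n m. n \<le> m \<Longrightarrow> \<xi> m \<cdot> t n m = \<xi> n"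
    \<comment> \<open>On the summand \<open>k\<close> a cocone vanishes at the stages up to
      \<open>k\<close> and is constant from \<open>Suc k\<close> on; \<open>h\<close> takes that
      constant value.\<close>
    have "\<exists>h \<in> Hom C S Y. \<forall>k\<in>UNIV. h \<cdot> \<iota> k = \<xi> (Suc k) \<cdot> \<iota> k"
      using * by (intro coproduct_desc[OF S]) simp_all
    then obtain h where h: "h \<in> Hom C S Y" "\<And>k. h \<cdot> \<iota> k = \<xi> (Suc k) \<cdot> \<iota> k" by blast
    have "h \<cdot> s n = \<xi> n" for n
    proof (rule ext)
      fix k
      show "(h \<cdot> s n) \<cdot> \<iota> k = \<xi> n \<cdot> \<iota> k"
      proof (cases "k < n")
        case True
        have "\<xi> (Suc k) \<cdot> \<iota> k = (\<xi> n \<cdot> t (Suc k) n) \<cdot> \<iota> k" using *(3)[of "Suc k" n] True by simp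
        also have "\<dots> = \<xi> n \<cdot> \<iota> k" using *(2)[of n] by simp
        finally show ?thesis using True h by simp
      next
        case False
        have "\<xi> n \<cdot> \<iota> k = (\<xi> (Suc k) \<cdot> t n (Suc k)) \<cdot> \<iota> k" using *(3)[of n "Suc k"] False by simp
        also have "\<dots> = zero_ar C (X k) Y" using *(1) *(2)[of "Suc k"] False by simp
        finally show ?thesis using False h * by simp
      qed
    qed (use h *(2)[of n] in simp_all)
    thus "\<exists>h\<in>Hom C S Y. \<forall>n. h \<cdot> s n = \<xi> n" using h(1) by blast
  next
    fix f g assume fg: "f \<in> Ar C" "g \<in> Ar C" "Dom C f = S" "Dom C g = S" "Cod C f = Cod C g"
      "\<And>n. f \<cdot> s n = g \<cdot> s n"
    show "f = g"
    proof (rule ext)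
      fix k
      have "(f \<cdot> s (Suc k)) \<cdot> \<iota> k = (g \<cdot> s (Suc k)) \<cdot> \<iota> k" by (simp only: fg(6))
      thus "f \<cdot> \<iota> k = g \<cdot> \<iota> k" using fg(1-5) by simp
    qed (use fg in simp_all)
  qed (simp_all add: st)
  have "is_cocone \<Omega> C (\<lambda>_. S) (omega_ar t) LZ (\<lambda>i. \<iota>Z i \<cdot> q)"
    unfolding omega_cocone
  proof (intro conjI allI impI)
    fix n m :: nat assume nm: "n \<le> m"
    have "\<iota>Z (enc m) \<cdot> (q \<cdot> t n m) = \<iota>Z (enc m) \<cdot> (z n m \<cdot> q)" using z(2)[OF nm] by simp
    also have "\<dots> = \<iota>Z (enc n) \<cdot> q"
      using LZ'(2)[of m] z(1)[OF nm] by (intro compose_reduce[OF LZ'(3)[OF nm]]) simp_all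
    finally show "(\<iota>Z (enc m) \<cdot> q) \<cdot> t n m = \<iota>Z (enc n) \<cdot> q" using LZ'(2)[of m] by simp
  qed (use LZ' in simp_all)
  hence "\<exists>!g. g \<in> Hom C S LZ \<and> (\<forall>j \<in> Ob \<Omega>. g \<cdot> s (the_inv enc j) = \<iota>Z j \<cdot> q)"
    using LY unfolding is_colimit_def by blast
  then obtain g where g: "g \<in> Hom C S LZ" "\<forall>j \<in> Ob \<Omega>. g \<cdot> s (the_inv enc j) = \<iota>Z j \<cdot> q" by blast
  have se: "\<forall>j\<in>Ob \<Omega>. short_exact C ((\<lambda>_. k) j) ((\<lambda>_. q) j)"
    unfolding short_exact_def using kernel_monic[OF k] kernel_exact[OF k] cokernel_epic[OF q]
        by simp
  have NX: "is_natural \<Omega> C (\<lambda>_. K) (omega_ar (\<lambda>_ _. \<^bold>1 K)) (\<lambda>_. S) (omega_ar t) (\<lambda>_. k)"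
    by (rule omega_natural) (simp_all add: tk)
  have NY: "is_natural \<Omega> C (\<lambda>_. S) (omega_ar t) (\<lambda>_. Q) (omega_ar z) (\<lambda>_. q)"
    by (rule omega_natural) (simp_all add: z)
  let ?f = "zero_ar C K S"
  have f: "?f \<in> Hom C K S" "\<forall>j\<in>Ob \<Omega>. ?f \<cdot> (\<lambda>i. (\<lambda>_. \<^bold>1 K) (the_inv enc i)) j = (\<lambda>i. s
      (the_inv enc i)) j \<cdot> (\<lambda>_. k) j"
    by (simp_all add: sk)
  note AB = AB5[unfolded AB5_def, THEN conjunct2, THEN conjunct2]
  have "short_exact C ?f g"
    using AB[rule_format, of \<Omega> "\<lambda>_. K" "omega_ar (\<lambda>_ _. \<^bold>1 K)" "\<lambda>_. S" "omega_ar t" "\<lambda>_. Q"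
        "omega_ar z" "\<lambda>_. k"
      "\<lambda>_. q" K "\<lambda>i. (\<lambda>_. \<^bold>1 K) (the_inv enc i)" S "\<lambda>i. s (the_inv enc i)" LZ \<iota>Z ?f g]
      filtered_omega FX FY FZ NX NY se LX LY LZ f g by blast
  hence "monic C ?f" by (simp add: short_exact_def)
  moreover have "?f \<cdot> \<^bold>1 K = ?f \<cdot> zero_ar C K K" by simp
  moreover have "\<^bold>1 K \<in> Hom C K (Dom C ?f)" "zero_ar C K K \<in> Hom C K (Dom C ?f)" by simp_all
  \<comment> \<open>A zero arrow is monic only if its source is a zero object, so \<open>k\<close>
    vanishes, and with it \<open>x\<close>, which factors through \<open>k\<close>.\<close>
  ultimately have "\<^bold>1 K = zero_ar C K K" unfolding monic_def by blast
  hence "k \<cdot> (\<^bold>1 K \<cdot> x') = k \<cdot> (zero_ar C K K \<cdot> x')" by simp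
  thus ?thesis using x' by simp
qed

text \<open>Applies \<open>coproduct_proj_zero\<close> to the difference of the two arrows. The
  bijection \<open>d\<close> lists the index type by natural numbers, since the truncations used
  there add one summand at a time.\<close>

lemma coproduct_proj_ext:
  fixes d :: "nat \<Rightarrow> 'j" and X :: "'j \<Rightarrow> 'o"
  assumes S: "is_coproduct C UNIV X S \<iota>" and d: "bij d"
    and p: "\<And>n. p n \<in> Hom C S (X n)"
    and p\<iota>: "\<And>n k. p n \<cdot> \<iota> k = (if k = n then \<^bold>1 (X n) else zero_ar C (X k) (X n))"
    and x: "x \<in> Ar C" "Cod C x = S" "y \<in> Ar C" "Cod C y = S" "Dom C x = Dom C y"
    and eq: "\<And>n. p n \<cdot> x = p n \<cdot> y"
  shows "x = y"
proof -
  have "x \<boxplus> neg y = zero_ar C (Dom C (x \<boxplus> neg y)) S"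
  proof (rule coproduct_proj_zero)
    show "is_coproduct C UNIV (\<lambda>n. X (d n)) S (\<lambda>n. \<iota> (d n))"
      using coproduct_reindex[of d UNIV UNIV] S d by simp
    show "p (d n) \<in> Hom C S (X (d n))" for n by (rule p)
    show "p (d n) \<cdot> \<iota> (d k) = (if k = n then \<^bold>1 (X (d n)) else zero_ar C (X (d k)) (X (d n)))"
        for n k
      using p\<iota> d by (auto simp: bij_def inj_eq)
    show "p (d n) \<cdot> (x \<boxplus> neg y) = zero_ar C (Dom C (x \<boxplus> neg y)) (X (d n))" for n
    proof -
      have "p (d n) \<cdot> (x \<boxplus> neg y) = p (d n) \<cdot> x \<boxplus> p (d n) \<cdot> neg y"
        using x p[of "d n"] by (simp add: compose_add)
      also have "\<dots> = p (d n) \<cdot> (y \<boxplus> neg y)"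
        using x p[of "d n"] by (simp only: eq, subst compose_add) simp_all
      also have "\<dots> = zero_ar C (Dom C y) (X (d n))" using x p[of "d n"] coproduct_simps(2)[OF S]
          by simp
      finally show ?thesis using x by simp
    qed
  qed (use x in simp_all)
  thus ?thesis using eq_iff_diff_zero[of x y] x by simp
qed

lemma countable_coproduct:
  fixes g :: "'j \<Rightarrow> nat" and X :: "'j \<Rightarrow> 'o"
  assumes "inj_on g I" "\<And>j. j \<in> I \<Longrightarrow> X j \<in> Ob C"
  shows "is_coproduct C I X (fst (coproduct C I X)) (snd (coproduct C I X))"
proof -
  have "inj_on (\<lambda>j. enc (g j)) I" using assms(1) by (auto simp: inj_on_def)
  moreover have "cocomplete TYPE('i) C" using AB5 by (simp add: AB5_def)
  ultimately have "\<exists>S \<iota>. is_coproduct C I X S \<iota>" using assms(2) by (intro coproduct_exists)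
  hence "\<exists>p. is_coproduct C I X (fst p) (snd p)" by simp
  thus ?thesis unfolding coproduct_def by (rule someI_ex)
qed

text \<open>Preservation of direct sums is given for index sets inside \<open>'i\<close>; the family
  is moved there along \<open>g\<close> and \<open>enc\<close>, and the result is moved
  back.\<close>

lemma tensor_coproduct:
  fixes g :: "'j \<Rightarrow> nat" and X :: "'j \<Rightarrow> 'o"
  assumes "is_coproduct C I X S \<iota>" "inj_on g I" "Y \<in> Ob C"
  shows "is_coproduct C I (\<lambda>j. Y \<otimes>\<^sub>o X j) (Y \<otimes>\<^sub>o S) (\<lambda>j. Y \<lhd> \<iota> j)"
    "is_coproduct C I (\<lambda>j. X j \<otimes>\<^sub>o Y) (S \<otimes>\<^sub>o Y) (\<lambda>j. \<iota> j \<rhd> Y)"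
proof -
  define e where "e = (\<lambda>j. enc (g j))"
  have e: "inj_on e I" using assms(2) by (auto simp: inj_on_def e_def)
  let ?d = "inv_into I e"
  have d: "bij_betw ?d (e ` I) I" using e by (simp add: bij_betw_inv_into inj_on_imp_bij_betw)
  have de: "?d (e j) = j" if "j \<in> I" for j using e that by simp
  have "is_coproduct C (e ` I) (\<lambda>i. X (?d i)) S (\<lambda>i. \<iota> (?d i))"
    using coproduct_reindex[OF d] assms(1) by blast
  hence *: "is_coproduct C (e ` I) (\<lambda>i. Y \<otimes>\<^sub>o X (?d i)) (Y \<otimes>\<^sub>o S) (\<lambda>i. Y \<lhd> \<iota> (?d i))"
    "is_coproduct C (e ` I) (\<lambda>i. X (?d i) \<otimes>\<^sub>o Y) (S \<otimes>\<^sub>o Y) (\<lambda>i. \<iota> (?d i) \<rhd> Y)"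
    using tensor_direct_sums assms(3) unfolding tensor_preserves_direct_sums_def lw_def rw_def
        by blast+
  have b: "bij_betw e I (e ` I)" using e by (simp add: inj_on_imp_bij_betw)
  show "is_coproduct C I (\<lambda>j. Y \<otimes>\<^sub>o X j) (Y \<otimes>\<^sub>o S) (\<lambda>j. Y \<lhd> \<iota> j)"
    by (rule coproduct_cong[OF iffD1[OF coproduct_reindex[OF b] *(1)]]) (simp_all add: de)
  show "is_coproduct C I (\<lambda>j. X j \<otimes>\<^sub>o Y) (S \<otimes>\<^sub>o Y) (\<lambda>j. \<iota> j \<rhd> Y)"
    by (rule coproduct_cong[OF iffD1[OF coproduct_reindex[OF b] *(2)]]) (simp_all add: de)
qed

text \<open>A direct sum of direct sums, obtained in one tensor factor at a time. For
  \<open>TC\<close> it gives the bigrading of the tensor square and, applied again, the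
  decomposition of the cube.\<close>

lemma tensor_coproducts:
  fixes g :: "'j \<Rightarrow> nat" and h :: "'k \<Rightarrow> nat" and X :: "'j \<Rightarrow> 'o" and Y :: "'k \<Rightarrow> 'o"
  assumes S: "is_coproduct C UNIV X S \<iota>" "inj g" and T: "is_coproduct C UNIV Y T \<kappa>" "inj h"
  shows "is_coproduct C UNIV (\<lambda>(a, b). X a \<otimes>\<^sub>o Y b) (S \<otimes>\<^sub>o T) (\<lambda>(a, b). \<iota> a \<otimes>\<^sub>a \<kappa> b)"
proof (rule coproductI)
  note [simp] = coproduct_simps[OF S(1), simplified] coproduct_simps[OF T(1), simplified]
  note A = tensor_coproduct(1)[OF T]
  note B = tensor_coproduct(2)[OF S, of T]
  have \<iota>\<kappa>: "\<iota> a \<otimes>\<^sub>a \<kappa> b = \<iota> a \<rhd> T \<cdot> X a \<lhd> \<kappa> b" for a b by (simp add: tensor_split)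
  fix Z f
  assume Z: "Z \<in> Ob C" and f: "\<And>j. j \<in> UNIV \<Longrightarrow> f j \<in> Hom C (case j of (a, b) \<Rightarrow> X a \<otimes>\<^sub>o Y b) Z"
  have "\<exists>u \<in> Hom C (X a \<otimes>\<^sub>o T) Z. \<forall>b\<in>UNIV. u \<cdot> X a \<lhd> \<kappa> b = f (a, b)" for a
    using Z f[of "(a, _)"] by (intro coproduct_desc[OF A]) simp_all
  hence "\<forall>a. \<exists>u. u \<in> Hom C (X a \<otimes>\<^sub>o T) Z \<and> (\<forall>b\<in>UNIV. u \<cdot> X a \<lhd> \<kappa> b = f (a, b))"
    unfolding Bex_def by (rule allI)
  from choice[OF this] obtain u where u: "\<And>a. u a \<in> Hom C (X a \<otimes>\<^sub>o T) Z"
    "\<And>a b. u a \<cdot> X a \<lhd> \<kappa> b = f (a, b)"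
    by blast
  have "\<exists>v \<in> Hom C (S \<otimes>\<^sub>o T) Z. \<forall>a\<in>UNIV. v \<cdot> \<iota> a \<rhd> T = u a"
    using Z u by (intro coproduct_desc[OF B]) simp_all
  then obtain v where v: "v \<in> Hom C (S \<otimes>\<^sub>o T) Z" "\<And>a. v \<cdot> \<iota> a \<rhd> T = u a" by blast
  have "v \<cdot> (\<iota> a \<otimes>\<^sub>a \<kappa> b) = f (a, b)" for a b
    using v(1) u(1)[of a] u(2)[of a b] compose_reduce[OF v(2)[of a], of "X a \<lhd> \<kappa> b"] by
        (simp add: \<iota>\<kappa>)
  thus "\<exists>h\<in>Hom C (S \<otimes>\<^sub>o T) Z. \<forall>j\<in>UNIV. h \<cdot> (case j of (a, b) \<Rightarrow> \<iota> a \<otimes>\<^sub>a \<kappa> b) = f j"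
    using v(1) by (intro bexI[of _ v]) auto
next
  note [simp] = coproduct_simps[OF S(1), simplified] coproduct_simps[OF T(1), simplified]
  note A = tensor_coproduct(1)[OF T]
  note B = tensor_coproduct(2)[OF S, of T]
  have \<iota>\<kappa>: "\<iota> a \<otimes>\<^sub>a \<kappa> b = \<iota> a \<rhd> T \<cdot> X a \<lhd> \<kappa> b" for a b by (simp add: tensor_split)
  fix f g assume f: "f \<in> Ar C" "g \<in> Ar C" "Dom C f = S \<otimes>\<^sub>o T" "Dom C g = S \<otimes>\<^sub>o T" "Cod C f = Cod C g"
    and eq: "\<And>j. j \<in> UNIV \<Longrightarrow> f \<cdot> (case j of (a, b) \<Rightarrow> \<iota> a \<otimes>\<^sub>a \<kappa> b) = g \<cdot> (case j of
        (a, b) \<Rightarrow> \<iota> a \<otimes>\<^sub>a \<kappa> b)"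
  show "f = g"
  proof (rule coproduct_ext[OF B])
    show "f \<cdot> \<iota> a \<rhd> T = g \<cdot> \<iota> a \<rhd> T" for a
    proof (rule coproduct_ext[OF A])
      show "(f \<cdot> \<iota> a \<rhd> T) \<cdot> X a \<lhd> \<kappa> b = (g \<cdot> \<iota> a \<rhd> T) \<cdot> X a \<lhd> \<kappa> b" for b
        using eq[of "(a, b)"] f by (simp add: \<iota>\<kappa>)
    qed (use f in simp_all)
  qed (use f in simp_all)
qed (use coproduct_simps[OF S(1)] coproduct_simps[OF T(1)] in auto)

end

section \<open>Cotensor powers\<close>

context monoidal_category
begin

text \<open>Identities on a new cotensor power are verified after composing with the whiskered
  inclusion \<open>e\<close>. There \<open>er\<close> replaces the new coaction by that of the last
  factor \<open>N\<close>, where coassociativity is known.\<close>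

lemma right_coaction_coassoc_step:
  assumes [simp]: "A \<in> Ob C" "N \<in> Ob C" "Y \<in> Ob C" "Y' \<in> Ob C"
    and ar: "\<delta> \<in> Hom C A (A \<otimes>\<^sub>o A)" "\<rho> \<in> Hom C N (N \<otimes>\<^sub>o A)" "e \<in> Hom C Y' (Y \<otimes>\<^sub>o N)" "r \<in> Hom C Y'
        (Y' \<otimes>\<^sub>o A)"
    and \<rho>\<rho>: "\<alpha> N A A \<cdot> \<rho> \<rhd> A \<cdot> \<rho> = N \<lhd> \<delta> \<cdot> \<rho>"
    and er: "e \<rhd> A \<cdot> r = \<beta> Y N A \<cdot> Y \<lhd> \<rho> \<cdot> e"
  shows "e \<rhd> (A \<otimes>\<^sub>o A) \<cdot> \<alpha> Y' A A \<cdot> r \<rhd> A \<cdot> r = e \<rhd> (A \<otimes>\<^sub>o A) \<cdot> Y' \<lhd> \<delta> \<cdot> r"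
proof -
  note [simp] = ar[simplified]
  have "e \<rhd> (A \<otimes>\<^sub>o A) \<cdot> \<alpha> Y' A A \<cdot> r \<rhd> A \<cdot> r = \<alpha> (Y \<otimes>\<^sub>o N) A A \<cdot> (e \<rhd> A \<cdot> r) \<rhd> A \<cdot> r"
    by (simp add: whisker_normal)
  also have "\<dots> = \<alpha> (Y \<otimes>\<^sub>o N) A A \<cdot> (\<beta> Y N A \<cdot> Y \<lhd> \<rho> \<cdot> e) \<rhd> A \<cdot> r"
    by (simp only: er)
  also have "\<dots> = \<beta> Y N (A \<otimes>\<^sub>o A) \<cdot> Y \<lhd> (\<alpha> N A A \<cdot> \<rho> \<rhd> A \<cdot> \<rho>) \<cdot> e"
    by (simp add: whisker_normal er)
  also have "\<dots> = \<beta> Y N (A \<otimes>\<^sub>o A) \<cdot> Y \<lhd> (N \<lhd> \<delta> \<cdot> \<rho>) \<cdot> e"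
    by (simp only: \<rho>\<rho>)
  also have "\<dots> = e \<rhd> (A \<otimes>\<^sub>o A) \<cdot> Y' \<lhd> \<delta> \<cdot> r"
    using compose_reduce[OF interchange[of e \<delta> Y' "Y \<otimes>\<^sub>o N" A "A \<otimes>\<^sub>o A"], of r] by
        (simp add: whisker_normal er)
  finally show ?thesis .
qed

lemma right_coaction_counit_step:
  assumes [simp]: "A \<in> Ob C" "N \<in> Ob C" "Y \<in> Ob C" "Y' \<in> Ob C"
    and ar: "\<epsilon> \<in> Hom C A \<I>" "\<rho> \<in> Hom C N (N \<otimes>\<^sub>o A)" "e \<in> Hom C Y' (Y \<otimes>\<^sub>o N)" "r \<in> Hom C Y' (Y' \<otimes>\<^sub>o A)"
    and \<rho>\<rho>: "\<r> N \<cdot> N \<lhd> \<epsilon> \<cdot> \<rho> = \<^bold>1 N"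
    and er: "e \<rhd> A \<cdot> r = \<beta> Y N A \<cdot> Y \<lhd> \<rho> \<cdot> e"
  shows "e \<cdot> \<r> Y' \<cdot> Y' \<lhd> \<epsilon> \<cdot> r = e"
proof -
  note [simp] = ar[simplified]
  have "e \<cdot> \<r> Y' \<cdot> Y' \<lhd> \<epsilon> \<cdot> r = \<r> (Y \<otimes>\<^sub>o N) \<cdot> e \<rhd> \<I> \<cdot> Y' \<lhd> \<epsilon> \<cdot> r"
    using compose_reduce[OF unitor_natural(2)[of e], of "Y' \<lhd> \<epsilon> \<cdot> r"] by simp
  also have "\<dots> = \<r> (Y \<otimes>\<^sub>o N) \<cdot> (Y \<otimes>\<^sub>o N) \<lhd> \<epsilon> \<cdot> e \<rhd> A \<cdot> r"
    using compose_reduce[OF interchange[of e \<epsilon> Y' "Y \<otimes>\<^sub>o N" A \<I>], of r] by simp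
  also have "\<dots> = Y \<lhd> (\<r> N \<cdot> N \<lhd> \<epsilon> \<cdot> \<rho>) \<cdot> e"
    by (simp add: er whisker_normal right_unitor_lw)
  finally show ?thesis by (simp add: \<rho>\<rho>)
qed

lemma left_coaction_counit_step:
  assumes [simp]: "A \<in> Ob C" "N \<in> Ob C" "Y \<in> Ob C" "Y' \<in> Ob C"
    and ar: "\<epsilon> \<in> Hom C A \<I>" "l \<in> Hom C Y (A \<otimes>\<^sub>o Y)" "e \<in> Hom C Y' (Y \<otimes>\<^sub>o N)" "l' \<in> Hom C Y' (A \<otimes>\<^sub>o Y')"
    and ll: "\<l> Y \<cdot> \<epsilon> \<rhd> Y \<cdot> l = \<^bold>1 Y"
    and el: "A \<lhd> e \<cdot> l' = \<alpha> A Y N \<cdot> l \<rhd> N \<cdot> e"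
  shows "e \<cdot> \<l> Y' \<cdot> \<epsilon> \<rhd> Y' \<cdot> l' = e"
proof -
  note [simp] = ar[simplified]
  have "e \<cdot> \<l> Y' \<cdot> \<epsilon> \<rhd> Y' \<cdot> l' = \<l> (Y \<otimes>\<^sub>o N) \<cdot> \<I> \<lhd> e \<cdot> \<epsilon> \<rhd> Y' \<cdot> l'"
    using compose_reduce[OF unitor_natural(1)[of e], of "\<epsilon> \<rhd> Y' \<cdot> l'"] by simp
  also have "\<dots> = \<l> (Y \<otimes>\<^sub>o N) \<cdot> \<epsilon> \<rhd> (Y \<otimes>\<^sub>o N) \<cdot> A \<lhd> e \<cdot> l'"
    using compose_reduce[OF interchange[of \<epsilon> e A \<I> Y' "Y \<otimes>\<^sub>o N", symmetric], of l'] by simp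
  also have "\<dots> = (\<l> Y \<cdot> \<epsilon> \<rhd> Y \<cdot> l) \<rhd> N \<cdot> e"
    by (simp add: el whisker_normal left_unitor_rw)
  finally show ?thesis by (simp add: ll)
qed

text \<open>Serves two purposes. With left coactions for \<open>d\<close> and \<open>d'\<close> it
  gives the commutation of the two coactions on a power; with components for \<open>d\<close> and
  \<open>d'\<close> it gives the right colinearity of the next component.\<close>

lemma coaction_compat_step:
  assumes [simp]: "A \<in> Ob C" "N \<in> Ob C" "X \<in> Ob C" "Y \<in> Ob C" "Y' \<in> Ob C" "W \<in> Ob C" "W' \<in> Ob C"
    and ar: "d \<in> Hom C W (X \<otimes>\<^sub>o Y)" "d' \<in> Hom C W' (X \<otimes>\<^sub>o Y')" "\<rho> \<in> Hom C N (N \<otimes>\<^sub>o A)"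
      "e \<in> Hom C Y' (Y \<otimes>\<^sub>o N)" "r \<in> Hom C Y' (Y' \<otimes>\<^sub>o A)"
      "e' \<in> Hom C W' (W \<otimes>\<^sub>o N)" "r' \<in> Hom C W' (W' \<otimes>\<^sub>o A)"
    and ed: "X \<lhd> e \<cdot> d' = \<alpha> X Y N \<cdot> d \<rhd> N \<cdot> e'"
    and er: "e \<rhd> A \<cdot> r = \<beta> Y N A \<cdot> Y \<lhd> \<rho> \<cdot> e"
    and er': "e' \<rhd> A \<cdot> r' = \<beta> W N A \<cdot> W \<lhd> \<rho> \<cdot> e'"
  shows "X \<lhd> (e \<rhd> A) \<cdot> \<alpha> X Y' A \<cdot> d' \<rhd> A \<cdot> r' = X \<lhd> (e \<rhd> A) \<cdot> X \<lhd> r \<cdot> d'"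
proof -
  note [simp] = ar[simplified]
  have "X \<lhd> (e \<rhd> A) \<cdot> \<alpha> X Y' A \<cdot> d' \<rhd> A \<cdot> r' = \<alpha> X (Y \<otimes>\<^sub>o N) A \<cdot> (X \<lhd> e \<cdot> d') \<rhd> A \<cdot> r'"
    by (simp add: whisker_normal)
  also have "\<dots> = \<alpha> X (Y \<otimes>\<^sub>o N) A \<cdot> (\<alpha> X Y N \<cdot> d \<rhd> N \<cdot> e') \<rhd> A \<cdot> r'"
    by (simp only: ed)
  also have "\<dots> = X \<lhd> \<beta> Y N A \<cdot> \<alpha> X Y (N \<otimes>\<^sub>o A) \<cdot> d \<rhd> (N \<otimes>\<^sub>o A) \<cdot> W \<lhd> \<rho> \<cdot> e'"
    by (simp add: whisker_normal er')
  also have "\<dots> = X \<lhd> \<beta> Y N A \<cdot> X \<lhd> (Y \<lhd> \<rho>) \<cdot> (\<alpha> X Y N \<cdot> d \<rhd> N \<cdot> e')"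
    using compose_reduce[OF interchange[of d \<rho> W "X \<otimes>\<^sub>o Y" N "N \<otimes>\<^sub>o A"], of e'] by
        (simp add: whisker_normal)
  also have "\<dots> = X \<lhd> (\<beta> Y N A \<cdot> Y \<lhd> \<rho> \<cdot> e) \<cdot> d'"
    by (subst ed[symmetric]) (simp add: whisker_normal)
  also have "\<dots> = X \<lhd> (e \<rhd> A \<cdot> r) \<cdot> d'"
    by (simp only: er)
  finally show ?thesis by (simp add: whisker_normal)
qed

text \<open>Because the two coactions on \<open>N\<close> commute, the right coaction of
  \<open>N\<close> preserves the equalizer condition; the resulting factorization is the right
  coaction of the cotensor power.\<close>

lemma cotensor_right_coaction_lift:
  assumes [simp]: "A \<in> Ob C" "N \<in> Ob C" "Y \<in> Ob C" "Y' \<in> Ob C"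
    and ar: "\<rho> \<in> Hom C N (N \<otimes>\<^sub>o A)" "\<tau> \<in> Hom C N (A \<otimes>\<^sub>o N)" "e \<in> Hom C Y' (Y \<otimes>\<^sub>o N)" "r \<in> Hom C Y
        (Y \<otimes>\<^sub>o A)"
    and \<tau>\<rho>: "\<alpha> A N A \<cdot> \<tau> \<rhd> A \<cdot> \<rho> = A \<lhd> \<rho> \<cdot> \<tau>"
    and eq: "\<alpha> Y A N \<cdot> r \<rhd> N \<cdot> e = Y \<lhd> \<tau> \<cdot> e"
  shows "(\<alpha> Y A N \<cdot> r \<rhd> N) \<rhd> A \<cdot> \<beta> Y N A \<cdot> Y \<lhd> \<rho> \<cdot> e = (Y \<lhd> \<tau>) \<rhd> A \<cdot> \<beta> Y N A \<cdot> Y \<lhd> \<rho> \<cdot> e"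
proof -
  note [simp] = ar[simplified]
  have "(\<alpha> Y A N \<cdot> r \<rhd> N) \<rhd> A \<cdot> \<beta> Y N A \<cdot> Y \<lhd> \<rho> \<cdot> e
    = \<beta> Y (A \<otimes>\<^sub>o N) A \<cdot> Y \<lhd> \<beta> A N A \<cdot> \<alpha> Y A (N \<otimes>\<^sub>o A) \<cdot> r \<rhd> (N \<otimes>\<^sub>o A) \<cdot> Y \<lhd> \<rho> \<cdot> e"
    by (simp add: whisker_normal)
  also have "\<dots> = \<beta> Y (A \<otimes>\<^sub>o N) A \<cdot> Y \<lhd> \<beta> A N A \<cdot> Y \<lhd> (A \<lhd> \<rho>) \<cdot> (\<alpha> Y A N \<cdot> r \<rhd> N \<cdot> e)"
    using compose_reduce[OF interchange[of r \<rho> Y "Y \<otimes>\<^sub>o A" N "N \<otimes>\<^sub>o A"], of e] by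
        (simp add: whisker_normal)
  also have "\<dots> = \<beta> Y (A \<otimes>\<^sub>o N) A \<cdot> Y \<lhd> (\<beta> A N A \<cdot> (A \<lhd> \<rho> \<cdot> \<tau>)) \<cdot> e"
    by (simp add: eq whisker_normal)
  also have "\<dots> = \<beta> Y (A \<otimes>\<^sub>o N) A \<cdot> Y \<lhd> (\<beta> A N A \<cdot> (\<alpha> A N A \<cdot> \<tau> \<rhd> A \<cdot> \<rho>)) \<cdot> e"
    by (simp only: \<tau>\<rho>)
  also have "\<dots> = (Y \<lhd> \<tau>) \<rhd> A \<cdot> \<beta> Y N A \<cdot> Y \<lhd> \<rho> \<cdot> e"
    by (simp add: whisker_normal)
  finally show ?thesis .
qed

text \<open>Right colinearity \<open>dr\<close> turns the equalizer condition on \<open>W'\<close>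
  into the one on \<open>Y\<close>. The factorization is the left coaction of a power if
  \<open>d\<close> is a left coaction, and the next component if \<open>d\<close> is a
  component.\<close>

lemma cotensor_component_lift:
  assumes [simp]: "A \<in> Ob C" "N \<in> Ob C" "X \<in> Ob C" "Y \<in> Ob C" "W \<in> Ob C" "W' \<in> Ob C"
    and ar: "\<tau> \<in> Hom C N (A \<otimes>\<^sub>o N)" "d \<in> Hom C W (X \<otimes>\<^sub>o Y)" "r \<in> Hom C Y (Y \<otimes>\<^sub>o A)"
      "r' \<in> Hom C W (W \<otimes>\<^sub>o A)" "e' \<in> Hom C W' (W \<otimes>\<^sub>o N)"
    and dr: "\<alpha> X Y A \<cdot> d \<rhd> A \<cdot> r' = X \<lhd> r \<cdot> d"
    and eq: "\<alpha> W A N \<cdot> r' \<rhd> N \<cdot> e' = W \<lhd> \<tau> \<cdot> e'"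
  shows "X \<lhd> (\<alpha> Y A N \<cdot> r \<rhd> N) \<cdot> \<alpha> X Y N \<cdot> d \<rhd> N \<cdot> e' = X \<lhd> (Y \<lhd> \<tau>) \<cdot> \<alpha> X Y N \<cdot> d \<rhd> N \<cdot> e'"
proof -
  note [simp] = ar[simplified]
  have "X \<lhd> (\<alpha> Y A N \<cdot> r \<rhd> N) \<cdot> \<alpha> X Y N \<cdot> d \<rhd> N \<cdot> e'
    = X \<lhd> \<alpha> Y A N \<cdot> \<alpha> X (Y \<otimes>\<^sub>o A) N \<cdot> (X \<lhd> r \<cdot> d) \<rhd> N \<cdot> e'"
    by (simp add: whisker_normal)
  also have "\<dots> = X \<lhd> \<alpha> Y A N \<cdot> \<alpha> X (Y \<otimes>\<^sub>o A) N \<cdot> (\<alpha> X Y A \<cdot> d \<rhd> A \<cdot> r') \<rhd> N \<cdot> e'"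
    by (simp only: dr)
  also have "\<dots> = \<alpha> X Y (A \<otimes>\<^sub>o N) \<cdot> d \<rhd> (A \<otimes>\<^sub>o N) \<cdot> W \<lhd> \<tau> \<cdot> e'"
    by (simp add: whisker_normal eq)
  also have "\<dots> = X \<lhd> (Y \<lhd> \<tau>) \<cdot> \<alpha> X Y N \<cdot> d \<rhd> N \<cdot> e'"
    using compose_reduce[OF interchange[of d \<tau> W "X \<otimes>\<^sub>o Y" N "A \<otimes>\<^sub>o N"], of e'] by
        (simp add: whisker_normal)
  finally show ?thesis .
qed

text \<open>The relations \<open>h2\<close>, \<open>h3\<close>, \<open>h4\<close> are instances of
  one recursion of the components in their last index; they carry \<open>IH\<close> one factor
  \<open>N\<close> further.\<close>

lemma component_coassoc_step:
  assumes [simp]: "N \<in> Ob C" "X \<in> Ob C" "Y \<in> Ob C" "Z \<in> Ob C" "Z' \<in> Ob C" "P \<in> Ob C" "Q \<in> Ob C"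
      "Q' \<in> Ob C"
      "U \<in> Ob C" "U' \<in> Ob C"
    and ar: "d1 \<in> Hom C P (X \<otimes>\<^sub>o Y)" "d2 \<in> Hom C Q (Y \<otimes>\<^sub>o Z)" "d2' \<in> Hom C Q' (Y \<otimes>\<^sub>o Z')"
      "d3 \<in> Hom C U (X \<otimes>\<^sub>o Q)" "d3' \<in> Hom C U' (X \<otimes>\<^sub>o Q')" "d4 \<in> Hom C U (P \<otimes>\<^sub>o Z)" "d4' \<in> Hom C U'
          (P \<otimes>\<^sub>o Z')"
      "e \<in> Hom C Z' (Z \<otimes>\<^sub>o N)" "eQ \<in> Hom C Q' (Q \<otimes>\<^sub>o N)" "eU \<in> Hom C U' (U \<otimes>\<^sub>o N)"
    and IH: "\<alpha> X Y Z \<cdot> d1 \<rhd> Z \<cdot> d4 = X \<lhd> d2 \<cdot> d3"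
    and h2: "Y \<lhd> e \<cdot> d2' = \<alpha> Y Z N \<cdot> d2 \<rhd> N \<cdot> eQ"
    and h3: "X \<lhd> eQ \<cdot> d3' = \<alpha> X Q N \<cdot> d3 \<rhd> N \<cdot> eU"
    and h4: "P \<lhd> e \<cdot> d4' = \<alpha> P Z N \<cdot> d4 \<rhd> N \<cdot> eU"
  shows "X \<lhd> (Y \<lhd> e) \<cdot> \<alpha> X Y Z' \<cdot> d1 \<rhd> Z' \<cdot> d4' = X \<lhd> (Y \<lhd> e) \<cdot> X \<lhd> d2' \<cdot> d3'"
proof -
  note [simp] = ar[simplified]
  have "X \<lhd> (Y \<lhd> e) \<cdot> \<alpha> X Y Z' \<cdot> d1 \<rhd> Z' \<cdot> d4' = \<alpha> X Y (Z \<otimes>\<^sub>o N) \<cdot> d1 \<rhd> (Z \<otimes>\<^sub>o N) \<cdot> P \<lhd> e \<cdot> d4'"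
    using compose_reduce[OF interchange[of d1 e P "X \<otimes>\<^sub>o Y" Z' "Z \<otimes>\<^sub>o N"], of d4'] by
        (simp add: whisker_normal)
  also have "\<dots> = X \<lhd> \<alpha> Y Z N \<cdot> \<alpha> X (Y \<otimes>\<^sub>o Z) N \<cdot> (\<alpha> X Y Z \<cdot> d1 \<rhd> Z \<cdot> d4) \<rhd> N \<cdot> eU"
    by (simp add: whisker_normal h4)
  also have "\<dots> = X \<lhd> \<alpha> Y Z N \<cdot> \<alpha> X (Y \<otimes>\<^sub>o Z) N \<cdot> (X \<lhd> d2 \<cdot> d3) \<rhd> N \<cdot> eU"
    by (simp only: IH)
  also have "\<dots> = X \<lhd> \<alpha> Y Z N \<cdot> X \<lhd> (d2 \<rhd> N) \<cdot> (\<alpha> X Q N \<cdot> d3 \<rhd> N \<cdot> eU)"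
    by (simp add: whisker_normal)
  also have "\<dots> = X \<lhd> (\<alpha> Y Z N \<cdot> d2 \<rhd> N \<cdot> eQ) \<cdot> d3'"
    by (subst h3[symmetric]) (simp add: whisker_normal)
  also have "\<dots> = X \<lhd> (Y \<lhd> e \<cdot> d2') \<cdot> d3'"
    by (simp only: h2)
  finally show ?thesis by (simp add: whisker_normal)
qed

text \<open>Convolution with values in different objects is associative up to
  \<open>\<alpha>\<close>. The lift constructed later is a convolution nested to the left, and this
  rebrackets it.\<close>

lemma convolution_assoc:
  assumes [simp]: "B \<in> Ob C"
    and ar: "\<delta> \<in> Hom C B (B \<otimes>\<^sub>o B)" "f \<in> Ar C" "g \<in> Ar C" "h \<in> Ar C" "Dom C f = B" "Dom C g = B"
        "Dom C h = B"
    and \<delta>: "\<alpha> B B B \<cdot> \<delta> \<rhd> B \<cdot> \<delta> = B \<lhd> \<delta> \<cdot> \<delta>"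
  shows "\<alpha> (Cod C f) (Cod C g) (Cod C h) \<cdot> (((f \<otimes>\<^sub>a g) \<cdot> \<delta>) \<otimes>\<^sub>a h) \<cdot> \<delta> = (f \<otimes>\<^sub>a ((g \<otimes>\<^sub>a h) \<cdot> \<delta>)) \<cdot> \<delta>"
proof -
  note [simp] = ar[simplified]
  have "\<alpha> (Cod C f) (Cod C g) (Cod C h) \<cdot> (((f \<otimes>\<^sub>a g) \<cdot> \<delta>) \<otimes>\<^sub>a h) \<cdot> \<delta>
    = \<alpha> (Cod C f) (Cod C g) (Cod C h) \<cdot> ((f \<otimes>\<^sub>a g) \<otimes>\<^sub>a h) \<cdot> \<delta> \<rhd> B \<cdot> \<delta>"
    using compose_reduce[OF compose_tensor[of \<delta> "f \<otimes>\<^sub>a g" "\<^bold>1 B" h], of \<delta>] by (simp add: rw_def)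
  also have "\<dots> = (f \<otimes>\<^sub>a (g \<otimes>\<^sub>a h)) \<cdot> \<alpha> B B B \<cdot> \<delta> \<rhd> B \<cdot> \<delta>"
    using compose_reduce[OF assoc_nat_ar[of f g h], of "\<delta> \<rhd> B \<cdot> \<delta>"] by simp
  also have "\<dots> = (f \<otimes>\<^sub>a (g \<otimes>\<^sub>a h)) \<cdot> B \<lhd> \<delta> \<cdot> \<delta>" by (simp only: \<delta>)
  also have "\<dots> = (f \<otimes>\<^sub>a ((g \<otimes>\<^sub>a h) \<cdot> \<delta>)) \<cdot> \<delta>"
    using compose_reduce[OF compose_tensor[of "\<^bold>1 B" f \<delta> "g \<otimes>\<^sub>a h"], of \<delta>] by (simp add: lw_def)
  finally show ?thesis .
qed

end

section \<open>The tower of cotensor powers\<close>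

locale cotensor_tower = ab5_braided_category C enc
  for C :: "('o, 'a, 'z) braided_category_scheme" (structure) and enc :: "nat \<Rightarrow> 'i" +
  fixes H :: "('o, 'a, 'y) coalgebra_scheme" and M :: "('o, 'a, 'x) bicomodule_scheme"
  assumes bicomodule: "is_bicomodule C H M"
begin

abbreviation HO :: 'o where "HO \<equiv> carr H"
abbreviation N :: 'o where "N \<equiv> bic_ob M"
abbreviation T :: "nat \<Rightarrow> 'o" where "T \<equiv> cotensor_power_ob C H M"
abbreviation R :: "nat \<Rightarrow> 'a" where "R n \<equiv> rcoact (cotensor_power C H M n)"
abbreviation L :: "nat \<Rightarrow> 'a" where "L n \<equiv> lcoact (cotensor_power C H M n)"
abbreviation D :: "nat \<Rightarrow> nat \<Rightarrow> 'a" where "D \<equiv> Tc_component C H M"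

text \<open>With the left coaction of \<open>M\<close> as \<open>E 0\<close>, every power, the first one included, is an equalizer
  \<open>E n : T (n + 1) \<rightarrow> T n \<otimes> M\<close>, and the components satisfy one recursion in all degrees.\<close>

definition E :: "nat \<Rightarrow> 'a" where
  "E n = (if n = 0 then lcoact M else cotensor_incl C H (cotensor_power C H M n) M)"

lemma coalgebra_H: "is_coalgebra C H"
  using bicomodule by (simp add: is_bicomodule_def Let_def)

lemma H_simps [simp]:
  "HO \<in> Ob C" "comul H \<in> Ar C" "Dom C (comul H) = HO" "Cod C (comul H) = HO \<otimes>\<^sub>o HO"
  "counit H \<in> Ar C" "Dom C (counit H) = HO" "Cod C (counit H) = \<I>"
  using coalgebra_H by (simp_all add: is_coalgebra_def Let_def)

lemma H_coalgebra:
  "\<alpha> HO HO HO \<cdot> comul H \<rhd> HO \<cdot> comul H = HO \<lhd> comul H \<cdot> comul H"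
  "\<l> HO \<cdot> counit H \<rhd> HO \<cdot> comul H = \<^bold>1 HO"
  "\<r> HO \<cdot> HO \<lhd> counit H \<cdot> comul H = \<^bold>1 HO"
  using coalgebra_H by (simp_all add: is_coalgebra_def Let_def lw_def rw_def)

lemma M_simps [simp]:
  "N \<in> Ob C" "rcoact M \<in> Ar C" "Dom C (rcoact M) = N" "Cod C (rcoact M) = N \<otimes>\<^sub>o HO"
  "lcoact M \<in> Ar C" "Dom C (lcoact M) = N" "Cod C (lcoact M) = HO \<otimes>\<^sub>o N"
  using bicomodule by (simp_all add: is_bicomodule_def Let_def)

lemma M_bicomodule:
  "\<alpha> HO HO N \<cdot> comul H \<rhd> N \<cdot> lcoact M = HO \<lhd> lcoact M \<cdot> lcoact M"
  "\<l> N \<cdot> counit H \<rhd> N \<cdot> lcoact M = \<^bold>1 N"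
  "\<alpha> N HO HO \<cdot> rcoact M \<rhd> HO \<cdot> rcoact M = N \<lhd> comul H \<cdot> rcoact M"
  "\<r> N \<cdot> N \<lhd> counit H \<cdot> rcoact M = \<^bold>1 N"
  "\<alpha> HO N HO \<cdot> lcoact M \<rhd> HO \<cdot> rcoact M = HO \<lhd> rcoact M \<cdot> lcoact M"
  using bicomodule by (simp_all add: is_bicomodule_def Let_def lw_def rw_def)

lemma power_simps:
  "T 0 = HO" "R 0 = comul H" "L 0 = comul H" "T (Suc 0) = N" "R (Suc 0) = rcoact M" "L (Suc 0)
      = lcoact M"
  by (simp_all add: cotensor_power_ob_def bicomodule.defs)

lemma power_Suc:
  assumes "n > 0"
  shows "T (Suc n) = Dom C (E n)"
    "R (Suc n) = (THE r. r \<in> Hom C (Dom C (E n)) (Dom C (E n) \<otimes>\<^sub>o HO)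
       \<and> E n \<rhd> HO \<cdot> r = \<beta> (T n) N HO \<cdot> T n \<lhd> rcoact M \<cdot> E n)"
    "L (Suc n) = (THE l. l \<in> Hom C (Dom C (E n)) (HO \<otimes>\<^sub>o Dom C (E n))
       \<and> HO \<lhd> E n \<cdot> l = \<alpha> HO (T n) N \<cdot> L n \<rhd> N \<cdot> E n)"
  using assms by (simp_all add: cotensor_power_ob_def E_def cotensor_def Let_def lw_def rw_def)

declare cotensor_power.simps [simp del]

lemma E_pos:
  assumes "n > 0"
  shows "E n = equalizer C (\<alpha> (T n) HO N \<cdot> R n \<rhd> N) (T n \<lhd> lcoact M)"
  using assms by (simp add: E_def cotensor_incl_def cotensor_power_ob_def lw_def rw_def)

text \<open>The counit contracts this fork: the factorization of \<open>x\<close> is obtained by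
  applying the counit to its first tensor factor. It expresses that \<open>M\<close> is its own
  cotensor product with \<open>H\<close>.\<close>

lemma left_coaction_equalizer:
  "is_equalizer C (\<alpha> HO HO N \<cdot> comul H \<rhd> N) (HO \<lhd> lcoact M) (lcoact M)"
  unfolding is_equalizer_def
proof (intro conjI allI ballI impI)
  fix X x assume x: "x \<in> Hom C X (Dom C (\<alpha> HO HO N \<cdot> comul H \<rhd> N))"
    and eq: "(\<alpha> HO HO N \<cdot> comul H \<rhd> N) \<cdot> x = HO \<lhd> lcoact M \<cdot> x"
  hence x': "x \<in> Ar C" "Dom C x = X" "Cod C x = HO \<otimes>\<^sub>o N" by simp_all
  have X: "X \<in> Ob C" using x' Dom_Ob[of x] by simp
  define h where "h = \<l> N \<cdot> counit H \<rhd> N \<cdot> x"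
  have h: "h \<in> Hom C X N" using x' by (simp add: h_def)
  have mono: "k = \<l> N \<cdot> counit H \<rhd> N \<cdot> (lcoact M \<cdot> k)" if "k \<in> Hom C X N" for k
    using compose_reduce[OF M_bicomodule(2), of k] that by simp
  have "lcoact M \<cdot> h = \<l> (HO \<otimes>\<^sub>o N) \<cdot> \<I> \<lhd> lcoact M \<cdot> counit H \<rhd> N \<cdot> x"
    using compose_reduce[OF unitor_natural(1)[of "lcoact M"], of "counit H \<rhd> N \<cdot> x"] x' by
        (simp add: h_def)
  also have "\<dots> = \<l> (HO \<otimes>\<^sub>o N) \<cdot> counit H \<rhd> (HO \<otimes>\<^sub>o N) \<cdot> (HO \<lhd> lcoact M \<cdot> x)"
    using compose_reduce[OF interchange[of "counit H" "lcoact M" HO \<I> N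
        "HO \<otimes>\<^sub>o N", symmetric], of x] x' by simp
  also have "\<dots> = (\<l> HO \<cdot> counit H \<rhd> HO \<cdot> comul H) \<rhd> N \<cdot> x"
    using x' by (simp add: eq[symmetric] whisker_normal left_unitor_rw)
  also have "\<dots> = x" using x' by (simp add: H_coalgebra)
  finally have hx: "lcoact M \<cdot> h = x" .
  show "\<exists>!h. h \<in> Hom C X (Dom C (lcoact M)) \<and> lcoact M \<cdot> h = x"
  proof (rule ex1I)
    show "h \<in> Hom C X (Dom C (lcoact M)) \<and> lcoact M \<cdot> h = x" using h hx by simp
    fix k assume k: "k \<in> Hom C X (Dom C (lcoact M)) \<and> lcoact M \<cdot> k = x"
    have "k = \<l> N \<cdot> counit H \<rhd> N \<cdot> (lcoact M \<cdot> k)" by (rule mono) (use k in simp)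
    also have "lcoact M \<cdot> k = x" using k ..
    finally show "k = h" by (simp only: h_def)
  qed
qed (simp_all add: M_bicomodule)

definition tower :: "nat \<Rightarrow> bool" where
  "tower n \<longleftrightarrow> T n \<in> Ob C \<and> R n \<in> Hom C (T n) (T n \<otimes>\<^sub>o HO) \<and> L n \<in> Hom C (T n) (HO \<otimes>\<^sub>o T n)
     \<and> \<alpha> (T n) HO HO \<cdot> R n \<rhd> HO \<cdot> R n = T n \<lhd> comul H \<cdot> R n
     \<and> \<r> (T n) \<cdot> T n \<lhd> counit H \<cdot> R n = \<^bold>1 (T n)
     \<and> \<l> (T n) \<cdot> counit H \<rhd> T n \<cdot> L n = \<^bold>1 (T n)
     \<and> \<alpha> HO (T n) HO \<cdot> L n \<rhd> HO \<cdot> R n = HO \<lhd> R n \<cdot> L n"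

text \<open>Kept apart from \<open>tower\<close> because the passage from 0 to 1 has its own proof:
  the first power is \<open>M\<close> by definition and becomes an equalizer only through
  \<open>left_coaction_equalizer\<close>.\<close>

definition tower_step :: "nat \<Rightarrow> bool" where
  "tower_step n \<longleftrightarrow> is_equalizer C (\<alpha> (T n) HO N \<cdot> R n \<rhd> N) (T n \<lhd> lcoact M) (E n)
     \<and> E n \<in> Hom C (T (Suc n)) (T n \<otimes>\<^sub>o N)
     \<and> R (Suc n) \<in> Hom C (T (Suc n)) (T (Suc n) \<otimes>\<^sub>o HO)
     \<and> L (Suc n) \<in> Hom C (T (Suc n)) (HO \<otimes>\<^sub>o T (Suc n))
     \<and> E n \<rhd> HO \<cdot> R (Suc n) = \<beta> (T n) N HO \<cdot> T n \<lhd> rcoact M \<cdot> E n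
     \<and> HO \<lhd> E n \<cdot> L (Suc n) = \<alpha> HO (T n) N \<cdot> L n \<rhd> N \<cdot> E n"

lemma equalizer_factor:
  assumes "is_equalizer C f g e" "x \<in> Hom C X (Dom C f)" "f \<cdot> x = g \<cdot> x"
  shows "(THE h. h \<in> Hom C X (Dom C e) \<and> e \<cdot> h = x) \<in> Hom C X (Dom C e)"
    "e \<cdot> (THE h. h \<in> Hom C X (Dom C e) \<and> e \<cdot> h = x) = x"
  using theI'[OF equalizer_univ[OF assms]] by blast+

lemma tower_step_0: "tower 0 \<and> tower (Suc 0) \<and> tower_step 0"
  unfolding tower_def tower_step_def
  using left_coaction_equalizer
  by (simp add: power_simps H_coalgebra M_bicomodule E_def inv_pair_cancel flip: M_bicomodule(5))

text \<open>The coactions on a power are defined as unique factorizations. They exist since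
  \<open>E n\<close> stays an equalizer after tensoring with the coalgebra on either side.\<close>

lemma tower_step_pos:
  assumes "tower n" "n > 0"
  shows "tower_step n"
proof -
  note [simp] = conjunct1[OF assms(1)[unfolded tower_def]]
  note t = assms(1)[unfolded tower_def, THEN conjunct2]
  have rl [simp]: "R n \<in> Ar C" "Dom C (R n) = T n" "Cod C (R n) = T n \<otimes>\<^sub>o HO"
    "L n \<in> Ar C" "Dom C (L n) = T n" "Cod C (L n) = HO \<otimes>\<^sub>o T n" using t by simp_all
  have eq: "is_equalizer C (\<alpha> (T n) HO N \<cdot> R n \<rhd> N) (T n \<lhd> lcoact M) (E n)"
    unfolding E_pos[OF assms(2)] by (rule equalizer_exists) simp_all
  have E [simp]: "E n \<in> Ar C" "Cod C (E n) = T n \<otimes>\<^sub>o N"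
    using eq by (simp_all add: is_equalizer_def)
  have "(\<alpha> (T n) HO N \<cdot> R n \<rhd> N) \<cdot> E n = T n \<lhd> lcoact M \<cdot> E n"
    using eq unfolding is_equalizer_def by (elim conjE)
  hence Ee: "\<alpha> (T n) HO N \<cdot> R n \<rhd> N \<cdot> E n = T n \<lhd> lcoact M \<cdot> E n"
    by simp
  note [simp] = power_Suc(1)[OF assms(2)]
  have e1: "(\<alpha> (T n) HO N \<cdot> R n \<rhd> N) \<rhd> HO \<cdot> \<beta> (T n) N HO \<cdot> T n \<lhd> rcoact M \<cdot> E n
    = (T n \<lhd> lcoact M) \<rhd> HO \<cdot> \<beta> (T n) N HO \<cdot> T n \<lhd> rcoact M \<cdot> E n"
    by (rule cotensor_right_coaction_lift) (simp_all add: M_bicomodule Ee)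
  have "R (Suc n) \<in> Hom C (T (Suc n)) (T (Suc n) \<otimes>\<^sub>o HO)
    \<and> E n \<rhd> HO \<cdot> R (Suc n) = \<beta> (T n) N HO \<cdot> T n \<lhd> rcoact M \<cdot> E n"
    using equalizer_factor[OF tensor_equalizer(2)[OF eq, of HO] _ e1, of "Dom C (E n)"]
    by (simp add: power_Suc[OF assms(2)])
  moreover have e2: "HO \<lhd> (\<alpha> (T n) HO N \<cdot> R n \<rhd> N) \<cdot> \<alpha> HO (T n) N \<cdot> L n \<rhd> N \<cdot> E n
    = HO \<lhd> (T n \<lhd> lcoact M) \<cdot> \<alpha> HO (T n) N \<cdot> L n \<rhd> N \<cdot> E n"
    by (rule cotensor_component_lift[of HO N HO "T n" "T n" "Dom C (E n)" _ _ _ "R n"])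
      (use t in \<open>simp_all add: Ee\<close>)
  have "L (Suc n) \<in> Hom C (T (Suc n)) (HO \<otimes>\<^sub>o T (Suc n))
    \<and> HO \<lhd> E n \<cdot> L (Suc n) = \<alpha> HO (T n) N \<cdot> L n \<rhd> N \<cdot> E n"
    using equalizer_factor[OF tensor_equalizer(1)[OF eq, of HO] _ e2, of "Dom C (E n)"]
    by (simp add: power_Suc[OF assms(2)])
  ultimately show ?thesis using eq by (simp add: tower_step_def)
qed

lemma tower_Suc:
  assumes "tower n" "tower_step n"
  shows "tower (Suc n)"
proof -
  note t = assms(1)[unfolded tower_def] and s = assms(2)[unfolded tower_step_def]
  have eq: "is_equalizer C (\<alpha> (T n) HO N \<cdot> R n \<rhd> N) (T n \<lhd> lcoact M) (E n)" using s by blast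
  have [simp]: "T n \<in> Ob C" "R n \<in> Ar C" "Dom C (R n) = T n" "Cod C (R n) = T n \<otimes>\<^sub>o HO"
    "L n \<in> Ar C" "Dom C (L n) = T n" "Cod C (L n) = HO \<otimes>\<^sub>o T n"
    "E n \<in> Ar C" "Dom C (E n) = T (Suc n)" "Cod C (E n) = T n \<otimes>\<^sub>o N"
    "R (Suc n) \<in> Ar C" "Dom C (R (Suc n)) = T (Suc n)" "Cod C (R (Suc n)) = T (Suc n) \<otimes>\<^sub>o HO"
    "L (Suc n) \<in> Ar C" "Dom C (L (Suc n)) = T (Suc n)" "Cod C (L (Suc n)) = HO \<otimes>\<^sub>o T (Suc n)"
    using t s by simp_all
  have [simp]: "T (Suc n) \<in> Ob C" using Dom_Ob[of "E n"] by simp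
  have E: "E n \<rhd> HO \<cdot> R (Suc n) = \<beta> (T n) N HO \<cdot> T n \<lhd> rcoact M \<cdot> E n"
     "HO \<lhd> E n \<cdot> L (Suc n) = \<alpha> HO (T n) N \<cdot> L n \<rhd> N \<cdot> E n"
    using s by blast+
  have "\<alpha> (T (Suc n)) HO HO \<cdot> R (Suc n) \<rhd> HO \<cdot> R (Suc n) = T (Suc n) \<lhd> comul H \<cdot> R (Suc n)"
    by (rule equalizer_monic[OF tensor_equalizer(2)[OF eq, of "HO \<otimes>\<^sub>o HO"]])
      (simp_all add: right_coaction_coassoc_step[OF _ _ _ _ _ _ _ _ M_bicomodule(3) E(1)])
  moreover have "\<r> (T (Suc n)) \<cdot> T (Suc n) \<lhd> counit H \<cdot> R (Suc n) = \<^bold>1 (T (Suc n))"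
    by (rule equalizer_monic[OF eq])
      (simp_all add: right_coaction_counit_step[OF _ _ _ _ _ _ _ _ M_bicomodule(4) E(1)])
  moreover have "\<l> (T (Suc n)) \<cdot> counit H \<rhd> T (Suc n) \<cdot> L (Suc n) = \<^bold>1 (T (Suc n))"
    by (rule equalizer_monic[OF eq])
      (use t in \<open>simp_all add: left_coaction_counit_step[OF _ _ _ _ _ _ _ _ _ E(2)]\<close>)
  moreover have "\<alpha> HO (T (Suc n)) HO \<cdot> L (Suc n) \<rhd> HO \<cdot> R (Suc n) = HO \<lhd> R (Suc n) \<cdot> L (Suc n)"
    by (rule equalizer_monic[OF tensor_equalizer(1)[OF tensor_equalizer(2)[OF eq, of HO], of HO]])
      (simp_all add: coaction_compat_step[where W' = "T (Suc n)", OF _ _ _ _ _ _ _ _ _ _ _ _ _ _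
          E(2) E(1) E(1)])
  ultimately show ?thesis by (simp add: tower_def)
qed

lemma tower: "tower n" and tower_step: "tower_step n"
proof -
  have "tower (Suc n)" for n
  proof (induction n)
    case (Suc n)
    show ?case using Suc tower_step_pos[OF Suc] tower_Suc by simp
  qed (use tower_step_0 in simp)
  thus "tower n" using tower_step_0 by (cases n) simp_all
  thus "tower_step n" using tower_step_0 tower_step_pos by (cases "n > 0") simp_all
qed

lemma T_simps [simp]:
  "T n \<in> Ob C" "R n \<in> Ar C" "Dom C (R n) = T n" "Cod C (R n) = T n \<otimes>\<^sub>o HO"
  "L n \<in> Ar C" "Dom C (L n) = T n" "Cod C (L n) = HO \<otimes>\<^sub>o T n"
  "E n \<in> Ar C" "Dom C (E n) = T (Suc n)" "Cod C (E n) = T n \<otimes>\<^sub>o N"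
  using tower[of n] tower_step[of n] by (simp_all add: tower_def tower_step_def)

lemma E_equalizer: "is_equalizer C (\<alpha> (T n) HO N \<cdot> R n \<rhd> N) (T n \<lhd> lcoact M) (E n)"
  using tower_step[of n] by (simp add: tower_step_def)

lemma T_coactions:
  "\<alpha> (T n) HO HO \<cdot> R n \<rhd> HO \<cdot> R n = T n \<lhd> comul H \<cdot> R n"
  "\<r> (T n) \<cdot> T n \<lhd> counit H \<cdot> R n = \<^bold>1 (T n)"
  "\<l> (T n) \<cdot> counit H \<rhd> T n \<cdot> L n = \<^bold>1 (T n)"
  "\<alpha> HO (T n) HO \<cdot> L n \<rhd> HO \<cdot> R n = HO \<lhd> R n \<cdot> L n"
  using tower[of n] by (simp_all add: tower_def)

lemma E_coactions:
  "\<alpha> (T n) HO N \<cdot> R n \<rhd> N \<cdot> E n = T n \<lhd> lcoact M \<cdot> E n"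
  "E n \<rhd> HO \<cdot> R (Suc n) = \<beta> (T n) N HO \<cdot> T n \<lhd> rcoact M \<cdot> E n"
  "HO \<lhd> E n \<cdot> L (Suc n) = \<alpha> HO (T n) N \<cdot> L n \<rhd> N \<cdot> E n"
  using tower_step[of n] by (simp_all add: tower_step_def is_equalizer_def)

section \<open>The components of the comultiplication\<close>

definition component_ok :: "nat \<Rightarrow> nat \<Rightarrow> bool" where
  "component_ok m n \<longleftrightarrow> D m n \<in> Hom C (T (m + n)) (T m \<otimes>\<^sub>o T n)
     \<and> \<alpha> (T m) (T n) HO \<cdot> D m n \<rhd> HO \<cdot> R (m + n) = T m \<lhd> R n \<cdot> D m n"

lemma D_0: "D 0 n = L n"
  by (cases n) (simp_all add: power_simps)

text \<open>The definition distinguishes three cases, but the recursion through \<open>E\<close> is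
  common to them. In the generic case the right colinearity in \<open>component_ok\<close> makes the
  right-hand side factor through the equalizer.\<close>

lemma D_Suc:
  assumes "component_ok m n"
  shows "D m (Suc n) \<in> Hom C (T (m + Suc n)) (T m \<otimes>\<^sub>o T (Suc n))"
    "T m \<lhd> E n \<cdot> D m (Suc n) = \<alpha> (T m) (T n) N \<cdot> D m n \<rhd> N \<cdot> E (m + n)"
proof -
  have [simp]: "D m n \<in> Ar C" "Dom C (D m n) = T (m + n)" "Cod C (D m n) = T m \<otimes>\<^sub>o T n"
    using assms by (simp_all add: component_ok_def)
  have dr: "\<alpha> (T m) (T n) HO \<cdot> D m n \<rhd> HO \<cdot> R (m + n) = T m \<lhd> R n \<cdot> D m n"
    using assms by (simp add: component_ok_def)
  have *: "D m (Suc n) \<in> Hom C (T (m + Suc n)) (T m \<otimes>\<^sub>o T (Suc n)) \<and>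
    T m \<lhd> E n \<cdot> D m (Suc n) = \<alpha> (T m) (T n) N \<cdot> D m n \<rhd> N \<cdot> E (m + n)"
  proof (cases "m = 0 \<or> n = 0")
    case True
    thus ?thesis
    proof (cases "m = 0")
      case True
      have h: "HO = T 0" by (simp add: power_simps)
      \<comment> \<open>For \<open>m = 0\<close> the components are left coactions, and the
        recursion is the defining property of the left coaction on the next power.\<close>
      show ?thesis unfolding True D_0 using T_simps[of n] T_simps[of "Suc n"] E_coactions(3)[of n]
        by (simp del: Tc_component.simps add: power_simps)
    next
      case False
      hence n: "n = 0" using \<open>m = 0 \<or> n = 0\<close> by simp
      \<comment> \<open>For \<open>n = 0\<close> the recursion is the equalizer condition of
        \<open>E m\<close>, as \<open>E 0\<close> is the left coaction of \<open>M\<close>.\<close>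
      have D: "D m (Suc 0) = E m" using False by (simp add: E_def)
      have E0: "E 0 = lcoact M" by (simp add: E_def)
      show ?thesis unfolding n D E0 using E_coactions(1)[of m] T_simps[of m]
        by (simp add: power_simps)
    qed
  next
    case False
    hence D: "D m (Suc n) = (THE d. d \<in> Hom C (T (m + Suc n)) (T m \<otimes>\<^sub>o T (Suc n)) \<and>
      T m \<lhd> E n \<cdot> d = \<alpha> (T m) (T n) N \<cdot> D m n \<rhd> N \<cdot> E (m + n))"
      by (simp add: E_def lw_def rw_def)
    have "T m \<lhd> (\<alpha> (T n) HO N \<cdot> R n \<rhd> N) \<cdot> \<alpha> (T m) (T n) N \<cdot> D m n \<rhd> N \<cdot> E (m + n)
      = T m \<lhd> (T n \<lhd> lcoact M) \<cdot> \<alpha> (T m) (T n) N \<cdot> D m n \<rhd> N \<cdot> E (m + n)"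
      by (rule cotensor_component_lift[where W' = "T (m + Suc n)", OF _ _ _ _ _ _ _ _ _ _ _ dr
          E_coactions(1)]) simp_all
    from theI'[OF equalizer_univ[OF tensor_equalizer(1)[OF E_equalizer[of n], of "T m"] _ this, of
        "T (m + Suc n)"]]
    show ?thesis unfolding D by simp
  qed
  from * show "D m (Suc n) \<in> Hom C (T (m + Suc n)) (T m \<otimes>\<^sub>o T (Suc n))" by (rule conjunct1)
  from * show "T m \<lhd> E n \<cdot> D m (Suc n) = \<alpha> (T m) (T n) N \<cdot> D m n \<rhd> N \<cdot> E (m + n)" by
      (rule conjunct2)
qed

lemma component_ok: "component_ok m n"
proof (induction n)
  case 0
  show ?case unfolding component_ok_def using T_coactions(1)[of m] T_simps[of m] by
      (simp add: power_simps)
next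
  case (Suc n)
  note D = D_Suc[OF Suc]
  have [simp]: "D m n \<in> Ar C" "Dom C (D m n) = T (m + n)" "Cod C (D m n) = T m \<otimes>\<^sub>o T n"
    using Suc by (simp_all add: component_ok_def)
  have [simp]: "D m (Suc n) \<in> Ar C" "Dom C (D m (Suc n)) = T (Suc (m + n))" "Cod C (D m (Suc n))
      = T m \<otimes>\<^sub>o T (Suc n)"
    using D(1) by (simp_all del: Tc_component.simps)
  have "\<alpha> (T m) (T (Suc n)) HO \<cdot> D m (Suc n) \<rhd> HO \<cdot> R (Suc (m + n)) = T m \<lhd> R (Suc n) \<cdot> D m (Suc n)"
    by (rule equalizer_monic[OF tensor_equalizer(1)[OF tensor_equalizer(2)[OF E_equalizer[of n],
        of HO], of "T m"]])
      (simp_all del: Tc_component.simps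
        add: coaction_compat_step[where W' = "T (Suc (m + n))", OF _ _ _ _ _ _ _ _ _ _ _ _ _ _
            D(2) E_coactions(2) E_coactions(2)])
  thus ?case unfolding component_ok_def by (simp del: Tc_component.simps)
qed

lemma D_simps [simp]:
  "D m n \<in> Ar C" "Dom C (D m n) = T (m + n)" "Cod C (D m n) = T m \<otimes>\<^sub>o T n"
  using component_ok[of m n] by (simp_all add: component_ok_def)

declare Tc_component.simps [simp del]

lemma D_R: "\<alpha> (T m) (T n) HO \<cdot> D m n \<rhd> HO \<cdot> R (m + n) = T m \<lhd> R n \<cdot> D m n"
  using component_ok[of m n] by (simp add: component_ok_def)

lemma D_E: "T m \<lhd> E n \<cdot> D m (Suc n) = \<alpha> (T m) (T n) N \<cdot> D m n \<rhd> N \<cdot> E (m + n)"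
  by (rule D_Suc[OF component_ok])

lemma D_right_0: "D m 0 = R m"
  by (simp add: Tc_component.simps)

lemma D_right_1: "D m (Suc 0) = E m"
  by (simp add: Tc_component.simps E_def power_simps)

text \<open>Induction on the last index. For \<open>c = 0\<close> the component is a right coaction
  and the claim is right colinearity; the step cancels \<open>E c\<close> under two tensor
  factors.\<close>

lemma component_coassoc:
  "\<alpha> (T a) (T b) (T c) \<cdot> D a b \<rhd> T c \<cdot> D (a + b) c = T a \<lhd> D b c \<cdot> D a (b + c)"
proof (induction c)
  case 0
  show ?case using D_R[of a b] by (simp add: D_right_0 power_simps)
next
  case (Suc c)
  show ?case
    by (rule equalizer_monic[OF tensor_equalizer(1)[OF tensor_equalizer(1)[OF E_equalizer[of c],
        of "T b"], of "T a"]])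
      (use component_coassoc_step[of N "T a" "T b" "T c" "T (Suc c)" "T (a + b)" "T (b + c)" "T
          (b + Suc c)"
        "T (a + b + c)" "T (a + b + Suc c)" "D a b" "D b c" "D b (Suc c)" "D a (b + c)" "D a
            (b + Suc c)"
        "D (a + b) c" "D (a + b) (Suc c)" "E c" "E (b + c)" "E (a + b + c)"] Suc
        D_E[of b c] D_E[of a "b + c"] D_E[of "a + b" c] in \<open>simp_all add: add.assoc\<close>)
qed

end

section \<open>The cotensor coalgebra and its universal property\<close>

context cotensor_tower
begin

lemma T_0_1 [simp]: "T 0 = HO" "T (Suc 0) = N"
  by (rule power_simps)+

abbreviation TC :: 'o where "TC \<equiv> Tc_ob C H M"
abbreviation inc :: "nat \<Rightarrow> 'a" where "inc \<equiv> Tc_inj C H M"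
abbreviation proj :: "nat \<Rightarrow> 'a" where "proj \<equiv> Tc_proj C H M"
abbreviation comulT :: 'a where "comulT \<equiv> Tc_comul C H M"

lemma TC_coproduct: "is_coproduct C UNIV T TC inc"
  unfolding Tc_ob_def Tc_inj_def by (rule countable_coproduct[of "\<lambda>n. n"]) simp_all

lemma TC_simps [simp]: "TC \<in> Ob C" "inc n \<in> Ar C" "Dom C (inc n) = T n" "Cod C (inc n) = TC"
  using coproduct_simps[OF TC_coproduct] by simp_all

lemma proj_spec: "proj n \<in> Hom C TC (T n)"
  "proj n \<cdot> inc k = (if k = n then \<^bold>1 (T n) else zero_ar C (T k) (T n))"
proof -
  have "\<exists>!p. p \<in> Hom C TC (T n) \<and> (\<forall>k\<in>UNIV. p \<cdot> inc k = (if k = n then \<^bold>1 (T n) else zero_ar C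
      (T k) (T n)))"
    by (rule coproduct_univ[OF TC_coproduct]) simp_all
  hence "\<exists>!p. p \<in> Hom C TC (T n) \<and> (\<forall>k. p \<cdot> inc k = (if k = n then \<^bold>1 (T n) else zero_ar C (T k)
      (T n)))"
    by (simp only: ball_UNIV)
  from theI'[OF this] show "proj n \<in> Hom C TC (T n)"
    "proj n \<cdot> inc k = (if k = n then \<^bold>1 (T n) else zero_ar C (T k) (T n))"
    unfolding Tc_proj_def by blast+
qed

lemma proj_simps [simp]: "proj n \<in> Ar C" "Dom C (proj n) = TC" "Cod C (proj n) = T n"
  using proj_spec(1)[of n] by simp_all

abbreviation comul_summand :: "nat \<Rightarrow> nat \<Rightarrow> 'a" where
  "comul_summand n \<equiv> \<lambda>a. (inc a \<otimes>\<^sub>a inc (n - a)) \<cdot> D a (n - a)"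

lemma comulT_spec: "comulT \<in> Hom C TC (TC \<otimes>\<^sub>o TC)"
  "comulT \<cdot> inc n = finprod (hom_group C (T n) (TC \<otimes>\<^sub>o TC)) (comul_summand n) {..n}"
proof -
  let ?f = "\<lambda>n. finprod (hom_group C (T n) (TC \<otimes>\<^sub>o TC)) (comul_summand n) {..n}"
  have "?f n \<in> Hom C (T n) (TC \<otimes>\<^sub>o TC) \<and> True" for n
    by (rule finprod_Hom_induct) simp_all
  hence "\<exists>!d. d \<in> Hom C TC (TC \<otimes>\<^sub>o TC) \<and> (\<forall>n\<in>UNIV. d \<cdot> inc n = ?f n)"
    by (intro coproduct_univ[OF TC_coproduct]) (simp_all del: in_Hom)
  hence "\<exists>!d. d \<in> Hom C TC (TC \<otimes>\<^sub>o TC) \<and> (\<forall>n. d \<cdot> inc n = ?f n)"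
    by (simp only: ball_UNIV)
  from theI'[OF this] show "comulT \<in> Hom C TC (TC \<otimes>\<^sub>o TC)" "comulT \<cdot> inc n = ?f n"
    unfolding Tc_comul_def by blast+
qed

lemma comulT_simps [simp]: "comulT \<in> Ar C" "Dom C comulT = TC" "Cod C comulT = TC \<otimes>\<^sub>o TC"
  using comulT_spec(1) by simp_all

text \<open>Of the summands in degree \<open>a + b\<close> only the one that splits as
  \<open>a\<close> and \<open>b\<close> survives both projections. The coalgebra axioms are checked
  through this identity, without returning to the sum.\<close>

lemma proj_comul: "(proj a \<otimes>\<^sub>a proj b) \<cdot> comulT = D a b \<cdot> proj (a + b)"
proof (rule coproduct_ext[OF TC_coproduct])
  fix n
  have 1: "(proj a \<otimes>\<^sub>a proj b) \<cdot> comul_summand n c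
      = (if n = a + b \<and> c = a then D a b else zero_ar C (T n) (T a \<otimes>\<^sub>o T b))" if "c \<le> n" for c
  proof -
    have "(proj a \<otimes>\<^sub>a proj b) \<cdot> comul_summand n c = ((proj a \<cdot> inc c) \<otimes>\<^sub>a (proj b \<cdot> inc (n - c)))
        \<cdot> D c (n - c)"
      using that compose_reduce[OF compose_tensor[of "inc c" "proj a" "inc (n - c)" "proj b"], of
          "D c (n - c)"]
      by simp
    also have "\<dots> = (if n = a + b \<and> c = a then D a b else zero_ar C (T n) (T a \<otimes>\<^sub>o T b))"
      using that by (auto simp: proj_spec(2))
    finally show ?thesis .
  qed
  have "((proj a \<otimes>\<^sub>a proj b) \<cdot> comulT) \<cdot> inc n
    = finprod (hom_group C (T n) (T a \<otimes>\<^sub>o T b)) (\<lambda>c. (proj a \<otimes>\<^sub>a proj b) \<cdot> comul_summand n c) {..n}"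
    by (simp add: comulT_spec(2)) (rule compose_finprod, simp_all)
  also have "\<dots> = D a b \<cdot> proj (a + b) \<cdot> inc n"
  proof (cases "n = a + b")
    case True
    have "finprod (hom_group C (T n) (T a \<otimes>\<^sub>o T b)) (\<lambda>c. (proj a \<otimes>\<^sub>a proj b)
        \<cdot> comul_summand n c) {..n}
      = (proj a \<otimes>\<^sub>a proj b) \<cdot> comul_summand n a"
      by (rule finprod_single) (use True 1 in auto)
    thus ?thesis using 1[of a] True by (simp add: proj_spec(2))
  next
    case False
    \<comment> \<open>In all other degrees every summand vanishes; the summand 0 serves to evaluate
      the zero sum.\<close>
    have "finprod (hom_group C (T n) (T a \<otimes>\<^sub>o T b)) (\<lambda>c. (proj a \<otimes>\<^sub>a proj b)
        \<cdot> comul_summand n c) {..n}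
      = (proj a \<otimes>\<^sub>a proj b) \<cdot> comul_summand n 0"
      by (rule finprod_single) (use False 1 in auto)
    thus ?thesis using 1[of 0] False by (simp add: proj_spec(2))
  qed
  finally show "((proj a \<otimes>\<^sub>a proj b) \<cdot> comulT) \<cdot> inc n = (D a b \<cdot> proj (a + b)) \<cdot> inc n" by simp
qed simp_all

lemma TC_ext:
  assumes "x \<in> Ar C" "y \<in> Ar C" "Cod C x = TC" "Cod C y = TC" "Dom C x = Dom C y"
    "\<And>n. proj n \<cdot> x = proj n \<cdot> y"
  shows "x = y"
  by (rule coproduct_proj_ext[OF TC_coproduct, of "\<lambda>n. n" proj])
      (use assms proj_spec(2) in \<open>auto simp: bij_def\<close>)

lemma TC_pair_coproduct: "is_coproduct C UNIV (\<lambda>(a, b). T a \<otimes>\<^sub>o T b) (TC \<otimes>\<^sub>o TC)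
    (\<lambda>(a, b). inc a \<otimes>\<^sub>a inc b)"
  by (rule tensor_coproducts[OF TC_coproduct _ TC_coproduct, of "\<lambda>n. n" "\<lambda>n. n"]) simp_all

lemma TC_pair_ext:
  assumes "x \<in> Ar C" "y \<in> Ar C" "Cod C x = TC \<otimes>\<^sub>o TC" "Cod C y = TC \<otimes>\<^sub>o TC" "Dom C x = Dom C y"
    "\<And>a b. (proj a \<otimes>\<^sub>a proj b) \<cdot> x = (proj a \<otimes>\<^sub>a proj b) \<cdot> y"
  shows "x = y"
proof (rule coproduct_proj_ext[OF TC_pair_coproduct])
  show "bij prod_decode" by (rule bij_prod_decode)
  let ?p = "\<lambda>(a, b). proj a \<otimes>\<^sub>a proj b"
  show "?p n \<in> Hom C (TC \<otimes>\<^sub>o TC) (case n of (a, b) \<Rightarrow> T a \<otimes>\<^sub>o T b)" for n by (cases n) simp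
  show "?p n \<cdot> (case k of (a, b) \<Rightarrow> inc a \<otimes>\<^sub>a inc b)
     = (if k = n then \<^bold>1 (case n of (a, b) \<Rightarrow> T a \<otimes>\<^sub>o T b)
        else zero_ar C (case k of (a, b) \<Rightarrow> T a \<otimes>\<^sub>o T b) (case n of (a, b) \<Rightarrow> T a \<otimes>\<^sub>o T b))" for n k
    by (cases n; cases k) (auto simp: compose_tensor proj_spec(2))
  show "?p n \<cdot> x = ?p n \<cdot> y" for n by (cases n) (simp add: assms)
qed (use assms in simp_all)

text \<open>Coassociativity compares arrows into the cube, so joint monicity is needed there as
  well; iterating the pairing function lists the triples of degrees.\<close>

lemma TC_triple_ext:
  assumes "x \<in> Ar C" "y \<in> Ar C" "Cod C x = TC \<otimes>\<^sub>o (TC \<otimes>\<^sub>o TC)" "Cod C y = TC \<otimes>\<^sub>o (TC \<otimes>\<^sub>o TC)" "Dom C x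
      = Dom C y"
    "\<And>a b c. (proj a \<otimes>\<^sub>a (proj b \<otimes>\<^sub>a proj c)) \<cdot> x = (proj a \<otimes>\<^sub>a (proj b \<otimes>\<^sub>a proj c)) \<cdot> y"
  shows "x = y"
proof (rule coproduct_proj_ext)
  show "is_coproduct C UNIV (\<lambda>(a, bc). T a \<otimes>\<^sub>o (case bc of (b, c) \<Rightarrow> T b \<otimes>\<^sub>o T c)) (TC \<otimes>\<^sub>o (TC \<otimes>\<^sub>o TC))
    (\<lambda>(a, bc). inc a \<otimes>\<^sub>a (case bc of (b, c) \<Rightarrow> inc b \<otimes>\<^sub>a inc c))"
    by (rule tensor_coproducts[OF TC_coproduct _ TC_pair_coproduct, of "\<lambda>n. n" prod_encode])
        (simp_all add: inj_prod_encode)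
  show "bij (\<lambda>n. case prod_decode n of (a, m) \<Rightarrow> (a, prod_decode m))"
  proof (rule bijI')
    show "\<exists>n. y = (case prod_decode n of (a, m) \<Rightarrow> (a, prod_decode m))" for y :: "nat \<times> nat \<times> nat"
      by (intro exI[of _ "prod_encode (fst y, prod_encode (snd y))"]) simp
    fix m n :: nat
    show "(case prod_decode m of (a, m) \<Rightarrow> (a, prod_decode m)) = (case prod_decode n of (a, m) \<Rightarrow>
        (a, prod_decode m))
      \<longleftrightarrow> m = n"
      by (cases "prod_decode m"; cases "prod_decode n")
        (auto, metis prod_decode_inverse)
  qed
  let ?p = "\<lambda>(a, b, c). proj a \<otimes>\<^sub>a (proj b \<otimes>\<^sub>a proj c)"
  show "?p n \<in> Hom C (TC \<otimes>\<^sub>o (TC \<otimes>\<^sub>o TC)) (case n of (a, bc) \<Rightarrow> T a \<otimes>\<^sub>o (case bc of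
      (b, c) \<Rightarrow> T b \<otimes>\<^sub>o T c))" for n
    by (cases n) simp
  show "?p n \<cdot> (case k of (a, bc) \<Rightarrow> inc a \<otimes>\<^sub>a (case bc of (b, c) \<Rightarrow> inc b \<otimes>\<^sub>a inc c))
     = (if k = n then \<^bold>1 (case n of (a, bc) \<Rightarrow> T a \<otimes>\<^sub>o (case bc of (b, c) \<Rightarrow> T b \<otimes>\<^sub>o T c))
        else zero_ar C (case k of (a, bc) \<Rightarrow> T a \<otimes>\<^sub>o (case bc of (b, c) \<Rightarrow> T b \<otimes>\<^sub>o T c))
          (case n of (a, bc) \<Rightarrow> T a \<otimes>\<^sub>o (case bc of (b, c) \<Rightarrow> T b \<otimes>\<^sub>o T c)))" for n k
    by (cases n; cases k) (auto simp: compose_tensor proj_spec(2))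
  show "?p n \<cdot> x = ?p n \<cdot> y" for n by (cases n) (simp add: assms)
qed (use assms in simp_all)

text \<open>On each triple of projections both sides reduce, by two uses of
  \<open>proj_comul\<close>, to the coassociativity of the components.\<close>

lemma comulT_coassoc: "\<alpha> TC TC TC \<cdot> comulT \<rhd> TC \<cdot> comulT = TC \<lhd> comulT \<cdot> comulT"
proof (rule TC_triple_ext)
  fix a b c
  let ?p = "proj a \<otimes>\<^sub>a (proj b \<otimes>\<^sub>a proj c)"
  have "?p \<cdot> (\<alpha> TC TC TC \<cdot> comulT \<rhd> TC \<cdot> comulT)
    = \<alpha> (T a) (T b) (T c) \<cdot> ((proj a \<otimes>\<^sub>a proj b) \<otimes>\<^sub>a proj c) \<cdot> comulT \<rhd> TC \<cdot> comulT"
    using compose_reduce[OF assoc_nat_ar[of "proj a" "proj b" "proj c"], of "comulT \<rhd> TC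
        \<cdot> comulT"] by simp
  also have "\<dots> = \<alpha> (T a) (T b) (T c) \<cdot> ((D a b \<cdot> proj (a + b)) \<otimes>\<^sub>a proj c) \<cdot> comulT"
    using compose_reduce[OF compose_tensor[of comulT "proj a \<otimes>\<^sub>a proj b" "\<^bold>1 TC" "proj c"], of comulT]
    by (simp add: rw_def proj_comul)
  also have "\<dots> = \<alpha> (T a) (T b) (T c) \<cdot> D a b \<rhd> T c \<cdot> ((proj (a + b) \<otimes>\<^sub>a proj c) \<cdot> comulT)"
    using compose_reduce[OF compose_tensor[of "proj (a + b)" "D a b" "proj c" "\<^bold>1 (T c)"], of comulT]
    by (simp add: rw_def)
  also have "\<dots> = (\<alpha> (T a) (T b) (T c) \<cdot> D a b \<rhd> T c \<cdot> D (a + b) c) \<cdot> proj (a + b + c)"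
    by (subst proj_comul) (simp add: add.assoc)
  also have "\<dots> = T a \<lhd> D b c \<cdot> (D a (b + c) \<cdot> proj (a + (b + c)))"
    by (subst component_coassoc) (simp add: add.assoc)
  also have "\<dots> = T a \<lhd> D b c \<cdot> (proj a \<otimes>\<^sub>a proj (b + c)) \<cdot> comulT"
    by (simp add: proj_comul)
  also have "\<dots> = (proj a \<otimes>\<^sub>a ((proj b \<otimes>\<^sub>a proj c) \<cdot> comulT)) \<cdot> comulT"
    using compose_reduce[OF compose_tensor[of "proj a" "\<^bold>1 (T a)" "proj (b + c)" "D b c"], of comulT]
    by (simp add: lw_def proj_comul)
  also have "\<dots> = ?p \<cdot> (TC \<lhd> comulT \<cdot> comulT)"
    using compose_reduce[OF compose_tensor[of "\<^bold>1 TC" "proj a" comulT "proj b \<otimes>\<^sub>a proj c"], of comulT]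
    by (simp add: lw_def)
  finally show "?p \<cdot> (\<alpha> TC TC TC \<cdot> comulT \<rhd> TC \<cdot> comulT) = ?p \<cdot> (TC \<lhd> comulT \<cdot> comulT)" .
qed simp_all

text \<open>The counit sees degree 0 only, where the components are coactions; what remains is their
  counit law on each \<open>T n\<close>.\<close>

lemma comulT_counit:
  "\<l> TC \<cdot> (counit H \<cdot> proj 0) \<rhd> TC \<cdot> comulT = \<^bold>1 TC"
  "\<r> TC \<cdot> TC \<lhd> (counit H \<cdot> proj 0) \<cdot> comulT = \<^bold>1 TC"
proof -
  have P: "(proj 0 \<otimes>\<^sub>a proj n) \<cdot> comulT = L n \<cdot> proj n" "(proj n \<otimes>\<^sub>a proj 0) \<cdot> comulT = R n
      \<cdot> proj n" for n
    using proj_comul[of 0 n] proj_comul[of n 0] by (simp_all add: D_0 D_right_0)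
  show "\<l> TC \<cdot> (counit H \<cdot> proj 0) \<rhd> TC \<cdot> comulT = \<^bold>1 TC"
  proof (rule TC_ext)
    fix n
    have "proj n \<cdot> (\<l> TC \<cdot> (counit H \<cdot> proj 0) \<rhd> TC \<cdot> comulT)
      = \<l> (T n) \<cdot> \<I> \<lhd> proj n \<cdot> (counit H \<cdot> proj 0) \<rhd> TC \<cdot> comulT"
      using compose_reduce[OF unitor_natural(1)[of "proj n"], of "(counit H \<cdot> proj 0) \<rhd> TC
          \<cdot> comulT"] by simp
    also have "\<dots> = \<l> (T n) \<cdot> counit H \<rhd> T n \<cdot> ((proj 0 \<otimes>\<^sub>a proj n) \<cdot> comulT)"
      using compose_reduce[OF compose_tensor[of "counit H \<cdot> proj 0" "\<^bold>1 \<I>" "\<^bold>1 TC"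
          "proj n"], of comulT]
        compose_reduce[OF compose_tensor[of "proj 0" "counit H" "proj n" "\<^bold>1 (T n)"], of comulT]
      by (simp add: lw_def rw_def)
    also have "\<dots> = (\<l> (T n) \<cdot> counit H \<rhd> T n \<cdot> L n) \<cdot> proj n"
      by (subst P) simp
    also have "\<dots> = proj n \<cdot> \<^bold>1 TC" by (subst T_coactions) simp
    finally show "proj n \<cdot> (\<l> TC \<cdot> (counit H \<cdot> proj 0) \<rhd> TC \<cdot> comulT) = proj n \<cdot> \<^bold>1 TC" .
  qed simp_all
  show "\<r> TC \<cdot> TC \<lhd> (counit H \<cdot> proj 0) \<cdot> comulT = \<^bold>1 TC"
  proof (rule TC_ext)
    fix n
    have "proj n \<cdot> (\<r> TC \<cdot> TC \<lhd> (counit H \<cdot> proj 0) \<cdot> comulT)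
      = \<r> (T n) \<cdot> proj n \<rhd> \<I> \<cdot> TC \<lhd> (counit H \<cdot> proj 0) \<cdot> comulT"
      using compose_reduce[OF unitor_natural(2)[of "proj n"], of "TC \<lhd> (counit H \<cdot> proj 0)
          \<cdot> comulT"] by simp
    also have "\<dots> = \<r> (T n) \<cdot> T n \<lhd> counit H \<cdot> ((proj n \<otimes>\<^sub>a proj 0) \<cdot> comulT)"
      using compose_reduce[OF compose_tensor[of "\<^bold>1 TC" "proj n" "counit H \<cdot> proj 0"
          "\<^bold>1 \<I>"], of comulT]
        compose_reduce[OF compose_tensor[of "proj n" "\<^bold>1 (T n)" "proj 0" "counit H"], of comulT]
      by (simp add: lw_def rw_def)
    also have "\<dots> = (\<r> (T n) \<cdot> T n \<lhd> counit H \<cdot> R n) \<cdot> proj n"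
      by (subst P) simp
    also have "\<dots> = proj n \<cdot> \<^bold>1 TC" by (subst T_coactions) simp
    finally show "proj n \<cdot> (\<r> TC \<cdot> TC \<lhd> (counit H \<cdot> proj 0) \<cdot> comulT) = proj n \<cdot> \<^bold>1 TC" .
  qed simp_all
qed

lemma coalgebra_TC: "is_coalgebra C (cotensor_coalgebra C H M)"
  using comulT_coassoc comulT_counit T_simps(1)[of 0] power_simps(1)
  by (simp add: is_coalgebra_def cotensor_coalgebra_def lw_def rw_def)

section \<open>Uniqueness and existence of coalgebra homomorphisms into the cotensor
  coalgebra\<close>

lemma E_proj: "E n \<cdot> proj (Suc n) = (proj n \<otimes>\<^sub>a proj (Suc 0)) \<cdot> comulT"
  using proj_comul[of n "Suc 0"] by (simp add: D_right_1)

lemma E_monic: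
  assumes "E n \<cdot> f = E n \<cdot> g" "f \<in> Ar C" "g \<in> Ar C" "Cod C f = T (Suc n)" "Cod C g = T (Suc n)"
      "Dom C f = Dom C g"
  shows "f = g"
  by (rule equalizer_monic[OF E_equalizer assms(1)]) (use assms(2-) in simp_all)

text \<open>Stated for a bare arrow \<open>\<delta>\<close>, so that the iterated
  \<open>tensor_comul\<close> of a cube, or of a product with \<open>\<I>\<close>, can be inserted
  as it stands.\<close>

lemma coalgebra_hom_unique:
  assumes \<delta>: "\<delta> \<in> Hom C B (B \<otimes>\<^sub>o B)" and f: "f \<in> Hom C B TC" and g: "g \<in> Hom C B TC"
    and cf: "comulT \<cdot> f = (f \<otimes>\<^sub>a f) \<cdot> \<delta>" and cg: "comulT \<cdot> g = (g \<otimes>\<^sub>a g) \<cdot> \<delta>"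
    and p0: "proj 0 \<cdot> f = proj 0 \<cdot> g" and p1: "proj (Suc 0) \<cdot> f = proj (Suc 0) \<cdot> g"
  shows "f = g"
proof -
  have pS: "E n \<cdot> (proj (Suc n) \<cdot> h) = ((proj n \<cdot> h) \<otimes>\<^sub>a (proj (Suc 0) \<cdot> h)) \<cdot> \<delta>"
    if "h \<in> Hom C B TC" "comulT \<cdot> h = (h \<otimes>\<^sub>a h) \<cdot> \<delta>" for h n
  proof -
    have "E n \<cdot> (proj (Suc n) \<cdot> h) = (proj n \<otimes>\<^sub>a proj (Suc 0)) \<cdot> (comulT \<cdot> h)"
      using compose_reduce[OF E_proj[of n], of h] that(1) by simp
    thus ?thesis
      using compose_reduce[OF compose_tensor[of h "proj n" h "proj (Suc 0)"], of \<delta>] that \<delta> by simp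
  qed
  have "proj n \<cdot> f = proj n \<cdot> g" for n
  proof (induction n)
    case (Suc n)
    have "E n \<cdot> (proj (Suc n) \<cdot> f) = E n \<cdot> (proj (Suc n) \<cdot> g)"
      unfolding pS[OF f cf] pS[OF g cg] Suc p1 ..
    thus ?case by (rule E_monic) (use f g in simp_all)
  qed (rule p0)
  thus ?thesis by - (rule TC_ext, use f g in simp_all)
qed

text \<open>For positive \<open>n\<close> this is the iterated comultiplication followed by
  \<open>f1\<close> in all \<open>n\<close> places, factored through the cotensor power. Starting
  from \<open>f0\<close> keeps a single recursion for all degrees; \<open>lift_component_1\<close>
  recovers \<open>f1\<close>.\<close>

primrec lift_component :: "'o \<Rightarrow> 'a \<Rightarrow> 'a \<Rightarrow> 'a \<Rightarrow> nat \<Rightarrow> 'a" where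
  "lift_component B \<delta> f0 f1 0 = f0"
| "lift_component B \<delta> f0 f1 (Suc n) = (THE h. h \<in> Hom C B (T (Suc n))
     \<and> E n \<cdot> h = (lift_component B \<delta> f0 f1 n \<otimes>\<^sub>a f1) \<cdot> \<delta>)"

context
  fixes B \<delta> f0 f1
  assumes B [simp]: "B \<in> Ob C" and \<delta>: "\<delta> \<in> Hom C B (B \<otimes>\<^sub>o B)"
    and coassoc: "\<alpha> B B B \<cdot> \<delta> \<rhd> B \<cdot> \<delta> = B \<lhd> \<delta> \<cdot> \<delta>"
    and f0: "f0 \<in> Hom C B HO" and f1: "f1 \<in> Hom C B N"
    and comul_f0: "comul H \<cdot> f0 = (f0 \<otimes>\<^sub>a f0) \<cdot> \<delta>"
    and lcoact_f1: "lcoact M \<cdot> f1 = (f0 \<otimes>\<^sub>a f1) \<cdot> \<delta>"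
    and rcoact_f1: "rcoact M \<cdot> f1 = (f1 \<otimes>\<^sub>a f0) \<cdot> \<delta>"
begin

abbreviation (input) F :: "nat \<Rightarrow> 'a" where "F \<equiv> lift_component B \<delta> f0 f1"

lemma lift_given_simps:
  "\<delta> \<in> Ar C" "Dom C \<delta> = B" "Cod C \<delta> = B \<otimes>\<^sub>o B" "f0 \<in> Ar C" "Dom C f0 = B" "Cod C f0 = HO"
  "f1 \<in> Ar C" "Dom C f1 = B" "Cod C f1 = N"
  using \<delta> f0 f1 by simp_all

text \<open>The equalizer condition compares two bracketings of the convolution of
  \<open>F n\<close>, \<open>f0\<close> and \<open>f1\<close>: one comes from right colinearity of
  \<open>F n\<close>, the other from left colinearity of \<open>f1\<close>. Right colinearity of
  \<open>f1\<close> then restores the invariant for the next degree.\<close>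

lemma lift_component_Suc:
  assumes "F n \<in> Hom C B (T n)" "R n \<cdot> F n = (F n \<otimes>\<^sub>a f0) \<cdot> \<delta>"
  shows "F (Suc n) \<in> Hom C B (T (Suc n))" "E n \<cdot> F (Suc n) = (F n \<otimes>\<^sub>a f1) \<cdot> \<delta>"
    "R (Suc n) \<cdot> F (Suc n) = (F (Suc n) \<otimes>\<^sub>a f0) \<cdot> \<delta>"
proof -
  note [simp] = lift_given_simps assms(1)[simplified]
  have "(\<alpha> (T n) HO N \<cdot> R n \<rhd> N) \<cdot> ((F n \<otimes>\<^sub>a f1) \<cdot> \<delta>) = \<alpha> (T n) HO N \<cdot> ((R n \<cdot> F n) \<otimes>\<^sub>a f1) \<cdot> \<delta>"
    using compose_reduce[OF compose_tensor[of "F n" "R n" f1 "\<^bold>1 N"], of \<delta>] by (simp add: rw_def)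
  also have "\<dots> = (F n \<otimes>\<^sub>a (lcoact M \<cdot> f1)) \<cdot> \<delta>"
    unfolding assms(2) lcoact_f1 using convolution_assoc[OF B \<delta> _ _ _ _ _ _ coassoc, of
        "F n" f0 f1] by simp
  also have "\<dots> = T n \<lhd> lcoact M \<cdot> ((F n \<otimes>\<^sub>a f1) \<cdot> \<delta>)"
    using compose_reduce[OF compose_tensor[of "F n" "\<^bold>1 (T n)" f1 "lcoact M"], of \<delta>] by
        (simp add: lw_def)
  finally have "(\<alpha> (T n) HO N \<cdot> R n \<rhd> N) \<cdot> ((F n \<otimes>\<^sub>a f1) \<cdot> \<delta>) = T n \<lhd> lcoact M \<cdot> ((F n \<otimes>\<^sub>a f1) \<cdot> \<delta>)" .
  from equalizer_factor[OF E_equalizer _ this, of B]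
  show F: "F (Suc n) \<in> Hom C B (T (Suc n))" "E n \<cdot> F (Suc n) = (F n \<otimes>\<^sub>a f1) \<cdot> \<delta>"
    by simp_all
  note [simp] = F(1)[simplified]
  show "R (Suc n) \<cdot> F (Suc n) = (F (Suc n) \<otimes>\<^sub>a f0) \<cdot> \<delta>"
  proof (rule equalizer_monic[OF tensor_equalizer(2)[OF E_equalizer[of n], of HO]])
    have "E n \<rhd> HO \<cdot> (R (Suc n) \<cdot> F (Suc n)) = \<beta> (T n) N HO \<cdot> T n \<lhd> rcoact M \<cdot> (E n \<cdot> F (Suc n))"
      using compose_reduce[OF E_coactions(2)[of n], of "F (Suc n)"] by simp
    also have "\<dots> = \<beta> (T n) N HO \<cdot> (F n \<otimes>\<^sub>a (rcoact M \<cdot> f1)) \<cdot> \<delta>"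
      unfolding F(2) using compose_reduce[OF compose_tensor[of "F n" "\<^bold>1 (T n)" f1
          "rcoact M"], of \<delta>] by (simp add: lw_def)
    also have "\<dots> = \<beta> (T n) N HO \<cdot> \<alpha> (T n) N HO \<cdot> (((F n \<otimes>\<^sub>a f1) \<cdot> \<delta>) \<otimes>\<^sub>a f0) \<cdot> \<delta>"
      unfolding rcoact_f1 using convolution_assoc[OF B \<delta> _ _ _ _ _ _ coassoc, of "F n" f1 f0]
          by simp
    also have "\<dots> = ((E n \<cdot> F (Suc n)) \<otimes>\<^sub>a f0) \<cdot> \<delta>"
      unfolding F(2) by (simp add: inv_pair_cancel)
    also have "\<dots> = E n \<rhd> HO \<cdot> ((F (Suc n) \<otimes>\<^sub>a f0) \<cdot> \<delta>)"
      using compose_reduce[OF compose_tensor[of "F (Suc n)" "E n" f0 "\<^bold>1 HO"], of \<delta>] by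
          (simp add: rw_def)
    finally show "E n \<rhd> HO \<cdot> (R (Suc n) \<cdot> F (Suc n)) = E n \<rhd> HO \<cdot> ((F (Suc n) \<otimes>\<^sub>a f0) \<cdot> \<delta>)" .
  qed simp_all
qed

lemma lift_component_basic: "F n \<in> Hom C B (T n) \<and> R n \<cdot> F n = (F n \<otimes>\<^sub>a f0) \<cdot> \<delta>"
proof (induction n)
  case 0
  show ?case using f0 comul_f0 by (simp add: power_simps)
next
  case (Suc n)
  thus ?case using lift_component_Suc(1,3)[of n] by blast
qed

lemma lift_component_simps: "F n \<in> Ar C" "Dom C (F n) = B" "Cod C (F n) = T n"
  using lift_component_basic[of n] by simp_all

lemma lift_component_E: "E n \<cdot> F (Suc n) = (F n \<otimes>\<^sub>a f1) \<cdot> \<delta>"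
  using lift_component_basic lift_component_Suc(2) by blast

lemma lift_component_1: "F (Suc 0) = f1"
proof (rule E_monic[of 0])
  have "E 0 \<cdot> F (Suc 0) = (F 0 \<otimes>\<^sub>a f1) \<cdot> \<delta>" by (rule lift_component_E)
  thus "E 0 \<cdot> F (Suc 0) = E 0 \<cdot> f1" using lcoact_f1 by (simp add: E_def del:
      lift_component.simps(2))
qed (use lift_component_simps[of "Suc 0"] lift_given_simps in \<open>simp_all add: power_simps del:
    lift_component.simps\<close>)

text \<open>Compatibility of the lift with the comultiplication in bidegree \<open>(m, n)\<close>.
  The recursions of \<open>D\<close> and of the lift have the same shape, so both advance together
  in \<open>n\<close>.\<close>

lemma lift_component_D: "D m n \<cdot> F (m + n) = (F m \<otimes>\<^sub>a F n) \<cdot> \<delta>"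
proof (induction n)
  case 0
  show ?case using lift_component_basic[of m] by (simp add: D_right_0)
next
  case (Suc n)
  note [simp] = lift_given_simps lift_component_simps
  note [simp del] = lift_component.simps
  show ?case
  proof (rule equalizer_monic[OF tensor_equalizer(1)[OF E_equalizer[of n], of "T m"]])
    have "T m \<lhd> E n \<cdot> (D m (Suc n) \<cdot> F (m + Suc n)) = \<alpha> (T m) (T n) N \<cdot> D m n \<rhd> N \<cdot> (E (m + n) \<cdot> F
        (Suc (m + n)))"
      using compose_reduce[OF D_E[of m n], of "F (m + Suc n)"] by simp
    also have "\<dots> = \<alpha> (T m) (T n) N \<cdot> ((D m n \<cdot> F (m + n)) \<otimes>\<^sub>a f1) \<cdot> \<delta>"
      unfolding lift_component_E
      using compose_reduce[OF compose_tensor[of "F (m + n)" "D m n" f1 "\<^bold>1 N"], of \<delta>] by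
          (simp add: rw_def)
    also have "\<dots> = (F m \<otimes>\<^sub>a (E n \<cdot> F (Suc n))) \<cdot> \<delta>"
      unfolding Suc lift_component_E
      using convolution_assoc[OF B \<delta> _ _ _ _ _ _ coassoc, of "F m" "F n" f1] by simp
    also have "\<dots> = T m \<lhd> E n \<cdot> ((F m \<otimes>\<^sub>a F (Suc n)) \<cdot> \<delta>)"
      using compose_reduce[OF compose_tensor[of "F m" "\<^bold>1 (T m)" "F (Suc n)" "E n"], of \<delta>] by
          (simp add: lw_def)
    finally show "T m \<lhd> E n \<cdot> (D m (Suc n) \<cdot> F (m + Suc n)) = T m \<lhd> E n \<cdot> ((F m \<otimes>\<^sub>a F (Suc n))
        \<cdot> \<delta>)" .
  qed simp_all
qed

text \<open>The assumption \<open>graded\<close> says that \<open>\<delta>\<close> preserves degrees, without writing it as a sum of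
  homogeneous components.\<close>

lemma coalgebra_lift:
  assumes B: "is_coproduct C UNIV X B \<iota>"
    and graded: "\<And>f g p q j. f \<in> Ar C \<Longrightarrow> g \<in> Ar C \<Longrightarrow> Dom C f = B \<Longrightarrow> Dom C g = B
      \<Longrightarrow> (\<And>k. deg k \<noteq> p \<Longrightarrow> f \<cdot> \<iota> k = zero_ar C (X k) (Cod C f))
      \<Longrightarrow> (\<And>k. deg k \<noteq> q \<Longrightarrow> g \<cdot> \<iota> k = zero_ar C (X k) (Cod C g))
      \<Longrightarrow> deg j \<noteq> p + q \<Longrightarrow> (f \<otimes>\<^sub>a g) \<cdot> \<delta> \<cdot> \<iota> j = zero_ar C (X j) (Cod C f \<otimes>\<^sub>o Cod C g)"
    and deg0: "\<And>k. deg k \<noteq> 0 \<Longrightarrow> f0 \<cdot> \<iota> k = zero_ar C (X k) HO"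
    and deg1: "\<And>k. deg k \<noteq> Suc 0 \<Longrightarrow> f1 \<cdot> \<iota> k = zero_ar C (X k) N"
  shows "\<exists>h. h \<in> Hom C B TC \<and> comulT \<cdot> h = (h \<otimes>\<^sub>a h) \<cdot> \<delta> \<and> proj 0 \<cdot> h = f0 \<and> proj (Suc 0) \<cdot> h = f1
    \<and> (\<forall>j. h \<cdot> \<iota> j = inc (deg j) \<cdot> (proj (deg j) \<cdot> (h \<cdot> \<iota> j)))"
proof -
  note [simp] = lift_given_simps lift_component_simps coproduct_simps[OF B, simplified]
  note [simp del] = lift_component.simps
  have F0: "F 0 = f0" by (simp add: lift_component.simps)
  \<comment> \<open>After the monic \<open>E n\<close>, the next component is a convolution of parts
    concentrated in degrees \<open>n\<close> and 1, so \<open>graded\<close> makes it vanish off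
    degree \<open>n + 1\<close>.\<close>
  have deg: "F n \<cdot> \<iota> k = zero_ar C (X k) (T n)" if "deg k \<noteq> n" for n k
    using that
  proof (induction n arbitrary: k)
    case 0
    thus ?case using deg0 by (simp add: F0 power_simps)
  next
    case (Suc n)
    have "E n \<cdot> (F (Suc n) \<cdot> \<iota> k) = (F n \<otimes>\<^sub>a f1) \<cdot> \<delta> \<cdot> \<iota> k"
      using compose_reduce[OF lift_component_E[of n], of "\<iota> k"] by simp
    also have "\<dots> = zero_ar C (X k) (T n \<otimes>\<^sub>o N)"
      using graded[of "F n" f1 n "Suc 0" k] Suc deg1 by simp
    finally have "E n \<cdot> (F (Suc n) \<cdot> \<iota> k) = E n \<cdot> zero_ar C (X k) (T (Suc n))" by simp
    thus ?case by (rule E_monic) simp_all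
  qed
  \<comment> \<open>A priori the components only map into a product. On a homogeneous summand just
    one of them can be nonzero, so \<open>h\<close> may be prescribed summand by summand and lands
    in the direct sum.\<close>
  have "\<exists>h \<in> Hom C B TC. \<forall>j\<in>UNIV. h \<cdot> \<iota> j = inc (deg j) \<cdot> F (deg j) \<cdot> \<iota> j"
    by (rule coproduct_desc[OF B]) simp_all
  then obtain h where h: "h \<in> Hom C B TC" "\<And>j. h \<cdot> \<iota> j = inc (deg j) \<cdot> F (deg j) \<cdot> \<iota> j" by blast
  note [simp] = h(1)[simplified]
  have ph: "proj n \<cdot> h = F n" for n
  proof (rule coproduct_ext[OF B])
    fix j
    have "proj n \<cdot> h \<cdot> \<iota> j = (proj n \<cdot> inc (deg j)) \<cdot> F (deg j) \<cdot> \<iota> j" by (simp add: h(2))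
    also have "\<dots> = F n \<cdot> \<iota> j" by (cases "deg j = n") (simp_all add: proj_spec(2) deg)
    finally show "(proj n \<cdot> h) \<cdot> \<iota> j = F n \<cdot> \<iota> j" by simp
  qed simp_all
  have c: "comulT \<cdot> h = (h \<otimes>\<^sub>a h) \<cdot> \<delta>"
  proof (rule TC_pair_ext)
    fix a b
    have "(proj a \<otimes>\<^sub>a proj b) \<cdot> comulT \<cdot> h = D a b \<cdot> (proj (a + b) \<cdot> h)"
      using compose_reduce[OF proj_comul[of a b], of h] by simp
    also have "\<dots> = (F a \<otimes>\<^sub>a F b) \<cdot> \<delta>" by (simp only: ph lift_component_D)
    also have "\<dots> = (proj a \<otimes>\<^sub>a proj b) \<cdot> (h \<otimes>\<^sub>a h) \<cdot> \<delta>"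
      using compose_reduce[OF compose_tensor[of h "proj a" h "proj b"], of \<delta>] by (simp add: ph)
    finally show "(proj a \<otimes>\<^sub>a proj b) \<cdot> comulT \<cdot> h = (proj a \<otimes>\<^sub>a proj b) \<cdot> (h \<otimes>\<^sub>a h) \<cdot> \<delta>" .
  qed simp_all
  \<comment> \<open>Homogeneity of \<open>h\<close> is recorded in terms of \<open>h\<close> alone,
    for the later proof that the multiplication is graded.\<close>
  have i: "h \<cdot> \<iota> j = inc (deg j) \<cdot> (proj (deg j) \<cdot> (h \<cdot> \<iota> j))" for j
    using compose_reduce[OF ph[of "deg j"], of "\<iota> j"] by (simp add: h(2))
  have "proj 0 \<cdot> h = f0" "proj (Suc 0) \<cdot> h = f1" by (simp_all only: ph F0 lift_component_1)
  with h(1) c i show ?thesis by (intro exI[of _ h] conjI allI)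
qed

end

end

section \<open>Tensor products of coalgebras\<close>

context braided_monoidal_category
begin

text \<open>The comultiplication of \<open>tensor_coalgebra\<close> on bare arrows, which can be
  nested without building records.\<close>

definition tensor_comul :: "'o \<Rightarrow> 'a \<Rightarrow> 'o \<Rightarrow> 'a \<Rightarrow> 'a" where
  "tensor_comul A f B g = mid_braiding C A A B B \<cdot> (f \<otimes>\<^sub>a g)"

lemma tensor_comul_simps [simp]:
  assumes "A \<in> Ob C" "B \<in> Ob C" "f \<in> Ar C" "Cod C f = A \<otimes>\<^sub>o A" "g \<in> Ar C" "Cod C g = B \<otimes>\<^sub>o B"
  shows "tensor_comul A f B g \<in> Ar C" "Dom C (tensor_comul A f B g) = Dom C f \<otimes>\<^sub>o Dom C g"
    "Cod C (tensor_comul A f B g) = (A \<otimes>\<^sub>o B) \<otimes>\<^sub>o (A \<otimes>\<^sub>o B)"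
  using assms by (simp_all add: tensor_comul_def)

lemma mid_braiding_nat:
  assumes "f \<in> Hom C A A'" "g \<in> Hom C B B'" "h \<in> Hom C D D'" "k \<in> Hom C E E'"
  shows "mid_braiding C A' B' D' E' \<cdot> ((f \<otimes>\<^sub>a g) \<otimes>\<^sub>a (h \<otimes>\<^sub>a k)) = ((f \<otimes>\<^sub>a h) \<otimes>\<^sub>a (g \<otimes>\<^sub>a k))
      \<cdot> mid_braiding C A B D E"
  using mid_braiding_natural[of f g h k] assms by auto

lemma tensor_comul_hom:
  assumes "A \<in> Ob C" "B \<in> Ob C" "A' \<in> Ob C" "B' \<in> Ob C"
    and "k \<in> Hom C A A'" "l \<in> Hom C B B'" "f \<in> Hom C A (A \<otimes>\<^sub>o A)" "g \<in> Hom C B (B \<otimes>\<^sub>o B)"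
      "f' \<in> Hom C A' (A' \<otimes>\<^sub>o A')" "g' \<in> Hom C B' (B' \<otimes>\<^sub>o B')"
    and "f' \<cdot> k = (k \<otimes>\<^sub>a k) \<cdot> f" "g' \<cdot> l = (l \<otimes>\<^sub>a l) \<cdot> g"
  shows "tensor_comul A' f' B' g' \<cdot> (k \<otimes>\<^sub>a l) = ((k \<otimes>\<^sub>a l) \<otimes>\<^sub>a (k \<otimes>\<^sub>a l)) \<cdot> tensor_comul A f B g"
proof -
  have "tensor_comul A' f' B' g' \<cdot> (k \<otimes>\<^sub>a l) = mid_braiding C A' A' B' B' \<cdot> ((f' \<cdot> k) \<otimes>\<^sub>a (g' \<cdot> l))"
    using assms(1-10) by (simp add: tensor_comul_def compose_tensor)
  also have "\<dots> = mid_braiding C A' A' B' B' \<cdot> ((k \<otimes>\<^sub>a k) \<otimes>\<^sub>a (l \<otimes>\<^sub>a l)) \<cdot> (f \<otimes>\<^sub>a g)"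
    using assms(1-10) by (simp add: assms(11,12) compose_tensor)
  also have "\<dots> = ((k \<otimes>\<^sub>a l) \<otimes>\<^sub>a (k \<otimes>\<^sub>a l)) \<cdot> tensor_comul A f B g"
    using assms(1-10) compose_reduce[OF mid_braiding_nat[OF assms(5,5,6,6)], of "f \<otimes>\<^sub>a g"]
    by (simp add: tensor_comul_def)
  finally show ?thesis .
qed

text \<open>\<open>mid_braiding_associator\<close> combined with naturality of
  \<open>\<alpha>\<close>. The two sides of the associative law live on differently bracketed cubes,
  and this compares their comultiplications.\<close>

lemma tensor_comul_assoc:
  assumes [simp]: "A \<in> Ob C" "B \<in> Ob C" "D \<in> Ob C"
    and ar: "f \<in> Hom C A (A \<otimes>\<^sub>o A)" "g \<in> Hom C B (B \<otimes>\<^sub>o B)" "h \<in> Hom C D (D \<otimes>\<^sub>o D)"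
  shows "tensor_comul A f (B \<otimes>\<^sub>o D) (tensor_comul B g D h) \<cdot> \<alpha> A B D
    = (\<alpha> A B D \<otimes>\<^sub>a \<alpha> A B D) \<cdot> tensor_comul (A \<otimes>\<^sub>o B) (tensor_comul A f B g) D h"
proof -
  note [simp] = ar[simplified]
  have "tensor_comul A f (B \<otimes>\<^sub>o D) (tensor_comul B g D h) \<cdot> \<alpha> A B D
    = mid_braiding C A A (B \<otimes>\<^sub>o D) (B \<otimes>\<^sub>o D) \<cdot> (A \<otimes>\<^sub>o A) \<lhd> mid_braiding C B B D D \<cdot> (f \<otimes>\<^sub>a (g \<otimes>\<^sub>a h))
        \<cdot> \<alpha> A B D"
    using compose_reduce[OF compose_tensor[of f "\<^bold>1 (A \<otimes>\<^sub>o A)" "g \<otimes>\<^sub>a h"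
        "mid_braiding C B B D D"], of "\<alpha> A B D"]
    by (simp add: tensor_comul_def lw_def)
  also have "\<dots> = (mid_braiding C A A (B \<otimes>\<^sub>o D) (B \<otimes>\<^sub>o D) \<cdot> (A \<otimes>\<^sub>o A) \<lhd> mid_braiding C B B D D
      \<cdot> \<alpha> (A \<otimes>\<^sub>o A) (B \<otimes>\<^sub>o B) (D \<otimes>\<^sub>o D)) \<cdot> ((f \<otimes>\<^sub>a g) \<otimes>\<^sub>a h)"
    using assoc_nat_ar[of f g h] by simp
  also have "\<dots> = (\<alpha> A B D \<otimes>\<^sub>a \<alpha> A B D) \<cdot> mid_braiding C (A \<otimes>\<^sub>o B) (A \<otimes>\<^sub>o B) D D
      \<cdot> mid_braiding C A A B B \<rhd> (D \<otimes>\<^sub>o D) \<cdot> ((f \<otimes>\<^sub>a g) \<otimes>\<^sub>a h)"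
    by (subst mid_braiding_associator[symmetric]) simp_all
  also have "\<dots> = (\<alpha> A B D \<otimes>\<^sub>a \<alpha> A B D) \<cdot> tensor_comul (A \<otimes>\<^sub>o B) (tensor_comul A f B g) D h"
    by (simp add: tensor_comul_def rw_def compose_tensor)
  finally show ?thesis .
qed

text \<open>Naturality pulls \<open>f\<close> and \<open>g\<close> past the interchange, where
  \<open>mid_braiding_assoc\<close> meets the coassociativity of the two factors.\<close>

lemma tensor_comul_coassoc:
  assumes [simp]: "A \<in> Ob C" "B \<in> Ob C"
    and ar: "f \<in> Hom C A (A \<otimes>\<^sub>o A)" "g \<in> Hom C B (B \<otimes>\<^sub>o B)"
    and f: "\<alpha> A A A \<cdot> f \<rhd> A \<cdot> f = A \<lhd> f \<cdot> f" and g: "\<alpha> B B B \<cdot> g \<rhd> B \<cdot> g = B \<lhd> g \<cdot> g"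
  shows "\<alpha> (A \<otimes>\<^sub>o B) (A \<otimes>\<^sub>o B) (A \<otimes>\<^sub>o B) \<cdot> tensor_comul A f B g \<rhd> (A \<otimes>\<^sub>o B) \<cdot> tensor_comul A f B g
    = (A \<otimes>\<^sub>o B) \<lhd> tensor_comul A f B g \<cdot> tensor_comul A f B g"
proof -
  note [simp] = ar[simplified]
  let ?AB = "A \<otimes>\<^sub>o B" and ?\<phi> = "mid_braiding C"
  have 1: "((f \<otimes>\<^sub>a g) \<otimes>\<^sub>a (\<^bold>1 A \<otimes>\<^sub>a \<^bold>1 B)) \<cdot> ?\<phi> A A B B = ?\<phi> (A \<otimes>\<^sub>o A) A (B \<otimes>\<^sub>o B) B \<cdot> ((f \<otimes>\<^sub>a \<^bold>1 A) \<otimes>\<^sub>a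
      (g \<otimes>\<^sub>a \<^bold>1 B))"
    by (rule mid_braiding_nat[symmetric]) simp_all
  have 2: "((\<^bold>1 A \<otimes>\<^sub>a \<^bold>1 B) \<otimes>\<^sub>a (f \<otimes>\<^sub>a g)) \<cdot> ?\<phi> A A B B = ?\<phi> A (A \<otimes>\<^sub>o A) B (B \<otimes>\<^sub>o B) \<cdot> ((\<^bold>1 A \<otimes>\<^sub>a f) \<otimes>\<^sub>a
      (\<^bold>1 B \<otimes>\<^sub>a g))"
    by (rule mid_braiding_nat[symmetric]) simp_all
  have "\<alpha> ?AB ?AB ?AB \<cdot> tensor_comul A f B g \<rhd> ?AB \<cdot> tensor_comul A f B g
    = \<alpha> ?AB ?AB ?AB \<cdot> ?\<phi> A A B B \<rhd> ?AB \<cdot> (((f \<otimes>\<^sub>a g) \<otimes>\<^sub>a (\<^bold>1 A \<otimes>\<^sub>a \<^bold>1 B)) \<cdot> ?\<phi> A A B B) \<cdot> (f \<otimes>\<^sub>a g)"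
    by (simp add: tensor_comul_def whisker_compose(2)) (simp add: rw_def)
  also have "\<dots> = (\<alpha> ?AB ?AB ?AB \<cdot> ?\<phi> A A B B \<rhd> ?AB \<cdot> ?\<phi> (A \<otimes>\<^sub>o A) A (B \<otimes>\<^sub>o B) B) \<cdot> (((f \<rhd> A) \<cdot> f) \<otimes>\<^sub>a
      ((g \<rhd> B) \<cdot> g))"
    unfolding 1 by (simp add: rw_def compose_tensor)
  also have "\<dots> = (?AB \<lhd> ?\<phi> A A B B \<cdot> ?\<phi> A (A \<otimes>\<^sub>o A) B (B \<otimes>\<^sub>o B)) \<cdot> ((\<alpha> A A A \<cdot> f \<rhd> A \<cdot> f) \<otimes>\<^sub>a
      (\<alpha> B B B \<cdot> g \<rhd> B \<cdot> g))"
    by (subst mid_braiding_assoc) (simp_all add: compose_tensor)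
  also have "\<dots> = ?AB \<lhd> ?\<phi> A A B B \<cdot> (?\<phi> A (A \<otimes>\<^sub>o A) B (B \<otimes>\<^sub>o B) \<cdot> ((\<^bold>1 A \<otimes>\<^sub>a f) \<otimes>\<^sub>a (\<^bold>1 B \<otimes>\<^sub>a g))) \<cdot>
      (f \<otimes>\<^sub>a g)"
    unfolding f g by (simp add: lw_def compose_tensor)
  also have "\<dots> = ?AB \<lhd> tensor_comul A f B g \<cdot> tensor_comul A f B g"
    unfolding 2[symmetric] by (simp add: tensor_comul_def whisker_compose(1)) (simp add: lw_def)
  finally show ?thesis .
qed

lemma tensor_comul_counit:
  assumes [simp]: "A \<in> Ob C" "B \<in> Ob C"
    and ar: "f \<in> Hom C A (A \<otimes>\<^sub>o A)" "g \<in> Hom C B (B \<otimes>\<^sub>o B)" "e \<in> Hom C A \<I>" "e' \<in> Hom C B \<I>"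
  shows "\<l> A \<cdot> e \<rhd> A \<cdot> f = \<^bold>1 A \<Longrightarrow> \<l> B \<cdot> e' \<rhd> B \<cdot> g = \<^bold>1 B \<Longrightarrow>
      \<l> (A \<otimes>\<^sub>o B) \<cdot> (\<l> \<I> \<cdot> (e \<otimes>\<^sub>a e')) \<rhd> (A \<otimes>\<^sub>o B) \<cdot> tensor_comul A f B g = \<^bold>1 (A \<otimes>\<^sub>o B)"
    and "\<r> A \<cdot> A \<lhd> e \<cdot> f = \<^bold>1 A \<Longrightarrow> \<r> B \<cdot> B \<lhd> e' \<cdot> g = \<^bold>1 B \<Longrightarrow>
      \<r> (A \<otimes>\<^sub>o B) \<cdot> (A \<otimes>\<^sub>o B) \<lhd> (\<l> \<I> \<cdot> (e \<otimes>\<^sub>a e')) \<cdot> tensor_comul A f B g = \<^bold>1 (A \<otimes>\<^sub>o B)"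
proof -
  note [simp] = ar[simplified]
  let ?AB = "A \<otimes>\<^sub>o B" and ?\<phi> = "mid_braiding C"
  have 1: "((e \<otimes>\<^sub>a e') \<otimes>\<^sub>a (\<^bold>1 A \<otimes>\<^sub>a \<^bold>1 B)) \<cdot> ?\<phi> A A B B = ?\<phi> \<I> A \<I> B \<cdot> ((e \<otimes>\<^sub>a \<^bold>1 A) \<otimes>\<^sub>a (e' \<otimes>\<^sub>a \<^bold>1 B))"
    by (rule mid_braiding_nat[symmetric]) simp_all
  have 2: "((\<^bold>1 A \<otimes>\<^sub>a \<^bold>1 B) \<otimes>\<^sub>a (e \<otimes>\<^sub>a e')) \<cdot> ?\<phi> A A B B = ?\<phi> A \<I> B \<I> \<cdot> ((\<^bold>1 A \<otimes>\<^sub>a e) \<otimes>\<^sub>a (\<^bold>1 B \<otimes>\<^sub>a e'))"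
    by (rule mid_braiding_nat[symmetric]) simp_all
  show "\<l> ?AB \<cdot> (\<l> \<I> \<cdot> (e \<otimes>\<^sub>a e')) \<rhd> ?AB \<cdot> tensor_comul A f B g = \<^bold>1 ?AB"
    if "\<l> A \<cdot> e \<rhd> A \<cdot> f = \<^bold>1 A" "\<l> B \<cdot> e' \<rhd> B \<cdot> g = \<^bold>1 B"
  proof -
    have "\<l> ?AB \<cdot> (\<l> \<I> \<cdot> (e \<otimes>\<^sub>a e')) \<rhd> ?AB \<cdot> tensor_comul A f B g
      = \<l> ?AB \<cdot> \<l> \<I> \<rhd> ?AB \<cdot> (((e \<otimes>\<^sub>a e') \<otimes>\<^sub>a (\<^bold>1 A \<otimes>\<^sub>a \<^bold>1 B)) \<cdot> ?\<phi> A A B B) \<cdot> (f \<otimes>\<^sub>a g)"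
      by (simp add: tensor_comul_def whisker_compose(2)) (simp add: rw_def)
    also have "\<dots> = (\<l> ?AB \<cdot> \<l> \<I> \<rhd> ?AB \<cdot> ?\<phi> \<I> A \<I> B) \<cdot> ((e \<rhd> A \<cdot> f) \<otimes>\<^sub>a (e' \<rhd> B \<cdot> g))"
      unfolding 1 by (simp add: rw_def compose_tensor)
    also have "\<dots> = (\<l> A \<cdot> e \<rhd> A \<cdot> f) \<otimes>\<^sub>a (\<l> B \<cdot> e' \<rhd> B \<cdot> g)"
      by (subst mid_braiding_units) (simp_all add: compose_tensor)
    finally show ?thesis by (simp add: that)
  qed
  show "\<r> ?AB \<cdot> ?AB \<lhd> (\<l> \<I> \<cdot> (e \<otimes>\<^sub>a e')) \<cdot> tensor_comul A f B g = \<^bold>1 ?AB"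
    if "\<r> A \<cdot> A \<lhd> e \<cdot> f = \<^bold>1 A" "\<r> B \<cdot> B \<lhd> e' \<cdot> g = \<^bold>1 B"
  proof -
    have "\<r> ?AB \<cdot> ?AB \<lhd> (\<l> \<I> \<cdot> (e \<otimes>\<^sub>a e')) \<cdot> tensor_comul A f B g
      = \<r> ?AB \<cdot> ?AB \<lhd> \<l> \<I> \<cdot> (((\<^bold>1 A \<otimes>\<^sub>a \<^bold>1 B) \<otimes>\<^sub>a (e \<otimes>\<^sub>a e')) \<cdot> ?\<phi> A A B B) \<cdot> (f \<otimes>\<^sub>a g)"
      by (simp add: tensor_comul_def whisker_compose(1)) (simp add: lw_def)
    also have "\<dots> = (\<r> ?AB \<cdot> ?AB \<lhd> \<l> \<I> \<cdot> ?\<phi> A \<I> B \<I>) \<cdot> ((A \<lhd> e \<cdot> f) \<otimes>\<^sub>a (B \<lhd> e' \<cdot> g))"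
      unfolding 2 by (simp add: lw_def compose_tensor)
    also have "\<dots> = (\<r> A \<cdot> A \<lhd> e \<cdot> f) \<otimes>\<^sub>a (\<r> B \<cdot> B \<lhd> e' \<cdot> g)"
      by (subst mid_braiding_units) (simp_all add: compose_tensor)
    finally show ?thesis by (simp add: that)
  qed
qed

lemma is_coalgebra_tensor:
  assumes "is_coalgebra C X" "is_coalgebra C Y"
  shows "is_coalgebra C (tensor_coalgebra C X Y)"
proof -
  have 1: "comul (tensor_coalgebra C X Y) = tensor_comul (carr X) (comul X) (carr Y) (comul Y)"
    "carr (tensor_coalgebra C X Y) = carr X \<otimes>\<^sub>o carr Y"
    "counit (tensor_coalgebra C X Y) = \<l> \<I> \<cdot> (counit X \<otimes>\<^sub>a counit Y)"
    by (simp_all add: tensor_coalgebra_def tensor_comul_def)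
  note x = assms(1)[unfolded is_coalgebra_def Let_def, folded lw_def rw_def]
  note y = assms(2)[unfolded is_coalgebra_def Let_def, folded lw_def rw_def]
  note [simp] = x[THEN conjunct1] y[THEN conjunct1]
  have "comul X \<in> Hom C (carr X) (carr X \<otimes>\<^sub>o carr X)" "comul Y \<in> Hom C (carr Y) (carr Y \<otimes>\<^sub>o carr Y)"
    "counit X \<in> Hom C (carr X) \<I>" "counit Y \<in> Hom C (carr Y) \<I>"
    using x y by blast+
  note ar = this[simplified] and ar' = this
  show ?thesis
    unfolding is_coalgebra_def Let_def 1 lw_def[symmetric] rw_def[symmetric]
    using tensor_comul_coassoc[OF _ _ ar'(1,2)] tensor_comul_counit[OF _ _ ar'] x y ar
    by simp
qed

text \<open>Coassociativity is tested after the invertible \<open>\<I> \<lhd> \<l> \<I>\<close>,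
  where it becomes the unit coherence.\<close>

lemma is_coalgebra_unit: "is_coalgebra C (unit_coalgebra C)"
proof -
  have "(\<I> \<lhd> \<l> \<I> \<cdot> \<alpha> \<I> \<I> \<I>) \<cdot> left_unitor_inv \<I> \<rhd> \<I> = \<l> \<I> \<rhd> \<I> \<cdot> left_unitor_inv \<I> \<rhd> \<I>"
    by (simp add: left_unitor_rw left_unitor_unit)
  also have "\<dots> = \<^bold>1 (\<I> \<otimes>\<^sub>o \<I>)"
    by (subst whisker_compose(2)[symmetric]) (simp_all add: inv_pair_cancel)
  finally have "\<I> \<lhd> \<l> \<I> \<cdot> (\<alpha> \<I> \<I> \<I> \<cdot> left_unitor_inv \<I> \<rhd> \<I>) = \<I> \<lhd> \<l> \<I> \<cdot> \<I> \<lhd> left_unitor_inv \<I>"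
    by (simp add: inv_pair_cancel)
  hence "\<alpha> \<I> \<I> \<I> \<cdot> left_unitor_inv \<I> \<rhd> \<I> = \<I> \<lhd> left_unitor_inv \<I>"
    by (rule cancel_left[rotated, where b = "\<I> \<lhd> left_unitor_inv \<I>"]) simp_all
  from compose_reduce[OF this, of "left_unitor_inv \<I>"]
  have "\<alpha> \<I> \<I> \<I> \<cdot> left_unitor_inv \<I> \<rhd> \<I> \<cdot> left_unitor_inv \<I> = \<I> \<lhd> left_unitor_inv \<I>
      \<cdot> left_unitor_inv \<I>"
    by simp
  thus ?thesis
    by (simp add: is_coalgebra_def unit_coalgebra_def lw_def rw_def right_unitor_unit
        inv_pair_cancel)
qed

text \<open>Puts the right-hand sides of the unit laws within reach of
  \<open>coalgebra_hom_unique\<close>.\<close>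

lemma unitor_comul_hom:
  assumes [simp]: "B \<in> Ob C" and ar: "g \<in> Hom C B (B \<otimes>\<^sub>o B)"
  shows "g \<cdot> \<l> B = (\<l> B \<otimes>\<^sub>a \<l> B) \<cdot> tensor_comul \<I> (left_unitor_inv \<I>) B g"
    "g \<cdot> \<r> B = (\<r> B \<otimes>\<^sub>a \<r> B) \<cdot> tensor_comul B g \<I> (left_unitor_inv \<I>)"
proof -
  note [simp] = ar[simplified]
  have "(\<l> B \<otimes>\<^sub>a \<l> B) \<cdot> tensor_comul \<I> (left_unitor_inv \<I>) B g
    = ((\<l> B \<otimes>\<^sub>a \<l> B) \<cdot> mid_braiding C \<I> \<I> B B) \<cdot> (left_unitor_inv \<I> \<otimes>\<^sub>a g)"
    by (simp add: tensor_comul_def)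
  also have "\<dots> = \<l> (B \<otimes>\<^sub>o B) \<cdot> \<I> \<lhd> g"
    by (subst mid_braiding_units) (simp_all add: lw_def rw_def compose_tensor inv_pair_cancel)
  also have "\<dots> = g \<cdot> \<l> B" using unitor_natural(1)[of g] by simp
  finally show "g \<cdot> \<l> B = (\<l> B \<otimes>\<^sub>a \<l> B) \<cdot> tensor_comul \<I> (left_unitor_inv \<I>) B g" ..
  have "(\<r> B \<otimes>\<^sub>a \<r> B) \<cdot> tensor_comul B g \<I> (left_unitor_inv \<I>)
    = ((\<r> B \<otimes>\<^sub>a \<r> B) \<cdot> mid_braiding C B B \<I> \<I>) \<cdot> (g \<otimes>\<^sub>a left_unitor_inv \<I>)"
    by (simp add: tensor_comul_def)
  also have "\<dots> = \<r> (B \<otimes>\<^sub>o B) \<cdot> g \<rhd> \<I>"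
    by (subst mid_braiding_units) (simp_all add: lw_def rw_def compose_tensor inv_pair_cancel)
  also have "\<dots> = g \<cdot> \<r> B" using unitor_natural(2)[of g] by simp
  finally show "g \<cdot> \<r> B = (\<r> B \<otimes>\<^sub>a \<r> B) \<cdot> tensor_comul B g \<I> (left_unitor_inv \<I>)" ..
qed

end

section \<open>The bialgebra structure\<close>

locale hopf_tower = cotensor_tower C enc H M
  for C :: "('o, 'a, 'z) braided_category_scheme" (structure) and enc :: "nat \<Rightarrow> 'i"
    and H :: "('o, 'a, 'y) bialgebra_scheme" and M :: "('o, 'a, 'x) hopf_bimodule_scheme" +
  assumes bialgebra: "is_braided_bialgebra C H" and hopf_bimodule: "is_hopf_bimodule C H M"
begin

abbreviation mH :: 'a where "mH \<equiv> mul H"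
abbreviation uH :: 'a where "uH \<equiv> unt H"
abbreviation \<mu>l :: 'a where "\<mu>l \<equiv> lact M"
abbreviation \<mu>r :: 'a where "\<mu>r \<equiv> ract M"

lemma action_simps [simp]:
  "mH \<in> Ar C" "Dom C mH = HO \<otimes>\<^sub>o HO" "Cod C mH = HO" "uH \<in> Ar C" "Dom C uH = \<I>" "Cod C uH = HO"
  "\<mu>l \<in> Ar C" "Dom C \<mu>l = HO \<otimes>\<^sub>o N" "Cod C \<mu>l = N"
  "\<mu>r \<in> Ar C" "Dom C \<mu>r = N \<otimes>\<^sub>o HO" "Cod C \<mu>r = N"
  using bialgebra hopf_bimodule
  by (simp_all add: is_braided_bialgebra_def is_hopf_bimodule_def is_bimodule_def is_algebra_def
      Let_def)

lemma H_algebra: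
  "mH \<cdot> mH \<rhd> HO = mH \<cdot> HO \<lhd> mH \<cdot> \<alpha> HO HO HO" "mH \<cdot> uH \<rhd> HO = \<l> HO" "mH \<cdot> HO \<lhd> uH = \<r> HO"
  using bialgebra by (simp_all add: is_braided_bialgebra_def is_algebra_def Let_def lw_def rw_def)

lemma H_bialgebra:
  "comul H \<cdot> mH = (mH \<otimes>\<^sub>a mH) \<cdot> mid_braiding C HO HO HO HO \<cdot> (comul H \<otimes>\<^sub>a comul H)"
  "counit H \<cdot> mH = \<l> \<I> \<cdot> (counit H \<otimes>\<^sub>a counit H)"
  "comul H \<cdot> uH = (uH \<otimes>\<^sub>a uH) \<cdot> left_unitor_inv \<I>"
  "counit H \<cdot> uH = \<^bold>1 \<I>"
  using bialgebra by (simp_all add: is_braided_bialgebra_def Let_def)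

lemma M_bimodule:
  "\<mu>l \<cdot> mH \<rhd> N = \<mu>l \<cdot> HO \<lhd> \<mu>l \<cdot> \<alpha> HO HO N" "\<mu>l \<cdot> uH \<rhd> N = \<l> N"
  "\<mu>r \<cdot> \<mu>r \<rhd> HO = \<mu>r \<cdot> N \<lhd> mH \<cdot> \<alpha> N HO HO" "\<mu>r \<cdot> N \<lhd> uH = \<r> N"
  "\<mu>r \<cdot> \<mu>l \<rhd> HO = \<mu>l \<cdot> HO \<lhd> \<mu>r \<cdot> \<alpha> HO N HO"
  using hopf_bimodule by (simp_all add: is_hopf_bimodule_def is_bimodule_def Let_def lw_def rw_def)

lemma M_hopf:
  "lcoact M \<cdot> \<mu>l = (mH \<otimes>\<^sub>a \<mu>l) \<cdot> mid_braiding C HO HO HO N \<cdot> (comul H \<otimes>\<^sub>a lcoact M)"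
  "lcoact M \<cdot> \<mu>r = (mH \<otimes>\<^sub>a \<mu>r) \<cdot> mid_braiding C HO N HO HO \<cdot> (lcoact M \<otimes>\<^sub>a comul H)"
  "rcoact M \<cdot> \<mu>l = (\<mu>l \<otimes>\<^sub>a mH) \<cdot> mid_braiding C HO HO N HO \<cdot> (comul H \<otimes>\<^sub>a rcoact M)"
  "rcoact M \<cdot> \<mu>r = (\<mu>r \<otimes>\<^sub>a mH) \<cdot> mid_braiding C N HO HO HO \<cdot> (rcoact M \<otimes>\<^sub>a comul H)"
  using hopf_bimodule by (simp_all add: is_hopf_bimodule_def Let_def)

lemma D_0_1:
  "D 0 0 = comul H" "D 0 (Suc 0) = lcoact M" "D (Suc 0) 0 = rcoact M"
  by (simp_all add: D_0 D_right_0 power_simps)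

section \<open>The multiplication in degrees 0 and 1\<close>

abbreviation comulTT :: 'a where "comulTT \<equiv> tensor_comul TC comulT TC comulT"

definition mul_0 :: 'a where "mul_0 = mH \<cdot> (proj 0 \<otimes>\<^sub>a proj 0)"

definition mul_1 :: 'a where
  "mul_1 = (\<mu>l \<cdot> (proj 0 \<otimes>\<^sub>a proj (Suc 0))) \<boxplus> (\<mu>r \<cdot> (proj (Suc 0) \<otimes>\<^sub>a proj 0))"

lemma mul_simps [simp]:
  "mul_0 \<in> Ar C" "Dom C mul_0 = TC \<otimes>\<^sub>o TC" "Cod C mul_0 = HO"
  "mul_1 \<in> Ar C" "Dom C mul_1 = TC \<otimes>\<^sub>o TC" "Cod C mul_1 = N"
  by (simp_all add: mul_0_def mul_1_def)

text \<open>Moves the projections through the comultiplication of the tensor square. What stands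
  before them is, for suitable \<open>x\<close> and \<open>y\<close>, the right-hand side of a
  bialgebra or Hopf bimodule axiom.\<close>

lemma proj_comulTT:
  assumes "x \<in> Ar C" "Dom C x = T a \<otimes>\<^sub>o T b" "y \<in> Ar C" "Dom C y = T c \<otimes>\<^sub>o T d"
  shows "((x \<cdot> (proj a \<otimes>\<^sub>a proj b)) \<otimes>\<^sub>a (y \<cdot> (proj c \<otimes>\<^sub>a proj d))) \<cdot> comulTT
    = (x \<otimes>\<^sub>a y) \<cdot> mid_braiding C (T a) (T c) (T b) (T d) \<cdot> (D a c \<otimes>\<^sub>a D b d) \<cdot> (proj (a + c) \<otimes>\<^sub>a proj
        (b + d))"
proof -
  have 1: "((proj a \<otimes>\<^sub>a proj b) \<otimes>\<^sub>a (proj c \<otimes>\<^sub>a proj d)) \<cdot> mid_braiding C TC TC TC TC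
    = mid_braiding C (T a) (T c) (T b) (T d) \<cdot> ((proj a \<otimes>\<^sub>a proj c) \<otimes>\<^sub>a (proj b \<otimes>\<^sub>a proj d))"
    by (rule mid_braiding_nat[symmetric]) simp_all
  have "((x \<cdot> (proj a \<otimes>\<^sub>a proj b)) \<otimes>\<^sub>a (y \<cdot> (proj c \<otimes>\<^sub>a proj d))) \<cdot> comulTT
    = (x \<otimes>\<^sub>a y) \<cdot> (((proj a \<otimes>\<^sub>a proj b) \<otimes>\<^sub>a (proj c \<otimes>\<^sub>a proj d)) \<cdot> mid_braiding C TC TC TC TC) \<cdot>
        (comulT \<otimes>\<^sub>a comulT)"
    using assms compose_reduce[OF compose_tensor[of "proj a \<otimes>\<^sub>a proj b" x
        "proj c \<otimes>\<^sub>a proj d" y], of comulTT]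
    by (simp add: tensor_comul_def)
  also have "\<dots> = (x \<otimes>\<^sub>a y) \<cdot> mid_braiding C (T a) (T c) (T b) (T d)
      \<cdot> (((proj a \<otimes>\<^sub>a proj c) \<cdot> comulT) \<otimes>\<^sub>a ((proj b \<otimes>\<^sub>a proj d) \<cdot> comulT))"
    unfolding 1 using assms by (simp add: compose_tensor)
  also have "\<dots> = (x \<otimes>\<^sub>a y) \<cdot> mid_braiding C (T a) (T c) (T b) (T d) \<cdot> (D a c \<otimes>\<^sub>a D b d) \<cdot> (proj
      (a + c) \<otimes>\<^sub>a proj (b + d))"
    using assms by (simp add: proj_comul compose_tensor)
  finally show ?thesis .
qed

lemma mul_0_comul: "comul H \<cdot> mul_0 = (mul_0 \<otimes>\<^sub>a mul_0) \<cdot> comulTT"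
proof -
  have "(mul_0 \<otimes>\<^sub>a mul_0) \<cdot> comulTT
    = ((mH \<otimes>\<^sub>a mH) \<cdot> mid_braiding C HO HO HO HO \<cdot> (comul H \<otimes>\<^sub>a comul H)) \<cdot> (proj 0 \<otimes>\<^sub>a proj 0)"
    using proj_comulTT[of mH 0 0 mH 0 0] by (simp add: mul_0_def D_0_1)
  also have "\<dots> = comul H \<cdot> mul_0" unfolding H_bialgebra(1)[symmetric] by (simp add: mul_0_def)
  finally show ?thesis ..
qed

text \<open>Each summand of \<open>mul_1\<close> uses one of the two Hopf bimodule axioms for the
  left coaction, the one for its own action.\<close>

lemma mul_1_lcoact: "lcoact M \<cdot> mul_1 = (mul_0 \<otimes>\<^sub>a mul_1) \<cdot> comulTT"
proof -
  have "(mul_0 \<otimes>\<^sub>a (\<mu>l \<cdot> (proj 0 \<otimes>\<^sub>a proj (Suc 0)))) \<cdot> comulTT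
    = ((mH \<otimes>\<^sub>a \<mu>l) \<cdot> mid_braiding C HO HO HO N \<cdot> (comul H \<otimes>\<^sub>a lcoact M)) \<cdot> (proj 0 \<otimes>\<^sub>a proj (Suc 0))"
    using proj_comulTT[of mH 0 0 \<mu>l 0 "Suc 0"] by (simp add: mul_0_def D_0_1)
  also have "\<dots> = lcoact M \<cdot> (\<mu>l \<cdot> (proj 0 \<otimes>\<^sub>a proj (Suc 0)))" unfolding M_hopf(1)[symmetric] by simp
  finally have 1: "(mul_0 \<otimes>\<^sub>a (\<mu>l \<cdot> (proj 0 \<otimes>\<^sub>a proj (Suc 0)))) \<cdot> comulTT = lcoact M \<cdot> (\<mu>l \<cdot>
      (proj 0 \<otimes>\<^sub>a proj (Suc 0)))" .
  have "(mul_0 \<otimes>\<^sub>a (\<mu>r \<cdot> (proj (Suc 0) \<otimes>\<^sub>a proj 0))) \<cdot> comulTT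
    = ((mH \<otimes>\<^sub>a \<mu>r) \<cdot> mid_braiding C HO N HO HO \<cdot> (lcoact M \<otimes>\<^sub>a comul H)) \<cdot> (proj (Suc 0) \<otimes>\<^sub>a proj 0)"
    using proj_comulTT[of mH 0 0 \<mu>r "Suc 0" 0] by (simp add: mul_0_def D_0_1)
  also have "\<dots> = lcoact M \<cdot> (\<mu>r \<cdot> (proj (Suc 0) \<otimes>\<^sub>a proj 0))" unfolding M_hopf(2)[symmetric] by simp
  finally have 2: "(mul_0 \<otimes>\<^sub>a (\<mu>r \<cdot> (proj (Suc 0) \<otimes>\<^sub>a proj 0))) \<cdot> comulTT = lcoact M \<cdot> (\<mu>r \<cdot> (proj
      (Suc 0) \<otimes>\<^sub>a proj 0))" .
  show ?thesis
    using 1 2 by (simp add: mul_1_def tensor_add compose_add)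
qed

lemma mul_1_rcoact: "rcoact M \<cdot> mul_1 = (mul_1 \<otimes>\<^sub>a mul_0) \<cdot> comulTT"
proof -
  have "((\<mu>l \<cdot> (proj 0 \<otimes>\<^sub>a proj (Suc 0))) \<otimes>\<^sub>a mul_0) \<cdot> comulTT
    = ((\<mu>l \<otimes>\<^sub>a mH) \<cdot> mid_braiding C HO HO N HO \<cdot> (comul H \<otimes>\<^sub>a rcoact M)) \<cdot> (proj 0 \<otimes>\<^sub>a proj (Suc 0))"
    using proj_comulTT[of \<mu>l 0 "Suc 0" mH 0 0] by (simp add: mul_0_def D_0_1)
  also have "\<dots> = rcoact M \<cdot> (\<mu>l \<cdot> (proj 0 \<otimes>\<^sub>a proj (Suc 0)))" unfolding M_hopf(3)[symmetric] by simp
  finally have 1: "((\<mu>l \<cdot> (proj 0 \<otimes>\<^sub>a proj (Suc 0))) \<otimes>\<^sub>a mul_0) \<cdot> comulTT = rcoact M \<cdot> (\<mu>l \<cdot>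
      (proj 0 \<otimes>\<^sub>a proj (Suc 0)))" .
  have "((\<mu>r \<cdot> (proj (Suc 0) \<otimes>\<^sub>a proj 0)) \<otimes>\<^sub>a mul_0) \<cdot> comulTT
    = ((\<mu>r \<otimes>\<^sub>a mH) \<cdot> mid_braiding C N HO HO HO \<cdot> (rcoact M \<otimes>\<^sub>a comul H)) \<cdot> (proj (Suc 0) \<otimes>\<^sub>a proj 0)"
    using proj_comulTT[of \<mu>r "Suc 0" 0 mH 0 0] by (simp add: mul_0_def D_0_1)
  also have "\<dots> = rcoact M \<cdot> (\<mu>r \<cdot> (proj (Suc 0) \<otimes>\<^sub>a proj 0))" unfolding M_hopf(4)[symmetric] by simp
  finally have 2: "((\<mu>r \<cdot> (proj (Suc 0) \<otimes>\<^sub>a proj 0)) \<otimes>\<^sub>a mul_0) \<cdot> comulTT = rcoact M \<cdot> (\<mu>r \<cdot> (proj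
      (Suc 0) \<otimes>\<^sub>a proj 0))" .
  show ?thesis
    using 1 2 by (simp add: mul_1_def tensor_add compose_add)
qed

section \<open>Degrees under the comultiplication of the tensor square\<close>

lemma comulT_inc_induct:
  assumes "\<And>s. s \<le> n \<Longrightarrow> P (comul_summand n s)" "P (zero_ar C (T n) (TC \<otimes>\<^sub>o TC))"
    "\<And>g h. g \<in> Hom C (T n) (TC \<otimes>\<^sub>o TC) \<Longrightarrow> h \<in> Hom C (T n) (TC \<otimes>\<^sub>o TC) \<Longrightarrow> P g \<Longrightarrow> P h \<Longrightarrow> P (g \<boxplus> h)"
  shows "P (comulT \<cdot> inc n)"
  unfolding comulT_spec(2)
  by (rule conjunct2, rule finprod_Hom_induct) (use assms in simp_all)

text \<open>The comultiplications of both factors are sums; two nested inductions reduce the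
  vanishing to single pairs of summands.\<close>

lemma comulT_inc_vanish:
  assumes w [simp]: "w \<in> Ar C" "Dom C w = (TC \<otimes>\<^sub>o TC) \<otimes>\<^sub>o (TC \<otimes>\<^sub>o TC)" "Cod C w = Z"
    and vanish: "\<And>s t. s \<le> a \<Longrightarrow> t \<le> b \<Longrightarrow> w \<cdot> ((inc s \<otimes>\<^sub>a inc (a - s)) \<otimes>\<^sub>a (inc t \<otimes>\<^sub>a inc (b - t)))
      = zero_ar C ((T s \<otimes>\<^sub>o T (a - s)) \<otimes>\<^sub>o (T t \<otimes>\<^sub>o T (b - t))) Z"
  shows "w \<cdot> ((comulT \<cdot> inc a) \<otimes>\<^sub>a (comulT \<cdot> inc b)) = zero_ar C (T a \<otimes>\<^sub>o T b) Z"
proof (rule comulT_inc_induct[of a "\<lambda>x. w \<cdot> (x \<otimes>\<^sub>a (comulT \<cdot> inc b)) = zero_ar C (T a \<otimes>\<^sub>o T b) Z"])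
  have [simp]: "Z \<in> Ob C" using Cod_Ob[of w] by simp
  fix s assume s: "s \<le> a"
  show "w \<cdot> (comul_summand a s \<otimes>\<^sub>a (comulT \<cdot> inc b)) = zero_ar C (T a \<otimes>\<^sub>o T b) Z"
  proof (rule comulT_inc_induct[of b "\<lambda>x. w \<cdot> (comul_summand a s \<otimes>\<^sub>a x) = zero_ar C (T a \<otimes>\<^sub>o T b) Z"])
    fix t assume t: "t \<le> b"
    have "w \<cdot> (comul_summand a s \<otimes>\<^sub>a comul_summand b t)
      = (w \<cdot> ((inc s \<otimes>\<^sub>a inc (a - s)) \<otimes>\<^sub>a (inc t \<otimes>\<^sub>a inc (b - t)))) \<cdot> (D s (a - s) \<otimes>\<^sub>a D t (b - t))"
      using s t by (simp add: compose_tensor)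
    thus "w \<cdot> (comul_summand a s \<otimes>\<^sub>a comul_summand b t) = zero_ar C (T a \<otimes>\<^sub>o T b) Z"
      unfolding vanish[OF s t] using s t by simp
  next
    show "w \<cdot> (comul_summand a s \<otimes>\<^sub>a (g \<boxplus> h)) = zero_ar C (T a \<otimes>\<^sub>o T b) Z"
      if "g \<in> Hom C (T b) (TC \<otimes>\<^sub>o TC)" "h \<in> Hom C (T b) (TC \<otimes>\<^sub>o TC)"
        "w \<cdot> (comul_summand a s \<otimes>\<^sub>a g) = zero_ar C (T a \<otimes>\<^sub>o T b) Z"
        "w \<cdot> (comul_summand a s \<otimes>\<^sub>a h) = zero_ar C (T a \<otimes>\<^sub>o T b) Z" for g h
      using that s by (simp add: tensor_add compose_add)
  qed (use s in simp_all)
next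
  have [simp]: "Z \<in> Ob C" using Cod_Ob[of w] by simp
  show "w \<cdot> (zero_ar C (T a) (TC \<otimes>\<^sub>o TC) \<otimes>\<^sub>a (comulT \<cdot> inc b)) = zero_ar C (T a \<otimes>\<^sub>o T b) Z" by simp
  show "w \<cdot> ((g \<boxplus> h) \<otimes>\<^sub>a (comulT \<cdot> inc b)) = zero_ar C (T a \<otimes>\<^sub>o T b) Z"
    if "g \<in> Hom C (T a) (TC \<otimes>\<^sub>o TC)" "h \<in> Hom C (T a) (TC \<otimes>\<^sub>o TC)"
      "w \<cdot> (g \<otimes>\<^sub>a (comulT \<cdot> inc b)) = zero_ar C (T a \<otimes>\<^sub>o T b) Z"
      "w \<cdot> (h \<otimes>\<^sub>a (comulT \<cdot> inc b)) = zero_ar C (T a \<otimes>\<^sub>o T b) Z" for g h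
    using that by (simp add: tensor_add compose_add)
qed

text \<open>Supplies the hypothesis \<open>graded\<close> of \<open>coalgebra_lift\<close> for the
  tensor square, a pair of degrees counting with its sum.\<close>

lemma comulTT_graded:
  assumes [simp]: "f \<in> Ar C" "g \<in> Ar C" "Dom C f = TC \<otimes>\<^sub>o TC" "Dom C g = TC \<otimes>\<^sub>o TC"
    and f: "\<And>s t. s + t \<noteq> p \<Longrightarrow> f \<cdot> (inc s \<otimes>\<^sub>a inc t) = zero_ar C (T s \<otimes>\<^sub>o T t) (Cod C f)"
    and g: "\<And>s t. s + t \<noteq> q \<Longrightarrow> g \<cdot> (inc s \<otimes>\<^sub>a inc t) = zero_ar C (T s \<otimes>\<^sub>o T t) (Cod C g)"
    and ab: "a + b \<noteq> p + q"
  shows "(f \<otimes>\<^sub>a g) \<cdot> comulTT \<cdot> (inc a \<otimes>\<^sub>a inc b) = zero_ar C (T a \<otimes>\<^sub>o T b) (Cod C f \<otimes>\<^sub>o Cod C g)"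
proof -
  let ?w = "(f \<otimes>\<^sub>a g) \<cdot> mid_braiding C TC TC TC TC"
  have "(f \<otimes>\<^sub>a g) \<cdot> comulTT \<cdot> (inc a \<otimes>\<^sub>a inc b) = ?w \<cdot> ((comulT \<cdot> inc a) \<otimes>\<^sub>a (comulT \<cdot> inc b))"
    by (simp add: tensor_comul_def compose_tensor)
  also have "\<dots> = zero_ar C (T a \<otimes>\<^sub>o T b) (Cod C f \<otimes>\<^sub>o Cod C g)"
  proof (rule comulT_inc_vanish)
    fix s t assume st: "s \<le> a" "t \<le> b"
    have 1: "mid_braiding C TC TC TC TC \<cdot> ((inc s \<otimes>\<^sub>a inc (a - s)) \<otimes>\<^sub>a (inc t \<otimes>\<^sub>a inc (b - t)))
      = ((inc s \<otimes>\<^sub>a inc t) \<otimes>\<^sub>a (inc (a - s) \<otimes>\<^sub>a inc (b - t))) \<cdot> mid_braiding C (T s) (T (a - s))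
          (T t) (T (b - t))"
      by (rule mid_braiding_nat) simp_all
    have "?w \<cdot> ((inc s \<otimes>\<^sub>a inc (a - s)) \<otimes>\<^sub>a (inc t \<otimes>\<^sub>a inc (b - t)))
      = (f \<otimes>\<^sub>a g) \<cdot> (mid_braiding C TC TC TC TC \<cdot> ((inc s \<otimes>\<^sub>a inc (a - s)) \<otimes>\<^sub>a (inc t \<otimes>\<^sub>a inc
          (b - t))))"
      by simp
    also have "\<dots> = ((f \<cdot> (inc s \<otimes>\<^sub>a inc t)) \<otimes>\<^sub>a (g \<cdot> (inc (a - s) \<otimes>\<^sub>a inc (b - t))))
        \<cdot> mid_braiding C (T s) (T (a - s)) (T t) (T (b - t))"
      unfolding 1 using compose_reduce[OF compose_tensor[of "inc s \<otimes>\<^sub>a inc t" f "inc (a - s) \<otimes>\<^sub>a inc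
          (b - t)" g],
          of "mid_braiding C (T s) (T (a - s)) (T t) (T (b - t))"] by simp
    \<comment> \<open>The total degree splits into \<open>s + t\<close> and the rest; if the first
      part equals \<open>p\<close>, the rest differs from \<open>q\<close>, so one of the two
      factors vanishes.\<close>
    also have "\<dots> = zero_ar C ((T s \<otimes>\<^sub>o T (a - s)) \<otimes>\<^sub>o (T t \<otimes>\<^sub>o T (b - t))) (Cod C f \<otimes>\<^sub>o Cod C g)"
    proof (cases "s + t = p")
      case True
      hence "(a - s) + (b - t) \<noteq> q" using ab st by auto
      thus ?thesis by (simp add: g)
    next
      case False
      thus ?thesis by (simp add: f)
    qed
    finally show "?w \<cdot> ((inc s \<otimes>\<^sub>a inc (a - s)) \<otimes>\<^sub>a (inc t \<otimes>\<^sub>a inc (b - t)))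
      = zero_ar C ((T s \<otimes>\<^sub>o T (a - s)) \<otimes>\<^sub>o (T t \<otimes>\<^sub>o T (b - t))) (Cod C f \<otimes>\<^sub>o Cod C g)" .
  qed simp_all
  finally show ?thesis .
qed

text \<open>The last conjunct is homogeneity. The projections to degrees 0 and 1 do not display it,
  so it is kept for the grading.\<close>

lemma multiplication_exists:
  "\<exists>m. m \<in> Hom C (TC \<otimes>\<^sub>o TC) TC \<and> comulT \<cdot> m = (m \<otimes>\<^sub>a m) \<cdot> comulTT \<and> proj 0 \<cdot> m = mul_0 \<and> proj
      (Suc 0) \<cdot> m = mul_1
    \<and> (\<forall>a b. m \<cdot> (inc a \<otimes>\<^sub>a inc b) = inc (a + b) \<cdot> (proj (a + b) \<cdot> (m \<cdot> (inc a \<otimes>\<^sub>a inc b))))"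
proof -
  let ?\<iota> = "\<lambda>(a, b). inc a \<otimes>\<^sub>a inc b" and ?X = "\<lambda>(a, b). T a \<otimes>\<^sub>o T b" and ?deg =
      "\<lambda>(a, b). a + b :: nat"
  have "\<exists>h. h \<in> Hom C (TC \<otimes>\<^sub>o TC) TC \<and> comulT \<cdot> h = (h \<otimes>\<^sub>a h) \<cdot> comulTT \<and> proj 0 \<cdot> h = mul_0 \<and> proj
      (Suc 0) \<cdot> h = mul_1
    \<and> (\<forall>j. h \<cdot> ?\<iota> j = inc (?deg j) \<cdot> (proj (?deg j) \<cdot> (h \<cdot> ?\<iota> j)))"
  proof (rule coalgebra_lift[OF _ _ _ _ _ mul_0_comul mul_1_lcoact mul_1_rcoact TC_pair_coproduct])
    show "\<alpha> (TC \<otimes>\<^sub>o TC) (TC \<otimes>\<^sub>o TC) (TC \<otimes>\<^sub>o TC) \<cdot> comulTT \<rhd> (TC \<otimes>\<^sub>o TC) \<cdot> comulTT =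
        (TC \<otimes>\<^sub>o TC) \<lhd> comulTT \<cdot> comulTT"
      by (rule tensor_comul_coassoc) (simp_all add: comulT_coassoc)
    show "mul_0 \<cdot> ?\<iota> k = zero_ar C (?X k) HO" if "?deg k \<noteq> 0" for k
      using that by (cases k) (auto simp: mul_0_def compose_tensor proj_spec(2))
    show "mul_1 \<cdot> ?\<iota> k = zero_ar C (?X k) N" if "?deg k \<noteq> Suc 0" for k
      using that by (cases k) (auto simp: mul_1_def compose_tensor compose_add proj_spec(2))
    show "(f \<otimes>\<^sub>a g) \<cdot> comulTT \<cdot> ?\<iota> j = zero_ar C (?X j) (Cod C f \<otimes>\<^sub>o Cod C g)"
      if "f \<in> Ar C" "g \<in> Ar C" "Dom C f = TC \<otimes>\<^sub>o TC" "Dom C g = TC \<otimes>\<^sub>o TC"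
        "\<And>k. ?deg k \<noteq> p \<Longrightarrow> f \<cdot> ?\<iota> k = zero_ar C (?X k) (Cod C f)"
        "\<And>k. ?deg k \<noteq> q \<Longrightarrow> g \<cdot> ?\<iota> k = zero_ar C (?X k) (Cod C g)" "?deg j \<noteq> p + q" for f g p q j
      using comulTT_graded[OF that(1-4), of p q "fst j" "snd j"] that(5)[of "(_, _)"] that(6)[of
          "(_, _)"] that(7)
      by (cases j) simp
  qed simp_all
  thus ?thesis by simp
qed

text \<open>Any candidate will do at this point; \<open>mulT_unique\<close> shows that there is only
  one.\<close>

definition mulT :: 'a where
  "mulT = (SOME m. m \<in> Hom C (TC \<otimes>\<^sub>o TC) TC \<and> comulT \<cdot> m = (m \<otimes>\<^sub>a m) \<cdot> comulTT \<and> proj 0 \<cdot> m = mul_0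
      \<and> proj (Suc 0) \<cdot> m = mul_1
    \<and> (\<forall>a b. m \<cdot> (inc a \<otimes>\<^sub>a inc b) = inc (a + b) \<cdot> (proj (a + b) \<cdot> (m \<cdot> (inc a \<otimes>\<^sub>a inc b)))))"

lemma mulT:
  "mulT \<in> Hom C (TC \<otimes>\<^sub>o TC) TC" "comulT \<cdot> mulT = (mulT \<otimes>\<^sub>a mulT) \<cdot> comulTT" "proj 0 \<cdot> mulT = mul_0"
      "proj (Suc 0) \<cdot> mulT = mul_1"
  "mulT \<cdot> (inc a \<otimes>\<^sub>a inc b) = inc (a + b) \<cdot> (proj (a + b) \<cdot> (mulT \<cdot> (inc a \<otimes>\<^sub>a inc b)))"
  using someI_ex[OF multiplication_exists] unfolding mulT_def[symmetric] by blast+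

lemma mulT_simps [simp]: "mulT \<in> Ar C" "Dom C mulT = TC \<otimes>\<^sub>o TC" "Cod C mulT = TC"
  using mulT(1) by simp_all

text \<open>In degree 0 the comultiplication of \<open>TC\<close> restricts to that of
  \<open>H\<close>, so the unit of \<open>H\<close> placed there can be written down directly
  instead of being lifted.\<close>

definition unitT :: 'a where "unitT = inc 0 \<cdot> uH"

lemma unitT_simps [simp]: "unitT \<in> Ar C" "Dom C unitT = \<I>" "Cod C unitT = TC"
  by (simp_all add: unitT_def)

lemma unitT:
  "comulT \<cdot> unitT = (unitT \<otimes>\<^sub>a unitT) \<cdot> left_unitor_inv \<I>" "proj 0 \<cdot> unitT = uH"
  "proj (Suc 0) \<cdot> unitT = zero_ar C \<I> N"
proof -
  have "comulT \<cdot> inc 0 = (inc 0 \<otimes>\<^sub>a inc 0) \<cdot> comul H"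
    unfolding comulT_spec(2) using finprod_single[of "T 0" "TC \<otimes>\<^sub>o TC" "{..0}" 0 "comul_summand 0"]
    by (simp add: D_0_1)
  from compose_reduce[OF this, of uH] have "comulT \<cdot> unitT = (inc 0 \<otimes>\<^sub>a inc 0) \<cdot> (comul H \<cdot> uH)"
    by (simp add: unitT_def)
  thus "comulT \<cdot> unitT = (unitT \<otimes>\<^sub>a unitT) \<cdot> left_unitor_inv \<I>"
    unfolding H_bialgebra(3)
    using compose_reduce[OF compose_tensor[of uH "inc 0" uH "inc 0"], of "left_unitor_inv \<I>"] by
        (simp add: unitT_def)
  show "proj 0 \<cdot> unitT = uH" "proj (Suc 0) \<cdot> unitT = zero_ar C \<I> N"
    using compose_reduce[OF proj_spec(2)[of 0 0], of uH] compose_reduce[OF proj_spec(2)[of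
        "Suc 0" 0], of uH]
    by (simp_all add: unitT_def)
qed

section \<open>Associativity and unit laws\<close>

lemma proj_mulT:
  assumes "x \<in> Ar C" "y \<in> Ar C" "Cod C x = TC" "Cod C y = TC"
  shows "proj 0 \<cdot> mulT \<cdot> (x \<otimes>\<^sub>a y) = mH \<cdot> ((proj 0 \<cdot> x) \<otimes>\<^sub>a (proj 0 \<cdot> y))"
    "proj (Suc 0) \<cdot> mulT \<cdot> (x \<otimes>\<^sub>a y) = (\<mu>l \<cdot> ((proj 0 \<cdot> x) \<otimes>\<^sub>a (proj (Suc 0) \<cdot> y)))
      \<boxplus> (\<mu>r \<cdot> ((proj (Suc 0) \<cdot> x) \<otimes>\<^sub>a (proj 0 \<cdot> y)))"
  using compose_reduce[OF mulT(3), of "x \<otimes>\<^sub>a y"] compose_reduce[OF mulT(4), of "x \<otimes>\<^sub>a y"] assms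
  by (simp_all add: mul_0_def mul_1_def compose_add compose_tensor)

text \<open>Compatibility with comultiplications passes from \<open>k\<close> and \<open>l\<close>
  to their product. This covers both bracketings of a triple product and the products with the
  unit.\<close>

lemma mulT_comul:
  assumes "A \<in> Ob C" "B \<in> Ob C" "k \<in> Hom C A TC" "l \<in> Hom C B TC" "f \<in> Hom C A (A \<otimes>\<^sub>o A)"
      "g \<in> Hom C B (B \<otimes>\<^sub>o B)"
    "comulT \<cdot> k = (k \<otimes>\<^sub>a k) \<cdot> f" "comulT \<cdot> l = (l \<otimes>\<^sub>a l) \<cdot> g"
  shows "comulT \<cdot> (mulT \<cdot> (k \<otimes>\<^sub>a l)) = ((mulT \<cdot> (k \<otimes>\<^sub>a l)) \<otimes>\<^sub>a (mulT \<cdot> (k \<otimes>\<^sub>a l)))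
      \<cdot> tensor_comul A f B g"
proof -
  have "comulT \<cdot> (mulT \<cdot> (k \<otimes>\<^sub>a l)) = (mulT \<otimes>\<^sub>a mulT) \<cdot> (comulTT \<cdot> (k \<otimes>\<^sub>a l))"
    using compose_reduce[OF mulT(2), of "k \<otimes>\<^sub>a l"] assms(1-6) by simp
  also have "comulTT \<cdot> (k \<otimes>\<^sub>a l) = ((k \<otimes>\<^sub>a l) \<otimes>\<^sub>a (k \<otimes>\<^sub>a l)) \<cdot> tensor_comul A f B g"
    by (rule tensor_comul_hom) (use assms in simp_all)
  finally show ?thesis
    using compose_reduce[OF compose_tensor[of "k \<otimes>\<^sub>a l" mulT "k \<otimes>\<^sub>a l" mulT], of
        "tensor_comul A f B g"] assms(1-6)
    by simp
qed

lemma mulT_assoc: "mulT \<cdot> mulT \<rhd> TC = mulT \<cdot> TC \<lhd> mulT \<cdot> \<alpha> TC TC TC"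
proof -
  \<comment> \<open>Both sides are compared on the cube bracketed to the left; the right-hand side
    reaches it through \<open>\<alpha>\<close> and \<open>tensor_comul_assoc\<close>.\<close>
  let ?\<delta> = "tensor_comul (TC \<otimes>\<^sub>o TC) comulTT TC comulT"
  let ?g = "mulT \<cdot> (\<^bold>1 TC \<otimes>\<^sub>a mulT)"
  have "mulT \<cdot> (mulT \<otimes>\<^sub>a \<^bold>1 TC) = ?g \<cdot> \<alpha> TC TC TC"
  proof (rule coalgebra_hom_unique)
    show "?\<delta> \<in> Hom C ((TC \<otimes>\<^sub>o TC) \<otimes>\<^sub>o TC) (((TC \<otimes>\<^sub>o TC) \<otimes>\<^sub>o TC) \<otimes>\<^sub>o ((TC \<otimes>\<^sub>o TC) \<otimes>\<^sub>o TC))" by simp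
    show "comulT \<cdot> (mulT \<cdot> (mulT \<otimes>\<^sub>a \<^bold>1 TC)) = ((mulT \<cdot> (mulT \<otimes>\<^sub>a \<^bold>1 TC)) \<otimes>\<^sub>a (mulT \<cdot> (mulT \<otimes>\<^sub>a \<^bold>1 TC)))
        \<cdot> ?\<delta>"
      by (rule mulT_comul) (simp_all add: mulT(2))
    have "comulT \<cdot> ?g = (?g \<otimes>\<^sub>a ?g) \<cdot> tensor_comul TC comulT (TC \<otimes>\<^sub>o TC) comulTT"
      by (rule mulT_comul) (simp_all add: mulT(2))
    from compose_reduce[OF this, of "\<alpha> TC TC TC"]
    have "comulT \<cdot> (?g \<cdot> \<alpha> TC TC TC) = (?g \<otimes>\<^sub>a ?g) \<cdot> (tensor_comul TC comulT (TC \<otimes>\<^sub>o TC) comulTT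
        \<cdot> \<alpha> TC TC TC)"
      by simp
    also have "\<dots> = ((?g \<cdot> \<alpha> TC TC TC) \<otimes>\<^sub>a (?g \<cdot> \<alpha> TC TC TC)) \<cdot> ?\<delta>"
      using compose_reduce[OF compose_tensor[of "\<alpha> TC TC TC" ?g "\<alpha> TC TC TC" ?g], of ?\<delta>]
      by (subst tensor_comul_assoc) simp_all
    finally show "comulT \<cdot> (?g \<cdot> \<alpha> TC TC TC) = ((?g \<cdot> \<alpha> TC TC TC) \<otimes>\<^sub>a (?g \<cdot> \<alpha> TC TC TC)) \<cdot> ?\<delta>" .
    have nat: "(proj a \<otimes>\<^sub>a (proj b \<otimes>\<^sub>a proj c)) \<cdot> \<alpha> TC TC TC = \<alpha> (T a) (T b) (T c) \<cdot>
        ((proj a \<otimes>\<^sub>a proj b) \<otimes>\<^sub>a proj c)" for a b c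
      using assoc_nat_ar[of "proj a" "proj b" "proj c"] by simp
    \<comment> \<open>\<open>L\<close> and \<open>R\<close> collect the projections at the right
      end, so that the axioms of \<open>H\<close> and \<open>M\<close> apply to what stands before
      them.\<close>
    have L: "x \<cdot> (((y \<cdot> (proj a \<otimes>\<^sub>a proj b)) \<otimes>\<^sub>a proj c)) = (x \<cdot> y \<rhd> T c) \<cdot>
        ((proj a \<otimes>\<^sub>a proj b) \<otimes>\<^sub>a proj c)"
      if "y \<in> Hom C (T a \<otimes>\<^sub>o T b) Y" "x \<in> Hom C (Y \<otimes>\<^sub>o T c) Z" for x y a b c Y Z
      using that Cod_Ob[of y] by (simp add: rw_def compose_tensor)
    have R: "x \<cdot> (proj a \<otimes>\<^sub>a (y \<cdot> (proj b \<otimes>\<^sub>a proj c))) \<cdot> \<alpha> TC TC TC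
       = (x \<cdot> T a \<lhd> y \<cdot> \<alpha> (T a) (T b) (T c)) \<cdot> ((proj a \<otimes>\<^sub>a proj b) \<otimes>\<^sub>a proj c)"
      if "y \<in> Hom C (T b \<otimes>\<^sub>o T c) Y" "x \<in> Hom C (T a \<otimes>\<^sub>o Y) Z" for x y a b c Y Z
    proof -
      have "x \<cdot> (proj a \<otimes>\<^sub>a (y \<cdot> (proj b \<otimes>\<^sub>a proj c))) \<cdot> \<alpha> TC TC TC
        = x \<cdot> T a \<lhd> y \<cdot> ((proj a \<otimes>\<^sub>a (proj b \<otimes>\<^sub>a proj c)) \<cdot> \<alpha> TC TC TC)"
        using that compose_reduce[OF compose_tensor[of "proj a" "\<^bold>1 (T a)"
            "proj b \<otimes>\<^sub>a proj c" y], of "\<alpha> TC TC TC"]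
        by (simp add: lw_def)
      thus ?thesis using that Cod_Ob[of y] by (simp add: nat)
    qed
    show "proj 0 \<cdot> (mulT \<cdot> (mulT \<otimes>\<^sub>a \<^bold>1 TC)) = proj 0 \<cdot> (?g \<cdot> \<alpha> TC TC TC)"
    proof -
      have "proj 0 \<cdot> (mulT \<cdot> (mulT \<otimes>\<^sub>a \<^bold>1 TC)) = mH \<cdot> (mul_0 \<otimes>\<^sub>a proj 0)"
        by (simp add: proj_mulT mulT)
      also have "\<dots> = mH \<cdot> (proj 0 \<otimes>\<^sub>a mul_0) \<cdot> \<alpha> TC TC TC"
        unfolding mul_0_def by (subst L[of _ _ _ HO], simp, simp, subst R[of _ _ _ HO], simp,
            simp) (simp only: T_0_1 H_algebra)
      also have "\<dots> = proj 0 \<cdot> (?g \<cdot> \<alpha> TC TC TC)"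
        using compose_reduce[OF proj_mulT(1)[of "\<^bold>1 TC" mulT, simplified assoc_compose], of
            "\<alpha> TC TC TC"]
        by (simp add: mulT)
      finally show ?thesis .
    qed
    show "proj (Suc 0) \<cdot> (mulT \<cdot> (mulT \<otimes>\<^sub>a \<^bold>1 TC)) = proj (Suc 0) \<cdot> (?g \<cdot> \<alpha> TC TC TC)"
    proof -
      let ?l = "\<mu>l \<cdot> (proj 0 \<otimes>\<^sub>a proj (Suc 0))" and ?r = "\<mu>r \<cdot> (proj (Suc 0) \<otimes>\<^sub>a proj 0)"
      \<comment> \<open>Degree 1 of a triple product has three terms, with the factor from
        \<open>M\<close> in the last, middle or first place. They correspond to the left, mixed and
        right associativity of the bimodule.\<close>
      have 1: "\<mu>l \<cdot> (mul_0 \<otimes>\<^sub>a proj (Suc 0)) = \<mu>l \<cdot> (proj 0 \<otimes>\<^sub>a ?l) \<cdot> \<alpha> TC TC TC"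
        unfolding mul_0_def by (subst L[of _ _ _ HO], simp, simp, subst R[of _ _ _ N], simp, simp)
            (simp only: T_0_1 M_bimodule)
      have 2: "\<mu>r \<cdot> (?l \<otimes>\<^sub>a proj 0) = \<mu>l \<cdot> (proj 0 \<otimes>\<^sub>a ?r) \<cdot> \<alpha> TC TC TC"
        by (subst L[of _ _ _ N], simp, simp, subst R[of _ _ _ N], simp, simp)
            (simp only: T_0_1 M_bimodule)
      have 3: "\<mu>r \<cdot> (?r \<otimes>\<^sub>a proj 0) = \<mu>r \<cdot> (proj (Suc 0) \<otimes>\<^sub>a mul_0) \<cdot> \<alpha> TC TC TC"
        unfolding mul_0_def by (subst L[of _ _ _ N], simp, simp, subst R[of _ _ _ HO], simp, simp)
            (simp only: T_0_1 M_bimodule)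
      have "proj (Suc 0) \<cdot> (mulT \<cdot> (mulT \<otimes>\<^sub>a \<^bold>1 TC))
        = \<mu>l \<cdot> (mul_0 \<otimes>\<^sub>a proj (Suc 0)) \<boxplus> (\<mu>r \<cdot> (?l \<otimes>\<^sub>a proj 0) \<boxplus> \<mu>r \<cdot> (?r \<otimes>\<^sub>a proj 0))"
        by (simp add: proj_mulT mulT) (simp add: mul_1_def tensor_add compose_add)
      also have "\<dots> = (\<mu>l \<cdot> (mul_0 \<otimes>\<^sub>a proj (Suc 0)) \<boxplus> \<mu>r \<cdot> (?l \<otimes>\<^sub>a proj 0)) \<boxplus> \<mu>r \<cdot> (?r \<otimes>\<^sub>a proj 0)"
        by (rule add_assoc[of _ "(TC \<otimes>\<^sub>o TC) \<otimes>\<^sub>o TC" N, symmetric]) simp_all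
      also have "\<dots> = (\<mu>l \<cdot> (proj 0 \<otimes>\<^sub>a mul_1) \<boxplus> \<mu>r \<cdot> (proj (Suc 0) \<otimes>\<^sub>a mul_0)) \<cdot> \<alpha> TC TC TC"
        unfolding 1 2 3 by (simp add: mul_1_def tensor_add compose_add)
      also have "\<dots> = (proj (Suc 0) \<cdot> ?g) \<cdot> \<alpha> TC TC TC"
        by (simp add: proj_mulT mulT)
      finally show ?thesis by simp
    qed
  qed simp_all
  thus ?thesis by (simp add: lw_def rw_def)
qed

text \<open>Both sides respect the comultiplication of a product with \<open>\<I>\<close>, so only
  degrees 0 and 1 remain. In degree 1 the term containing \<open>proj (Suc 0) \<cdot> unitT\<close>
  is zero, and the unit law of one action is left.\<close>

lemma mulT_unit:
  "mulT \<cdot> unitT \<rhd> TC = \<l> TC" "mulT \<cdot> TC \<lhd> unitT = \<r> TC"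
proof -
  note [simp] = proj_mulT unitT(2,3)
  have "mulT \<cdot> (unitT \<otimes>\<^sub>a \<^bold>1 TC) = \<l> TC"
  proof (rule coalgebra_hom_unique)
    let ?\<delta> = "tensor_comul \<I> (left_unitor_inv \<I>) TC comulT"
    show "?\<delta> \<in> Hom C (\<I> \<otimes>\<^sub>o TC) ((\<I> \<otimes>\<^sub>o TC) \<otimes>\<^sub>o (\<I> \<otimes>\<^sub>o TC))" by simp
    show "comulT \<cdot> (mulT \<cdot> (unitT \<otimes>\<^sub>a \<^bold>1 TC)) = ((mulT \<cdot> (unitT \<otimes>\<^sub>a \<^bold>1 TC)) \<otimes>\<^sub>a (mulT \<cdot>
        (unitT \<otimes>\<^sub>a \<^bold>1 TC))) \<cdot> ?\<delta>"
      by (rule mulT_comul) (simp_all add: unitT(1))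
    show "comulT \<cdot> \<l> TC = (\<l> TC \<otimes>\<^sub>a \<l> TC) \<cdot> ?\<delta>"
      by (rule unitor_comul_hom) simp_all
    have "mH \<cdot> (uH \<otimes>\<^sub>a proj 0) = (mH \<cdot> uH \<rhd> HO) \<cdot> \<I> \<lhd> proj 0"
      by (simp add: lw_def rw_def compose_tensor)
    thus "proj 0 \<cdot> (mulT \<cdot> (unitT \<otimes>\<^sub>a \<^bold>1 TC)) = proj 0 \<cdot> \<l> TC"
      using unitor_natural(1)[of "proj 0"] by (simp add: H_algebra)
    have "\<mu>l \<cdot> (uH \<otimes>\<^sub>a proj (Suc 0)) = (\<mu>l \<cdot> uH \<rhd> N) \<cdot> \<I> \<lhd> proj (Suc 0)"
      by (simp add: lw_def rw_def compose_tensor)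
    thus "proj (Suc 0) \<cdot> (mulT \<cdot> (unitT \<otimes>\<^sub>a \<^bold>1 TC)) = proj (Suc 0) \<cdot> \<l> TC"
      using unitor_natural(1)[of "proj (Suc 0)"] by (simp add: M_bimodule)
  qed simp_all
  thus "mulT \<cdot> unitT \<rhd> TC = \<l> TC" by (simp add: rw_def)
  have "mulT \<cdot> (\<^bold>1 TC \<otimes>\<^sub>a unitT) = \<r> TC"
  proof (rule coalgebra_hom_unique)
    let ?\<delta> = "tensor_comul TC comulT \<I> (left_unitor_inv \<I>)"
    show "?\<delta> \<in> Hom C (TC \<otimes>\<^sub>o \<I>) ((TC \<otimes>\<^sub>o \<I>) \<otimes>\<^sub>o (TC \<otimes>\<^sub>o \<I>))" by simp
    show "comulT \<cdot> (mulT \<cdot> (\<^bold>1 TC \<otimes>\<^sub>a unitT)) = ((mulT \<cdot> (\<^bold>1 TC \<otimes>\<^sub>a unitT)) \<otimes>\<^sub>a (mulT \<cdot>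
        (\<^bold>1 TC \<otimes>\<^sub>a unitT))) \<cdot> ?\<delta>"
      by (rule mulT_comul) (simp_all add: unitT(1))
    show "comulT \<cdot> \<r> TC = (\<r> TC \<otimes>\<^sub>a \<r> TC) \<cdot> ?\<delta>"
      by (rule unitor_comul_hom) simp_all
    have "mH \<cdot> (proj 0 \<otimes>\<^sub>a uH) = (mH \<cdot> HO \<lhd> uH) \<cdot> proj 0 \<rhd> \<I>"
      by (simp add: lw_def rw_def compose_tensor)
    thus "proj 0 \<cdot> (mulT \<cdot> (\<^bold>1 TC \<otimes>\<^sub>a unitT)) = proj 0 \<cdot> \<r> TC"
      using unitor_natural(2)[of "proj 0"] by (simp add: H_algebra)
    have "\<mu>r \<cdot> (proj (Suc 0) \<otimes>\<^sub>a uH) = (\<mu>r \<cdot> N \<lhd> uH) \<cdot> proj (Suc 0) \<rhd> \<I>"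
      by (simp add: lw_def rw_def compose_tensor)
    thus "proj (Suc 0) \<cdot> (mulT \<cdot> (\<^bold>1 TC \<otimes>\<^sub>a unitT)) = proj (Suc 0) \<cdot> \<r> TC"
      using unitor_natural(2)[of "proj (Suc 0)"] by (simp add: M_bimodule)
  qed simp_all
  thus "mulT \<cdot> TC \<lhd> unitT = \<r> TC" by (simp add: lw_def)
qed

section \<open>Gradings of the tensor square, the multiplication and the comultiplication\<close>

abbreviation TT :: "nat \<Rightarrow> 'o" where "TT \<equiv> tensor_degree C T T"
abbreviation incTT :: "nat \<Rightarrow> 'a" where "incTT \<equiv> tensor_inj C T TC inc T TC inc"
abbreviation inc2 :: "nat \<Rightarrow> nat \<times> nat \<Rightarrow> 'a" where "inc2 n \<equiv> snd (tensor_degree_sum C T T n)"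

lemma TT_coproduct: "is_coproduct C {(a, b). a + b = n} (\<lambda>(a, b). T a \<otimes>\<^sub>o T b) (TT n) (inc2 n)"
  unfolding tensor_degree_def tensor_degree_sum_def
  by (rule countable_coproduct[of prod_encode]) (auto intro: inj_on_subset[OF inj_prod_encode])

lemma TT_simps [simp]:
  "TT n \<in> Ob C" "a + b = n \<Longrightarrow> inc2 n (a, b) \<in> Ar C" "a + b = n \<Longrightarrow> Dom C (inc2 n (a, b)) = T a \<otimes>\<^sub>o T b"
  "a + b = n \<Longrightarrow> Cod C (inc2 n (a, b)) = TT n"
  using coproduct_simps[OF TT_coproduct[of n]] by (simp, force+)

lemma incTT_spec:
  "incTT n \<in> Hom C (TT n) (TC \<otimes>\<^sub>o TC)" "a + b = n \<Longrightarrow> incTT n \<cdot> inc2 n (a, b) = inc a \<otimes>\<^sub>a inc b"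
proof -
  have "\<exists>!h. h \<in> Hom C (TT n) (TC \<otimes>\<^sub>o TC) \<and> (\<forall>j\<in>{(a, b). a + b = n}. h \<cdot> inc2 n j =
      (\<lambda>(a, b). inc a \<otimes>\<^sub>a inc b) j)"
    by (rule coproduct_univ[OF TT_coproduct]) auto
  hence "\<exists>!h. h \<in> Hom C (TT n) (TC \<otimes>\<^sub>o TC) \<and> (\<forall>a b. a + b = n \<longrightarrow> h \<cdot> inc2 n (a, b) = inc a \<otimes>\<^sub>a inc b)"
    unfolding Ball_def by simp
  from theI'[OF this] show "incTT n \<in> Hom C (TT n) (TC \<otimes>\<^sub>o TC)"
    "a + b = n \<Longrightarrow> incTT n \<cdot> inc2 n (a, b) = inc a \<otimes>\<^sub>a inc b"
    unfolding tensor_inj_def by blast+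
qed

lemma incTT_simps [simp]: "incTT n \<in> Ar C" "Dom C (incTT n) = TT n" "Cod C (incTT n) = TC \<otimes>\<^sub>o TC"
  using incTT_spec(1)[of n] by simp_all

text \<open>The direct sum over all pairs is regrouped by total degree: existence and uniqueness
  reduce to \<open>TC_pair_coproduct\<close> and, within one degree, to
  \<open>TT_coproduct\<close>.\<close>

lemma grading_TT: "is_grading C TT (TC \<otimes>\<^sub>o TC) incTT"
  unfolding is_grading_def
proof (rule coproductI)
  fix Y f assume Y: "Y \<in> Ob C" and f: "\<And>n. n \<in> UNIV \<Longrightarrow> f n \<in> Hom C (TT n) Y"
  have "\<exists>h \<in> Hom C (TC \<otimes>\<^sub>o TC) Y. \<forall>j\<in>UNIV. h \<cdot> (\<lambda>(a, b). inc a \<otimes>\<^sub>a inc b) j = (\<lambda>(a, b). f (a + b)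
      \<cdot> inc2 (a + b) (a, b)) j"
    by (rule coproduct_desc[OF TC_pair_coproduct Y]) (use f in auto)
  then obtain h where h: "h \<in> Hom C (TC \<otimes>\<^sub>o TC) Y" "\<And>a b. h \<cdot> (inc a \<otimes>\<^sub>a inc b) = f (a + b) \<cdot> inc2
      (a + b) (a, b)"
    by auto
  have "h \<cdot> incTT n = f n" for n
  proof (rule coproduct_ext[OF TT_coproduct])
    fix j assume "j \<in> {(a, b). a + b = n}"
    then obtain a b where ab: "j = (a, b)" "a + b = n" by auto
    show "(h \<cdot> incTT n) \<cdot> inc2 n j = f n \<cdot> inc2 n j"
      using h ab incTT_spec(2)[of a b n] by simp
  qed (use h(1) f in simp_all)
  thus "\<exists>h\<in>Hom C (TC \<otimes>\<^sub>o TC) Y. \<forall>n\<in>UNIV. h \<cdot> incTT n = f n" using h(1) by blast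
next
  fix f g assume fg: "f \<in> Ar C" "g \<in> Ar C" "Dom C f = TC \<otimes>\<^sub>o TC" "Dom C g = TC \<otimes>\<^sub>o TC" "Cod C f
      = Cod C g"
    and eq: "\<And>n. n \<in> UNIV \<Longrightarrow> f \<cdot> incTT n = g \<cdot> incTT n"
  show "f = g"
  proof (rule coproduct_ext[OF TC_pair_coproduct])
    fix j :: "nat \<times> nat"
    obtain a b where j: "j = (a, b)" by (cases j)
    have "(f \<cdot> incTT (a + b)) \<cdot> inc2 (a + b) (a, b) = (g \<cdot> incTT (a + b)) \<cdot> inc2 (a + b) (a, b)"
      using eq[of "a + b"] by simp
    thus "f \<cdot> (case j of (a, b) \<Rightarrow> inc a \<otimes>\<^sub>a inc b) = g \<cdot> (case j of (a, b) \<Rightarrow> inc a \<otimes>\<^sub>a inc b)"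
      using fg incTT_spec(2)[of a b "a + b"] j by simp
  qed (use fg in simp_all)
qed simp_all

lemma grading_T: "is_grading C T TC inc"
  unfolding is_grading_def by (rule TC_coproduct)

text \<open>The component in degree \<open>n\<close> is read off with \<open>proj n\<close>;
  homogeneity of \<open>mulT\<close> on the summands says that no other part occurs.\<close>

lemma graded_mulT: "is_graded_morphism C TT (TC \<otimes>\<^sub>o TC) incTT T TC inc mulT"
  unfolding is_graded_morphism_def
proof (intro conjI allI grading_TT grading_T)
  fix n
  have "mulT \<cdot> incTT n = inc n \<cdot> (proj n \<cdot> (mulT \<cdot> incTT n))"
  proof (rule coproduct_ext[OF TT_coproduct])
    fix j assume "j \<in> {(a, b). a + b = n}"
    then obtain a b where ab: "j = (a, b)" "a + b = n" by auto
    show "(mulT \<cdot> incTT n) \<cdot> inc2 n j = (inc n \<cdot> (proj n \<cdot> (mulT \<cdot> incTT n))) \<cdot> inc2 n j"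
      using ab incTT_spec(2)[of a b n] mulT(5)[of a b] by simp
  qed simp_all
  thus "\<exists>fn\<in>Hom C (TT n) (T n). mulT \<cdot> incTT n = inc n \<cdot> fn"
    by (intro bexI[of _ "proj n \<cdot> (mulT \<cdot> incTT n)"]) simp_all
qed simp_all

text \<open>Factoring through the part of degree \<open>n\<close> is stable under sums, so it
  suffices to treat the summands, each of which lies in one bidegree
  \<open>(s, n - s)\<close>.\<close>

lemma graded_comulT: "is_graded_morphism C T TC inc TT (TC \<otimes>\<^sub>o TC) incTT comulT"
  unfolding is_graded_morphism_def
proof (intro conjI allI grading_TT grading_T)
  fix n
  show "\<exists>fn\<in>Hom C (T n) (TT n). comulT \<cdot> inc n = incTT n \<cdot> fn"
  proof (rule comulT_inc_induct[of n "\<lambda>x. \<exists>fn\<in>Hom C (T n) (TT n). x = incTT n \<cdot> fn"])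
    fix s assume s: "s \<le> n"
    have "incTT n \<cdot> (inc2 n (s, n - s) \<cdot> D s (n - s)) = comul_summand n s"
      using s by (intro compose_reduce[OF incTT_spec(2)]) simp_all
    thus "\<exists>fn\<in>Hom C (T n) (TT n). comul_summand n s = incTT n \<cdot> fn"
      using s by (intro bexI[of _ "inc2 n (s, n - s) \<cdot> D s (n - s)"]) simp_all
  next
    show "\<exists>fn\<in>Hom C (T n) (TT n). zero_ar C (T n) (TC \<otimes>\<^sub>o TC) = incTT n \<cdot> fn"
      by (intro bexI[of _ "zero_ar C (T n) (TT n)"]) simp_all
    fix g h assume "\<exists>fn\<in>Hom C (T n) (TT n). g = incTT n \<cdot> fn" "\<exists>fn\<in>Hom C (T n) (TT n). h = incTT n
        \<cdot> fn"
    then obtain g' h' where "g' \<in> Hom C (T n) (TT n)" "g = incTT n \<cdot> g'" "h' \<in> Hom C (T n) (TT n)"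
        "h = incTT n \<cdot> h'"
      by blast
    thus "\<exists>fn\<in>Hom C (T n) (TT n). g \<boxplus> h = incTT n \<cdot> fn"
      by (intro bexI[of _ "g' \<boxplus> h'"]) (simp_all add: compose_add)
  qed
qed simp_all

section \<open>Assembly of the graded braided bialgebra\<close>

abbreviation Tc :: "('o, 'a) coalgebra" where "Tc \<equiv> cotensor_coalgebra C H M"

lemma Tc_simps [simp]: "carr Tc = TC" "comul Tc = comulT" "counit Tc = counit H \<cdot> proj 0"
  by (simp_all add: cotensor_coalgebra_def)

lemma tensor_Tc_simps [simp]:
  "carr (tensor_coalgebra C Tc Tc) = TC \<otimes>\<^sub>o TC" "comul (tensor_coalgebra C Tc Tc) = comulTT"
  "counit (tensor_coalgebra C Tc Tc) = \<l> \<I> \<cdot> (counit Tc \<otimes>\<^sub>a counit Tc)"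
  by (simp_all add: tensor_coalgebra_def tensor_comul_def)

text \<open>The counit factors through \<open>proj 0\<close>, where the multiplication is that of
  \<open>H\<close>; so the multiplicativity of the counit of \<open>H\<close> decides.\<close>

lemma counit_mulT: "counit Tc \<cdot> mulT = \<l> \<I> \<cdot> (counit Tc \<otimes>\<^sub>a counit Tc)"
proof -
  have "counit Tc \<cdot> mulT = (counit H \<cdot> mH) \<cdot> (proj 0 \<otimes>\<^sub>a proj 0)"
    using mulT(3) by (simp add: mul_0_def)
  thus ?thesis unfolding H_bialgebra(2) by (simp add: compose_tensor)
qed

lemma coalgebra_hom_mulT: "is_coalgebra_hom C (tensor_coalgebra C Tc Tc) Tc mulT"
  unfolding is_coalgebra_hom_def
  using is_coalgebra_tensor[OF coalgebra_TC coalgebra_TC] coalgebra_TC mulT(2) counit_mulT by simp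

lemma counit_unitT: "counit Tc \<cdot> unitT = \<^bold>1 \<I>"
  using unitT(2) H_bialgebra(4) by simp

lemma coalgebra_hom_unitT: "is_coalgebra_hom C (unit_coalgebra C) Tc unitT"
  unfolding is_coalgebra_hom_def
  using is_coalgebra_unit coalgebra_TC unitT(1) counit_unitT by (simp add: unit_coalgebra_def)

text \<open>Existence and uniqueness in one equivalence, the shape in which the theorem quantifies
  over all candidates.\<close>

lemma mulT_unique:
  "(is_coalgebra_hom C (tensor_coalgebra C Tc Tc) Tc m
    \<and> proj 0 \<cdot> m = mH \<cdot> (proj 0 \<otimes>\<^sub>a proj 0)
    \<and> proj 1 \<cdot> m = (\<mu>l \<cdot> (proj 0 \<otimes>\<^sub>a proj 1)) \<boxplus> (\<mu>r \<cdot> (proj 1 \<otimes>\<^sub>a proj 0))) \<longleftrightarrow> m = mulT"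
proof
  assume m: "is_coalgebra_hom C (tensor_coalgebra C Tc Tc) Tc m
    \<and> proj 0 \<cdot> m = mH \<cdot> (proj 0 \<otimes>\<^sub>a proj 0)
    \<and> proj 1 \<cdot> m = (\<mu>l \<cdot> (proj 0 \<otimes>\<^sub>a proj 1)) \<boxplus> (\<mu>r \<cdot> (proj 1 \<otimes>\<^sub>a proj 0))"
  hence h: "m \<in> Hom C (TC \<otimes>\<^sub>o TC) TC" "comulT \<cdot> m = (m \<otimes>\<^sub>a m) \<cdot> comulTT"
    by (simp_all add: is_coalgebra_hom_def)
  show "m = mulT"
    by (rule coalgebra_hom_unique[OF _ h(1) mulT(1) h(2) mulT(2)])
      (use m in \<open>simp_all add: mulT(3,4) mul_0_def mul_1_def\<close>)
qed (use coalgebra_hom_mulT mulT(3,4) in \<open>simp add: mul_0_def mul_1_def\<close>)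

lemma unitT_unique:
  "(is_coalgebra_hom C (unit_coalgebra C) Tc u \<and> proj 0 \<cdot> u = uH \<and> proj 1 \<cdot> u = zero_ar C \<I> N) \<longleftrightarrow> u
      = unitT"
proof
  assume u: "is_coalgebra_hom C (unit_coalgebra C) Tc u \<and> proj 0 \<cdot> u = uH \<and> proj 1 \<cdot> u
      = zero_ar C \<I> N"
  hence h: "u \<in> Hom C \<I> TC" "comulT \<cdot> u = (u \<otimes>\<^sub>a u) \<cdot> left_unitor_inv \<I>"
    by (simp_all add: is_coalgebra_hom_def unit_coalgebra_def)
  show "u = unitT"
    by (rule coalgebra_hom_unique[OF _ h(1) _ h(2) unitT(1)]) (use u in \<open>simp_all add: unitT(2,3)\<close>)
qed (use coalgebra_hom_unitT unitT(2,3) in simp)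

lemma graded_bialgebra_Tc:
  "is_graded_braided_bialgebra C T inc \<lparr>carr = carr Tc, comul = comul Tc, counit = counit Tc, mul
      = mulT, unt = unitT\<rparr>"
proof -
  have a: "is_algebra C TC mulT unitT"
    unfolding is_algebra_def lw_def[symmetric] rw_def[symmetric]
    using mulT_assoc mulT_unit by simp
  have c: "is_coalgebra C \<lparr>carr = carr Tc, comul = comul Tc, counit = counit Tc, mul = mulT, unt
      = unitT\<rparr>"
    using coalgebra_TC by (simp add: is_coalgebra_def)
  show ?thesis
    unfolding is_graded_braided_bialgebra_def is_braided_bialgebra_def is_graded_algebra_def
        is_graded_coalgebra_def Let_def
    using a c grading_T graded_mulT graded_comulT mulT(2) counit_mulT unitT(1) counit_unitT
    by (simp add: tensor_comul_def)
qed

end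

theorem theorem4p5:
  fixes C :: "('o, 'a) braided_category" (structure)
    and H :: "('o, 'a) bialgebra"
    and M :: "('o, 'a) hopf_bimodule"
  assumes "infinite (UNIV :: 'i set)"
    and "braided_monoidal_category C"
    and "coabelian_monoidal_category C"
    and "cocomplete TYPE('i) C"
    and "complete TYPE('i) C"
    and "AB5 TYPE('i) C"
    and "tensor_preserves_direct_sums TYPE('i) C"
    and "is_braided_bialgebra C H"
    and "is_hopf_bimodule C H M"
  shows
    "let T = cotensor_coalgebra C H M;
         p = Tc_proj C H M
     in \<exists>m u.
       (\<forall>m'. (is_coalgebra_hom C (tensor_coalgebra C T T) T m'
              \<and> p 0 \<cdot> m' = mul H \<cdot> (p 0 \<otimes>\<^sub>a p 0)
              \<and> p 1 \<cdot> m' = (lact M \<cdot> (p 0 \<otimes>\<^sub>a p 1)) \<boxplus> (ract M \<cdot> (p 1 \<otimes>\<^sub>a p 0)))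
             \<longleftrightarrow> m' = m)
       \<and> (\<forall>u'. (is_coalgebra_hom C (unit_coalgebra C) T u'
              \<and> p 0 \<cdot> u' = unt H
              \<and> p 1 \<cdot> u' = zero_ar C \<I> (bic_ob M))
             \<longleftrightarrow> u' = u)
       \<and> is_graded_braided_bialgebra C (cotensor_power_ob C H M) (Tc_inj C H M)
           \<lparr>carr = carr T, comul = comul T, counit = counit T, mul = m, unt = u\<rparr>"
proof -
  \<comment> \<open>An infinite type of indices contains a copy of the natural numbers; this makes
    the countable diagrams used above small.\<close>
  obtain enc :: "nat \<Rightarrow> 'i" where "inj enc"
    using infinite_countable_subset[OF assms(1)] by blast
  interpret B: braided_monoidal_category C by fact
  interpret A: coabelian_monoidal_category C by fact
  interpret hopf_tower C enc H M
    by unfold_locales (use assms \<open>inj enc\<close> in \<open>simp_all add: is_hopf_bimodule_def Let_def\<close>)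
  show ?thesis
    unfolding Let_def
    by (intro exI[of _ mulT] exI[of _ unitT] conjI allI mulT_unique unitT_unique graded_bialgebra_Tc)
qed

end
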